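(* Let $p:B\to E$ be a homomorphism of non-trivial commutative rings with $1$, and let a group $G$ act on $E$ on the right via ring automorphisms with $p(b)g=p(b)$ for all $b\in B$, $g\in G$. Suppose that $p$ is a pure monomorphism of $B$-modules, that the map $h:E\otimes_BE\to GE$, $h(e\otimes e')(g)=(eg)e'$, is bijective (where $GE$ is the $E$-algebra of all maps from $G$ to $E$), and that $G$ is finite. Then the category of $B$-modules is equivalent to the category $Z^1(G,(E\text{-}\mathbf{Mod})^{\mathrm{op}})^{\mathrm{op}}$, which can be identified with the category of $E$-modules $D$ on which $G$ acts on the right via $B$-module automorphisms with $(ed)g=(eg)(dg)$ for all $e\in E$, $d\in D$, $g\in G$. Under this equivalence: (a) a $B$-module $A$ corresponds to the $E$-module $E\otimes_BA$, on which $G$ acts on the right via $B$-module automorphisms with $(e\otimes a)g=eg\otimes a$ for all $e\in E$, $a\in A$, $g\in G$; (b) an $E$-module $D$ equipped with a right $G$-action via $B$-module automorphisms satisfying $(ed)g=(eg)(dg)$ for all $e\in E$, $d\in D$, $g\in G$ corresponds to the $B$-module $D^G=\{d\in D\mid dg=d\text{ for all }g\in G\}$, where the scalar multiplication $B\times D^G\to D^G$ is induced by the scalar multiplication $B\times D_p\to D_p$.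
   Context: $D_p$ denotes the $E$-module $D$ regarded as a $B$-module via $p$. $p$ is a pure monomorphism of $B$-modules if $N\to N\otimes_BE$ is injective for every $B$-module $N$. $(E\text{-}\mathbf{Mod})^{\mathrm{op}}$ is a $G$-category via $g(D)=D_g$, where $D_g$ is $D$ as an abelian group with $e\in E$ acting on $d$ as $(eg)d$ computed in $D$, and $g(-)$ is the identity on underlying maps. In general a $G$-category is a category $\mathbf X$ equipped with functors $g(-):\mathbf X\to\mathbf X$ ($g\in G$) such that $1(-)=1_{\mathbf X}$ and $(hg)(-)=h(-)\,g(-)$. A $1$-cocycle $(X,\xi):G\to\mathbf X$ is an object $X$ with morphisms $\xi_g:g(X)\to X$ ($g\in G$) satisfying $\xi_1=1_X$ and $\xi_{hg}=\xi_h\,h(\xi_g)$; a morphism $f:(X,\xi)\to(X',\xi')$ is a morphism $f:X\to X'$ with $f\xi_g=\xi'_g\,g(f)$ for all $g$; these form the category $Z^1(G,\mathbf X)$. The identification in the theorem sends a cocycle $(D,\xi)$, with $\xi_g$ written as an $E$-module homomorphism $D\to D_g$, to $D$ with $dg=\xi_g(d)$; morphisms of the category of $E$-modules with such $G$-actions are the $E$-module homomorphisms preserving the $G$-action. *)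

theory Defs
  imports "HOL-Algebra.Module" "HOL-Algebra.QuotRing" "HOL-Algebra.Free_Abelian_Groups" "HOL-Library.Equipollence"
begin

section \<open>Categories, functors, equivalences\<close>

text \<open>Hom-sets of different pairs of objects need not be disjoint, so composition and the action of
  a functor on morphisms take the objects as arguments: \<open>Comp C X Y Z g f\<close> is \<open>g\<close> after \<open>f\<close>
  for \<open>f : X \<rightarrow> Y\<close> and \<open>g : Y \<rightarrow> Z\<close>.\<close>

record ('o, 'm) category =
  Obj :: "'o set"
  Hom :: "'o \<Rightarrow> 'o \<Rightarrow> 'm set"
  Ident :: "'o \<Rightarrow> 'm"
  Comp :: "'o \<Rightarrow> 'o \<Rightarrow> 'o \<Rightarrow> 'm \<Rightarrow> 'm \<Rightarrow> 'm"

locale category =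
  fixes C :: "('o, 'm) category"
  assumes Ident_in_Hom: "X \<in> Obj C \<Longrightarrow> Ident C X \<in> Hom C X X"
    and Comp_in_Hom:
      "\<lbrakk>X \<in> Obj C; Y \<in> Obj C; Z \<in> Obj C; f \<in> Hom C X Y; g \<in> Hom C Y Z\<rbrakk>
        \<Longrightarrow> Comp C X Y Z g f \<in> Hom C X Z"
    and Comp_Ident_left:
      "\<lbrakk>X \<in> Obj C; Y \<in> Obj C; f \<in> Hom C X Y\<rbrakk> \<Longrightarrow> Comp C X Y Y (Ident C Y) f = f"
    and Comp_Ident_right:
      "\<lbrakk>X \<in> Obj C; Y \<in> Obj C; f \<in> Hom C X Y\<rbrakk> \<Longrightarrow> Comp C X X Y f (Ident C X) = f"
    and Comp_assoc:
      "\<lbrakk>W \<in> Obj C; X \<in> Obj C; Y \<in> Obj C; Z \<in> Obj C;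
        f \<in> Hom C W X; g \<in> Hom C X Y; h \<in> Hom C Y Z\<rbrakk>
        \<Longrightarrow> Comp C W Y Z h (Comp C W X Y g f) = Comp C W X Z (Comp C X Y Z h g) f"

definition op_cat :: "('o, 'm) category \<Rightarrow> ('o, 'm) category" where
  "op_cat C = \<lparr>Obj = Obj C, Hom = (\<lambda>X Y. Hom C Y X), Ident = Ident C,
     Comp = (\<lambda>X Y Z g f. Comp C Z Y X f g)\<rparr>"

record ('o, 'm, 'p, 'n) funct =
  FObj :: "'o \<Rightarrow> 'p"
  FHom :: "'o \<Rightarrow> 'o \<Rightarrow> 'm \<Rightarrow> 'n"

locale is_functor = source: category C + target: category D
  for C :: "('o, 'm) category" and D :: "('p, 'n) category" +
  fixes F :: "('o, 'm, 'p, 'n) funct"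
  assumes FObj_in_Obj: "X \<in> Obj C \<Longrightarrow> FObj F X \<in> Obj D"
    and FHom_in_Hom:
      "\<lbrakk>X \<in> Obj C; Y \<in> Obj C; f \<in> Hom C X Y\<rbrakk> \<Longrightarrow> FHom F X Y f \<in> Hom D (FObj F X) (FObj F Y)"
    and FHom_Ident: "X \<in> Obj C \<Longrightarrow> FHom F X X (Ident C X) = Ident D (FObj F X)"
    and FHom_Comp:
      "\<lbrakk>X \<in> Obj C; Y \<in> Obj C; Z \<in> Obj C; f \<in> Hom C X Y; g \<in> Hom C Y Z\<rbrakk>
        \<Longrightarrow> FHom F X Z (Comp C X Y Z g f) =
            Comp D (FObj F X) (FObj F Y) (FObj F Z) (FHom F Y Z g) (FHom F X Y f)"

definition id_funct :: "('o, 'm, 'o, 'm) funct" where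
  "id_funct = \<lparr>FObj = (\<lambda>X. X), FHom = (\<lambda>X Y f. f)\<rparr>"

definition comp_funct ::
    "('p, 'n, 'q, 'k) funct \<Rightarrow> ('o, 'm, 'p, 'n) funct \<Rightarrow> ('o, 'm, 'q, 'k) funct" where
  "comp_funct H F = \<lparr>FObj = (\<lambda>X. FObj H (FObj F X)),
     FHom = (\<lambda>X Y f. FHom H (FObj F X) (FObj F Y) (FHom F X Y f))\<rparr>"

definition eq_funct ::
    "('o, 'm) category \<Rightarrow> ('o, 'm, 'p, 'n) funct \<Rightarrow> ('o, 'm, 'p, 'n) funct \<Rightarrow> bool" where
  "eq_funct C F H \<longleftrightarrow> (\<forall>X\<in>Obj C. FObj F X = FObj H X) \<and>
     (\<forall>X\<in>Obj C. \<forall>Y\<in>Obj C. \<forall>f\<in>Hom C X Y. FHom F X Y f = FHom H X Y f)"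

definition is_iso :: "('o, 'm) category \<Rightarrow> 'o \<Rightarrow> 'o \<Rightarrow> 'm \<Rightarrow> bool" where
  "is_iso C X Y f \<longleftrightarrow> f \<in> Hom C X Y \<and>
     (\<exists>g\<in>Hom C Y X. Comp C X Y X g f = Ident C X \<and> Comp C Y X Y f g = Ident C Y)"

definition natural_iso ::
    "('o, 'm) category \<Rightarrow> ('p, 'n) category \<Rightarrow> ('o, 'm, 'p, 'n) funct \<Rightarrow> ('o, 'm, 'p, 'n) funct
      \<Rightarrow> ('o \<Rightarrow> 'n) \<Rightarrow> bool" where
  "natural_iso C D F H \<tau> \<longleftrightarrow>
     (\<forall>X\<in>Obj C. is_iso D (FObj F X) (FObj H X) (\<tau> X)) \<and>
     (\<forall>X\<in>Obj C. \<forall>Y\<in>Obj C. \<forall>f\<in>Hom C X Y.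
        Comp D (FObj F X) (FObj F Y) (FObj H Y) (\<tau> Y) (FHom F X Y f) =
        Comp D (FObj F X) (FObj H X) (FObj H Y) (FHom H X Y f) (\<tau> X))"

definition cat_equivalence ::
    "('o, 'm) category \<Rightarrow> ('p, 'n) category \<Rightarrow> ('o, 'm, 'p, 'n) funct \<Rightarrow> ('p, 'n, 'o, 'm) funct
      \<Rightarrow> bool" where
  "cat_equivalence C D F H \<longleftrightarrow> is_functor C D F \<and> is_functor D C H \<and>
     (\<exists>\<eta>. natural_iso C C id_funct (comp_funct H F) \<eta>) \<and>
     (\<exists>\<epsilon>. natural_iso D D (comp_funct F H) id_funct \<epsilon>)"

definition cat_isomorphism ::
    "('o, 'm) category \<Rightarrow> ('p, 'n) category \<Rightarrow> ('o, 'm, 'p, 'n) funct \<Rightarrow> bool" where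
  "cat_isomorphism C D J \<longleftrightarrow> is_functor C D J \<and> bij_betw (FObj J) (Obj C) (Obj D) \<and>
     (\<forall>X\<in>Obj C. \<forall>Y\<in>Obj C. bij_betw (FHom J X Y) (Hom C X Y) (Hom D (FObj J X) (FObj J Y)))"

section \<open>G-categories and 1-cocycles\<close>

locale G_category = group G + category X
  for G :: "'g monoid" and X :: "('o, 'm) category" +
  fixes T :: "'g \<Rightarrow> ('o, 'm, 'o, 'm) funct"
  assumes T_functor: "g \<in> carrier G \<Longrightarrow> is_functor X X (T g)"
    and T_one: "eq_funct X (T \<one>\<^bsub>G\<^esub>) id_funct"
    and T_mult: "\<lbrakk>h \<in> carrier G; g \<in> carrier G\<rbrakk>
      \<Longrightarrow> eq_funct X (T (h \<otimes>\<^bsub>G\<^esub> g)) (comp_funct (T h) (T g))"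

definition cocycle_cat ::
    "'g monoid \<Rightarrow> ('o, 'm) category \<Rightarrow> ('g \<Rightarrow> ('o, 'm, 'o, 'm) funct)
      \<Rightarrow> ('o \<times> ('g \<Rightarrow> 'm), 'm) category" where
  "cocycle_cat G X T = \<lparr>
     Obj = {(Y, \<xi>). Y \<in> Obj X \<and> \<xi> \<in> (\<Pi>\<^sub>E g\<in>carrier G. Hom X (FObj (T g) Y) Y) \<and>
       \<xi> \<one>\<^bsub>G\<^esub> = Ident X Y \<and>
       (\<forall>h\<in>carrier G. \<forall>g\<in>carrier G. \<xi> (h \<otimes>\<^bsub>G\<^esub> g) =
          Comp X (FObj (T h) (FObj (T g) Y)) (FObj (T h) Y) Y
            (\<xi> h) (FHom (T h) (FObj (T g) Y) Y (\<xi> g)))},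
     Hom = (\<lambda>(Y, \<xi>) (Y', \<xi>'). {f \<in> Hom X Y Y'. \<forall>g\<in>carrier G.
       Comp X (FObj (T g) Y) Y Y' f (\<xi> g) =
       Comp X (FObj (T g) Y) (FObj (T g) Y') Y' (\<xi>' g) (FHom (T g) Y Y' f)}),
     Ident = (\<lambda>(Y, \<xi>). Ident X Y),
     Comp = (\<lambda>(Y, \<xi>) (Y', \<xi>') (Y'', \<xi>''). Comp X Y Y' Y'')\<rparr>"

section \<open>Modules\<close>

text \<open>The operations of a record are total functions.  \<open>mk_module\<close> erases their values outside the
  carriers, together with the fields \<open>mult\<close> and \<open>one\<close> that a module does not use, so that equality of
  such records is equality of modules (the equations between functors in a G-category are strict).\<close>

definition mk_module ::
    "'r ring \<Rightarrow> 'a set \<Rightarrow> ('a \<Rightarrow> 'a \<Rightarrow> 'a) \<Rightarrow> 'a \<Rightarrow> ('r \<Rightarrow> 'a \<Rightarrow> 'a) \<Rightarrow> ('r, 'a) module" where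
  "mk_module R S pls z sm = \<lparr>carrier = S, mult = undefined, one = undefined, ring.zero = z,
     add = (\<lambda>x\<in>S. \<lambda>y\<in>S. pls x y), smult = (\<lambda>r\<in>carrier R. \<lambda>x\<in>S. sm r x)\<rparr>"

definition strict_module :: "'r ring \<Rightarrow> ('r, 'a) module \<Rightarrow> bool" where
  "strict_module R M \<longleftrightarrow> module R M \<and> mk_module R (carrier M) (add M) (ring.zero M) (smult M) = M"

definition mod_hom :: "'r ring \<Rightarrow> ('r, 'a) module \<Rightarrow> ('r, 'c) module \<Rightarrow> ('a \<Rightarrow> 'c) set" where
  "mod_hom R M N = {f \<in> carrier M \<rightarrow>\<^sub>E carrier N.
     (\<forall>x\<in>carrier M. \<forall>y\<in>carrier M. f (x \<oplus>\<^bsub>M\<^esub> y) = f x \<oplus>\<^bsub>N\<^esub> f y) \<and>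
     (\<forall>r\<in>carrier R. \<forall>x\<in>carrier M. f (r \<odot>\<^bsub>M\<^esub> x) = r \<odot>\<^bsub>N\<^esub> f x)}"

definition mod_auto :: "'r ring \<Rightarrow> ('r, 'a) module \<Rightarrow> ('a \<Rightarrow> 'a) set" where
  "mod_auto R M = {f \<in> mod_hom R M M. bij_betw f (carrier M) (carrier M)}"

text \<open>The category of the \<open>R\<close>-modules whose carrier is a subset of the type \<open>'a\<close>.\<close>

definition module_cat :: "'r ring \<Rightarrow> (('r, 'a) module, 'a \<Rightarrow> 'a) category" where
  "module_cat R = \<lparr>Obj = {M. strict_module R M}, Hom = mod_hom R,
     Ident = (\<lambda>M. \<lambda>x\<in>carrier M. x), Comp = (\<lambda>L M N g f. compose (carrier L) g f)\<rparr>"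

definition self_module :: "'r ring \<Rightarrow> ('r, 'r) module" where
  "self_module R = mk_module R (carrier R) (add R) (ring.zero R) (mult R)"

definition restrict_scalars ::
    "'b ring \<Rightarrow> ('b \<Rightarrow> 'e) \<Rightarrow> ('e, 'a) module \<Rightarrow> ('b, 'a) module" where
  "restrict_scalars B p D =
     mk_module B (carrier D) (add D) (ring.zero D) (\<lambda>b d. p b \<odot>\<^bsub>D\<^esub> d)"

section \<open>Tensor products over a commutative ring\<close>

text \<open>The tensor product is the free abelian group on the product of the carriers modulo the bilinearity
  relations; as usual for \<open>free_Abelian_group\<close>, the group is written multiplicatively.\<close>

definition tensor_rels ::
    "'b ring \<Rightarrow> ('b, 'm) module \<Rightarrow> ('b, 'n) module \<Rightarrow> (('m \<times> 'n) \<Rightarrow>\<^sub>0 int) set" where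
  "tensor_rels B M N =
     {frag_of (x \<oplus>\<^bsub>M\<^esub> x', y) - frag_of (x, y) - frag_of (x', y) | x x' y.
        x \<in> carrier M \<and> x' \<in> carrier M \<and> y \<in> carrier N} \<union>
     {frag_of (x, y \<oplus>\<^bsub>N\<^esub> y') - frag_of (x, y) - frag_of (x, y') | x y y'.
        x \<in> carrier M \<and> y \<in> carrier N \<and> y' \<in> carrier N} \<union>
     {frag_of (b \<odot>\<^bsub>M\<^esub> x, y) - frag_of (x, b \<odot>\<^bsub>N\<^esub> y) | b x y.
        b \<in> carrier B \<and> x \<in> carrier M \<and> y \<in> carrier N}"

definition tensor_kernel ::
    "'b ring \<Rightarrow> ('b, 'm) module \<Rightarrow> ('b, 'n) module \<Rightarrow> (('m \<times> 'n) \<Rightarrow>\<^sub>0 int) set" where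
  "tensor_kernel B M N =
     generate (free_Abelian_group (carrier M \<times> carrier N)) (tensor_rels B M N)"

definition tensor_group ::
    "'b ring \<Rightarrow> ('b, 'm) module \<Rightarrow> ('b, 'n) module \<Rightarrow> (('m \<times> 'n) \<Rightarrow>\<^sub>0 int) set monoid" where
  "tensor_group B M N = free_Abelian_group (carrier M \<times> carrier N) Mod tensor_kernel B M N"

definition pure_tensor ::
    "'b ring \<Rightarrow> ('b, 'm) module \<Rightarrow> ('b, 'n) module \<Rightarrow> 'm \<Rightarrow> 'n \<Rightarrow> (('m \<times> 'n) \<Rightarrow>\<^sub>0 int) set" where
  "pure_tensor B M N x y =
     tensor_kernel B M N #>\<^bsub>free_Abelian_group (carrier M \<times> carrier N)\<^esub> frag_of (x, y)"

text \<open>The homomorphism out of the tensor product induced by a balanced biadditive map \<open>\<phi>\<close> into an abelian group;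
  it exists and is unique by the lemma below.\<close>

definition tensor_lift ::
    "'b ring \<Rightarrow> ('b, 'm) module \<Rightarrow> ('b, 'n) module \<Rightarrow> ('h, 'z) monoid_scheme \<Rightarrow> ('m \<Rightarrow> 'n \<Rightarrow> 'h)
      \<Rightarrow> (('m \<times> 'n) \<Rightarrow>\<^sub>0 int) set \<Rightarrow> 'h" where
  "tensor_lift B M N H \<phi> = (THE f.
     f \<in> hom (tensor_group B M N) H \<and> f \<in> extensional (carrier (tensor_group B M N)) \<and>
     (\<forall>x\<in>carrier M. \<forall>y\<in>carrier N. f (pure_tensor B M N x y) = \<phi> x y))"

lemma tensor_lift:
  fixes M :: "('b, 'm) module" and N :: "('b, 'n) module"
  assumes M: "module B M" and N: "module B N" and H: "comm_group H"
    and closed: "\<And>x y. \<lbrakk>x \<in> carrier M; y \<in> carrier N\<rbrakk> \<Longrightarrow> \<phi> x y \<in> carrier H"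
    and add_left: "\<And>x x' y. \<lbrakk>x \<in> carrier M; x' \<in> carrier M; y \<in> carrier N\<rbrakk>
      \<Longrightarrow> \<phi> (x \<oplus>\<^bsub>M\<^esub> x') y = \<phi> x y \<otimes>\<^bsub>H\<^esub> \<phi> x' y"
    and add_right: "\<And>x y y'. \<lbrakk>x \<in> carrier M; y \<in> carrier N; y' \<in> carrier N\<rbrakk>
      \<Longrightarrow> \<phi> x (y \<oplus>\<^bsub>N\<^esub> y') = \<phi> x y \<otimes>\<^bsub>H\<^esub> \<phi> x y'"
    and balanced: "\<And>b x y. \<lbrakk>b \<in> carrier B; x \<in> carrier M; y \<in> carrier N\<rbrakk>
      \<Longrightarrow> \<phi> (b \<odot>\<^bsub>M\<^esub> x) y = \<phi> x (b \<odot>\<^bsub>N\<^esub> y)"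
  shows "tensor_lift B M N H \<phi> \<in> hom (tensor_group B M N) H"
    and "\<And>x y. \<lbrakk>x \<in> carrier M; y \<in> carrier N\<rbrakk>
      \<Longrightarrow> tensor_lift B M N H \<phi> (pure_tensor B M N x y) = \<phi> x y"
    and "\<And>f. \<lbrakk>f \<in> hom (tensor_group B M N) H; f \<in> extensional (carrier (tensor_group B M N));
        \<forall>x\<in>carrier M. \<forall>y\<in>carrier N. f (pure_tensor B M N x y) = \<phi> x y\<rbrakk>
      \<Longrightarrow> f = tensor_lift B M N H \<phi>"
proof -
  interpret M: module B M by (rule M)
  interpret N: module B N by (rule N)
  interpret H: comm_group H by (rule H)
  let ?S = "carrier M \<times> carrier N"
  let ?F = "free_Abelian_group ?S"
  let ?K = "tensor_kernel B M N"
  let ?T = "tensor_group B M N"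
  let ?P = "\<lambda>f. f \<in> hom ?T H \<and> f \<in> extensional (carrier ?T) \<and>
     (\<forall>x\<in>carrier M. \<forall>y\<in>carrier N. f (pure_tensor B M N x y) = \<phi> x y)"
  interpret F: comm_group ?F by (rule abelian_free_Abelian_group)
  have rels: "tensor_rels B M N \<subseteq> carrier ?F"
    by (auto simp: tensor_rels_def carrier_free_Abelian_group_iff
        dest!: subsetD [OF keys_diff] split: if_splits)
  have K: "?K \<lhd> ?F"
    unfolding tensor_kernel_def
    by (rule F.normal_iff_subgroup[THEN iffD2]) (rule F.generate_is_subgroup [OF rels])
  have sub: "(\<lambda>(x, y). \<phi> x y) ` ?S \<subseteq> carrier H" using closed by auto
  obtain k where k: "k \<in> hom ?F H" and k_of: "\<And>z. z \<in> ?S \<Longrightarrow> k (frag_of z) = (\<lambda>(x, y). \<phi> x y) z"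
    using H.free_Abelian_group_universal [OF sub] by blast
  interpret k: group_hom ?F H k by unfold_locales (rule k)
  have ofF: "frag_of z \<in> carrier ?F" if "z \<in> ?S" for z using that by simp
  have hdiff: "u (a - b) = u a \<otimes>\<^bsub>H\<^esub> inv\<^bsub>H\<^esub> u b"
    if "group_hom ?F H u" "a \<in> carrier ?F" "b \<in> carrier ?F" for u a b
  proof -
    interpret u: group_hom ?F H u by fact
    have "a - b = a \<otimes>\<^bsub>?F\<^esub> inv\<^bsub>?F\<^esub> b" using that by simp
    then show ?thesis using that by (metis F.inv_closed u.hom_inv u.hom_mult)
  qed
  note kdiff = hdiff [OF k.group_hom_axioms]
  have dF: "a - b \<in> carrier ?F" if "a \<in> carrier ?F" "b \<in> carrier ?F" for a b
    using that by (auto simp: carrier_free_Abelian_group_iff dest!: subsetD [OF keys_diff])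
  have krel: "k z = \<one>\<^bsub>H\<^esub>" if z: "z \<in> tensor_rels B M N" for z
    using z unfolding tensor_rels_def
  proof (elim UnE CollectE exE conjE)
    fix x x' y assume *: "x \<in> carrier M" "x' \<in> carrier M" "y \<in> carrier N"
      and z: "z = frag_of (x \<oplus>\<^bsub>M\<^esub> x', y) - frag_of (x, y) - frag_of (x', y)"
    have "k z = (\<phi> (x \<oplus>\<^bsub>M\<^esub> x') y \<otimes>\<^bsub>H\<^esub> inv\<^bsub>H\<^esub> \<phi> x y) \<otimes>\<^bsub>H\<^esub> inv\<^bsub>H\<^esub> \<phi> x' y"
      unfolding z using * by (simp add: kdiff dF ofF k_of del: carrier_free_Abelian_group_iff)
    then show ?thesis using * by (simp add: add_left closed H.m_comm H.m_assoc) 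
        (metis H.inv_closed H.l_inv H.m_closed H.m_lcomm H.r_one H.r_inv closed)
  next
    fix x y y' assume *: "x \<in> carrier M" "y \<in> carrier N" "y' \<in> carrier N"
      and z: "z = frag_of (x, y \<oplus>\<^bsub>N\<^esub> y') - frag_of (x, y) - frag_of (x, y')"
    have "k z = (\<phi> x (y \<oplus>\<^bsub>N\<^esub> y') \<otimes>\<^bsub>H\<^esub> inv\<^bsub>H\<^esub> \<phi> x y) \<otimes>\<^bsub>H\<^esub> inv\<^bsub>H\<^esub> \<phi> x y'"
      unfolding z using * by (simp add: kdiff dF ofF k_of del: carrier_free_Abelian_group_iff)
    then show ?thesis using * by (simp add: add_right closed H.m_comm H.m_assoc)
        (metis H.inv_closed H.l_inv H.m_closed H.m_lcomm H.r_one H.r_inv closed)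
  next
    fix b x y assume *: "b \<in> carrier B" "x \<in> carrier M" "y \<in> carrier N"
      and z: "z = frag_of (b \<odot>\<^bsub>M\<^esub> x, y) - frag_of (x, b \<odot>\<^bsub>N\<^esub> y)"
    show ?thesis unfolding z
      using * by (simp add: kdiff ofF k_of balanced closed del: carrier_free_Abelian_group_iff)
  qed
  have "?K \<subseteq> kernel ?F H k"
    unfolding tensor_kernel_def
  proof (rule F.generate_subgroup_incl)
    show "tensor_rels B M N \<subseteq> kernel ?F H k" using rels krel by (auto simp: kernel_def simp del: carrier_free_Abelian_group_iff)
    show "subgroup (kernel ?F H k) ?F" by (rule k.subgroup_kernel)
  qed
  then obtain g where g: "g \<in> hom (?F Mod ?K) H"
    and g_of: "\<And>c. c \<in> carrier ?F \<Longrightarrow> g (?K #>\<^bsub>?F\<^esub> c) = k c"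
    using k.FactGroup_universal_kernel [OF K] by blast
  have grp: "group (?F Mod ?K)" by (rule normal.factorgroup_is_group [OF K])
  have "?P (restrict g (carrier ?T))"
  proof (intro conjI ballI)
    show "restrict g (carrier ?T) \<in> hom ?T H"
      using g monoid.m_closed [OF group.is_monoid [OF grp]] unfolding tensor_group_def
      by (auto simp: hom_def Pi_iff simp del: mult_FactGroup)
    fix x y assume *: "x \<in> carrier M" "y \<in> carrier N"
    have "?K #>\<^bsub>?F\<^esub> frag_of (x, y) \<in> carrier ?T"
      using * by (auto simp: tensor_group_def FactGroup_def RCOSETS_def)
    then show "restrict g (carrier ?T) (pure_tensor B M N x y) = \<phi> x y"
      using * by (simp add: pure_tensor_def g_of k_of del: carrier_free_Abelian_group_iff) 
  qed auto
  moreover have uniq: "f = f'" if f: "?P f" and f': "?P f'" for f f'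
  proof (rule extensionalityI [of _ "carrier ?T"])
    fix t assume "t \<in> carrier ?T"
    then obtain c where c: "c \<in> carrier ?F" and t: "t = ?K #>\<^bsub>?F\<^esub> c"
      by (auto simp: tensor_group_def FactGroup_def RCOSETS_def)
    have q: "(\<lambda>c. ?K #>\<^bsub>?F\<^esub> c) \<in> hom ?F ?T"
      unfolding tensor_group_def by (rule normal.r_coset_hom_Mod [OF K])
    have grp': "group ?T" using grp by (simp add: tensor_group_def)
    have homs: "group_hom ?F H (\<lambda>c. u (?K #>\<^bsub>?F\<^esub> c))" if "u \<in> hom ?T H" for u
      using hom_compose [OF q that] by (simp add: group_hom_def group_hom_axioms_def o_def)
    interpret f: group_hom ?F H "\<lambda>c. f (?K #>\<^bsub>?F\<^esub> c)" using f homs by blast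
    interpret f': group_hom ?F H "\<lambda>c. f' (?K #>\<^bsub>?F\<^esub> c)" using f' homs by blast
    have "Poly_Mapping.keys c \<subseteq> ?S" using c by simp
    then have "c \<in> carrier ?F \<and> f (?K #>\<^bsub>?F\<^esub> c) = f' (?K #>\<^bsub>?F\<^esub> c)"
    proof (induction c rule: frag_induction)
      case zero
      then show ?case using f.hom_one f'.hom_one by simp
    next
      case (one z)
      then show ?case using f f' by (cases z) (auto simp: pure_tensor_def)
    next
      case (diff a b)
      then show ?case
        using hdiff [OF f.group_hom_axioms, of a b] hdiff [OF f'.group_hom_axioms, of a b] dF [of a b]
        by metis
    qed
    then show "f t = f' t" by (simp add: t)
  qed (use f f' in auto)
  ultimately have ex1: "\<exists>!f. ?P f" by blast
  have P: "?P (tensor_lift B M N H \<phi>)"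
    unfolding tensor_lift_def by (rule theI' [OF ex1])
  show "tensor_lift B M N H \<phi> \<in> hom ?T H" using P by blast
  show "tensor_lift B M N H \<phi> (pure_tensor B M N x y) = \<phi> x y"
    if "x \<in> carrier M" "y \<in> carrier N" for x y using P that by blast
  show "f = tensor_lift B M N H \<phi>"
    if "f \<in> hom ?T H" "f \<in> extensional (carrier ?T)"
      "\<forall>x\<in>carrier M. \<forall>y\<in>carrier N. f (pure_tensor B M N x y) = \<phi> x y" for f
    using uniq P that by blast
qed

text \<open>Pure monomorphisms, tested on the \<open>B\<close>-modules with carrier in the type \<open>'u\<close>:
  \<open>N \<rightarrow> N \<otimes> E\<close>, \<open>n \<mapsto> n \<otimes> 1\<close> is injective.\<close>

definition pure_mono :: "'u itself \<Rightarrow> 'b ring \<Rightarrow> 'e ring \<Rightarrow> ('b \<Rightarrow> 'e) \<Rightarrow> bool" where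
  "pure_mono U B E p \<longleftrightarrow> (\<forall>N :: ('b, 'u) module. module B N \<longrightarrow>
     inj_on (\<lambda>n. pure_tensor B N (restrict_scalars B p (self_module E)) n \<one>\<^bsub>E\<^esub>) (carrier N))"

section \<open>Galois descent data\<close>

definition ring_right_action :: "'g monoid \<Rightarrow> 'e ring \<Rightarrow> ('e \<Rightarrow> 'g \<Rightarrow> 'e) \<Rightarrow> bool" where
  "ring_right_action G E act \<longleftrightarrow>
     (\<forall>g\<in>carrier G. (\<lambda>e. act e g) \<in> ring_iso E E) \<and>
     (\<forall>e\<in>carrier E. act e \<one>\<^bsub>G\<^esub> = e) \<and>
     (\<forall>e\<in>carrier E. \<forall>g\<in>carrier G. \<forall>h\<in>carrier G. act e (g \<otimes>\<^bsub>G\<^esub> h) = act (act e g) h)"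

definition map_algebra :: "'g monoid \<Rightarrow> 'e ring \<Rightarrow> ('e, 'g \<Rightarrow> 'e) module" where
  "map_algebra G E = \<lparr>carrier = carrier G \<rightarrow>\<^sub>E carrier E,
     mult = (\<lambda>u v. \<lambda>g\<in>carrier G. u g \<otimes>\<^bsub>E\<^esub> v g), one = (\<lambda>g\<in>carrier G. \<one>\<^bsub>E\<^esub>),
     ring.zero = (\<lambda>g\<in>carrier G. \<zero>\<^bsub>E\<^esub>), add = (\<lambda>u v. \<lambda>g\<in>carrier G. u g \<oplus>\<^bsub>E\<^esub> v g),
     smult = (\<lambda>e u. \<lambda>g\<in>carrier G. e \<otimes>\<^bsub>E\<^esub> u g)\<rparr>"

text \<open>The map \<open>E \<otimes> E \<rightarrow> GE\<close>, \<open>(e \<otimes> e') \<mapsto> (g \<mapsto> (eg)e')\<close>.\<close>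

definition galois_map ::
    "'b ring \<Rightarrow> 'e ring \<Rightarrow> ('b \<Rightarrow> 'e) \<Rightarrow> 'g monoid \<Rightarrow> ('e \<Rightarrow> 'g \<Rightarrow> 'e)
      \<Rightarrow> (('e \<times> 'e) \<Rightarrow>\<^sub>0 int) set \<Rightarrow> ('g \<Rightarrow> 'e)" where
  "galois_map B E p G act =
     (let Ep = restrict_scalars B p (self_module E)
      in tensor_lift B Ep Ep (add_monoid (map_algebra G E))
           (\<lambda>e e'. \<lambda>g\<in>carrier G. act e g \<otimes>\<^bsub>E\<^esub> e'))"

definition twist_module :: "'e ring \<Rightarrow> ('e \<Rightarrow> 'g \<Rightarrow> 'e) \<Rightarrow> 'g \<Rightarrow> ('e, 'a) module \<Rightarrow> ('e, 'a) module" where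
  "twist_module E act g D =
     mk_module E (carrier D) (add D) (ring.zero D) (\<lambda>e d. act e g \<odot>\<^bsub>D\<^esub> d)"

text \<open>Since it is the identity on underlying maps, the same record is an endofunctor of the category of
  \<open>E\<close>-modules and of its opposite.\<close>

definition twist ::
    "'e ring \<Rightarrow> ('e \<Rightarrow> 'g \<Rightarrow> 'e) \<Rightarrow> 'g
      \<Rightarrow> (('e, 'a) module, 'a \<Rightarrow> 'a, ('e, 'a) module, 'a \<Rightarrow> 'a) funct" where
  "twist E act g = \<lparr>FObj = twist_module E act g, FHom = (\<lambda>X Y f. f)\<rparr>"

text \<open>The category of \<open>E\<close>-modules with a semilinear right action of \<open>G\<close> by \<open>B\<close>-module automorphisms; in an
  object \<open>(D, \<rho>)\<close> the value \<open>\<rho> d g\<close> is \<open>dg\<close>.\<close>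

definition gmodule_cat ::
    "'b ring \<Rightarrow> 'e ring \<Rightarrow> ('b \<Rightarrow> 'e) \<Rightarrow> 'g monoid \<Rightarrow> ('e \<Rightarrow> 'g \<Rightarrow> 'e)
      \<Rightarrow> (('e, 'a) module \<times> ('a \<Rightarrow> 'g \<Rightarrow> 'a), 'a \<Rightarrow> 'a) category" where
  "gmodule_cat B E p G act = \<lparr>
     Obj = {(D, \<rho>). D \<in> Obj (module_cat E) \<and>
       \<rho> \<in> carrier D \<rightarrow>\<^sub>E carrier G \<rightarrow>\<^sub>E carrier D \<and>
       (\<forall>d\<in>carrier D. \<rho> d \<one>\<^bsub>G\<^esub> = d) \<and>
       (\<forall>d\<in>carrier D. \<forall>g\<in>carrier G. \<forall>h\<in>carrier G. \<rho> d (g \<otimes>\<^bsub>G\<^esub> h) = \<rho> (\<rho> d g) h) \<and>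
       (\<forall>g\<in>carrier G. (\<lambda>d\<in>carrier D. \<rho> d g) \<in> mod_auto B (restrict_scalars B p D)) \<and>
       (\<forall>e\<in>carrier E. \<forall>d\<in>carrier D. \<forall>g\<in>carrier G. \<rho> (e \<odot>\<^bsub>D\<^esub> d) g = act e g \<odot>\<^bsub>D\<^esub> \<rho> d g)},
     Hom = (\<lambda>(D, \<rho>) (D', \<rho>'). {f \<in> Hom (module_cat E) D D'.
       \<forall>d\<in>carrier D. \<forall>g\<in>carrier G. f (\<rho> d g) = \<rho>' (f d) g}),
     Ident = (\<lambda>(D, \<rho>). Ident (module_cat E) D),
     Comp = (\<lambda>(D, \<rho>) (D', \<rho>') (D'', \<rho>''). Comp (module_cat E) D D' D'')\<rparr>"

text \<open>The identification of cocycles with modules with \<open>G\<close>-action: \<open>(D, \<xi>)\<close> goes to \<open>D\<close> with \<open>dg = \<xi>\<^sub>g(d)\<close>.\<close>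

definition cocycle_to_gmodule ::
    "'g monoid \<Rightarrow> (('e, 'a) module \<times> ('g \<Rightarrow> 'a \<Rightarrow> 'a), 'a \<Rightarrow> 'a,
                   ('e, 'a) module \<times> ('a \<Rightarrow> 'g \<Rightarrow> 'a), 'a \<Rightarrow> 'a) funct" where
  "cocycle_to_gmodule G = \<lparr>
     FObj = (\<lambda>(D, \<xi>). (D, \<lambda>d\<in>carrier D. \<lambda>g\<in>carrier G. \<xi> g d)),
     FHom = (\<lambda>X Y f. f)\<rparr>"

text \<open>\<open>E \<otimes> A\<close> as an \<open>E\<close>-module, and its \<open>G\<close>-action.\<close>

definition ext_module ::
    "'b ring \<Rightarrow> 'e ring \<Rightarrow> ('b \<Rightarrow> 'e) \<Rightarrow> ('b, 'a) module \<Rightarrow> ('e, (('e \<times> 'a) \<Rightarrow>\<^sub>0 int) set) module" where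
  "ext_module B E p A =
     (let Ep = restrict_scalars B p (self_module E); T = tensor_group B Ep A
      in mk_module E (carrier T) (mult T) (one T)
           (\<lambda>e. tensor_lift B Ep A T (\<lambda>e' a. pure_tensor B Ep A (e \<otimes>\<^bsub>E\<^esub> e') a)))"

definition ext_action ::
    "'b ring \<Rightarrow> 'e ring \<Rightarrow> ('b \<Rightarrow> 'e) \<Rightarrow> 'g monoid \<Rightarrow> ('e \<Rightarrow> 'g \<Rightarrow> 'e) \<Rightarrow> ('b, 'a) module
      \<Rightarrow> (('e \<times> 'a) \<Rightarrow>\<^sub>0 int) set \<Rightarrow> 'g \<Rightarrow> (('e \<times> 'a) \<Rightarrow>\<^sub>0 int) set" where
  "ext_action B E p G act A =
     (let Ep = restrict_scalars B p (self_module E); T = tensor_group B Ep A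
      in (\<lambda>t\<in>carrier T. \<lambda>g\<in>carrier G.
           tensor_lift B Ep A T (\<lambda>e a. pure_tensor B Ep A (act e g) a) t))"

text \<open>\<open>E \<otimes> A\<close> is not a module on the type \<open>'a\<close>.  To have a functor between categories of modules on one
  type, it is replaced by its image under an injection \<open>encode S\<close> of its carrier \<open>S\<close> into \<open>'a\<close>, which exists
  if \<open>'a\<close> is infinite and at least as large as \<open>E\<close>.\<close>

definition encode :: "'s set \<Rightarrow> 's \<Rightarrow> 'a" where
  "encode S = (SOME i. inj_on i S)"

definition decode :: "'s set \<Rightarrow> 'a \<Rightarrow> 's" where
  "decode S = inv_into S (encode S)"

definition copy_gmodule ::
    "'e ring \<Rightarrow> 'g monoid \<Rightarrow> ('e, 's) module \<times> ('s \<Rightarrow> 'g \<Rightarrow> 's)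
      \<Rightarrow> ('e, 'a) module \<times> ('a \<Rightarrow> 'g \<Rightarrow> 'a)" where
  "copy_gmodule E G = (\<lambda>(D, \<rho>). let S = carrier D in
     (mk_module E (encode S ` S) (\<lambda>x y. encode S (decode S x \<oplus>\<^bsub>D\<^esub> decode S y)) (encode S \<zero>\<^bsub>D\<^esub>)
        (\<lambda>e x. encode S (e \<odot>\<^bsub>D\<^esub> decode S x)),
      \<lambda>x\<in>encode S ` S. \<lambda>g\<in>carrier G. encode S (\<rho> (decode S x) g)))"

definition gmodule_isomorphic ::
    "'e ring \<Rightarrow> 'g monoid \<Rightarrow> ('e, 's) module \<times> ('s \<Rightarrow> 'g \<Rightarrow> 's)
      \<Rightarrow> ('e, 'a) module \<times> ('a \<Rightarrow> 'g \<Rightarrow> 'a) \<Rightarrow> bool" where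
  "gmodule_isomorphic E G = (\<lambda>(D, \<rho>) (D', \<rho>'). \<exists>f \<in> mod_hom E D D'.
     bij_betw f (carrier D) (carrier D') \<and>
     (\<forall>d\<in>carrier D. \<forall>g\<in>carrier G. f (\<rho> d g) = \<rho>' (f d) g))"

definition ext_funct ::
    "'b ring \<Rightarrow> 'e ring \<Rightarrow> ('b \<Rightarrow> 'e) \<Rightarrow> 'g monoid \<Rightarrow> ('e \<Rightarrow> 'g \<Rightarrow> 'e)
      \<Rightarrow> (('b, 'a) module, 'a \<Rightarrow> 'a, ('e, 'a) module \<times> ('a \<Rightarrow> 'g \<Rightarrow> 'a), 'a \<Rightarrow> 'a) funct" where
  "ext_funct B E p G act = (let Ep = restrict_scalars B p (self_module E) in \<lparr>
     FObj = (\<lambda>A. copy_gmodule E G (ext_module B E p A, ext_action B E p G act A)),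
     FHom = (\<lambda>A A' f.
       let S = carrier (tensor_group B Ep A); T' = tensor_group B Ep A'
       in (\<lambda>x\<in>encode S ` S. encode (carrier T')
            (tensor_lift B Ep A T' (\<lambda>e a. pure_tensor B Ep A' e (f a)) (decode S x))))\<rparr>)"

definition fixed_points :: "'g monoid \<Rightarrow> ('e, 'a) module \<times> ('a \<Rightarrow> 'g \<Rightarrow> 'a) \<Rightarrow> 'a set" where
  "fixed_points G = (\<lambda>(D, \<rho>). {d \<in> carrier D. \<forall>g\<in>carrier G. \<rho> d g = d})"

definition fixed_funct ::
    "'b ring \<Rightarrow> ('b \<Rightarrow> 'e) \<Rightarrow> 'g monoid
      \<Rightarrow> (('e, 'a) module \<times> ('a \<Rightarrow> 'g \<Rightarrow> 'a), 'a \<Rightarrow> 'a, ('b, 'a) module, 'a \<Rightarrow> 'a) funct" where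
  "fixed_funct B p G = \<lparr>
     FObj = (\<lambda>(D, \<rho>). let Dp = restrict_scalars B p D in
       mk_module B (fixed_points G (D, \<rho>)) (add Dp) (ring.zero Dp) (smult Dp)),
     FHom = (\<lambda>X Y f. restrict f (fixed_points G X))\<rparr>"

end

theory Submission
  imports Defs
begin

text \<open>Inverting the Galois map on the delta function at \<open>1\<close> gives pairs \<open>(x, y)\<close> with
  \<open>\<Sum> x (y g) = \<delta>(g, 1)\<close>, hence \<open>d = \<Sum> x tr(y d)\<close> in every \<open>E\<close>-module \<open>D\<close> with semilinear \<open>G\<close>-action, where
  \<open>tr(d) = \<Sum>\<^sub>g dg\<close>.  Purity is used three times: for \<open>E / p(B)\<close> it shows that every \<open>G\<close>-invariant \<open>x\<close> of \<open>E\<close> lies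
  in \<open>p(B)\<close>, because \<open>x \<otimes> 1\<close> and \<open>1 \<otimes> x\<close> have the same image under the Galois map; for \<open>E / tr(E)\<close> it
  shows that some \<open>c\<close> has trace \<open>1\<close>; and for \<open>A\<close> it makes \<open>a \<mapsto> 1 \<otimes> a\<close> injective.  A \<open>G\<close>-invariant \<open>t\<close> of
  \<open>E \<otimes> A\<close> equals \<open>tr(c t)\<close>, and traces in \<open>E \<otimes> A\<close> have the form \<open>1 \<otimes> a\<close>, so the unit of the
  adjunction is bijective.  The counit \<open>e \<otimes> d \<mapsto> e d\<close> has the inverse \<open>d \<mapsto> \<Sum> x \<otimes> tr(y d)\<close>.\<close>

section \<open>Categories\<close>

text \<open>The type \<open>'u\<close> shapes the proof. Purity is available only for modules with
  carrier in \<open>'u\<close>, so the quotients \<open>E / p(B)\<close> and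
  \<open>E / tr(E)\<close> are realised there by coset representatives and an injection of
  \<open>E\<close>, and \<open>E \<otimes> A\<close> is replaced by an encoded copy. The algebra is
  done on tensors and quotient maps; codes appear only when functors and natural isomorphisms are
  assembled. The uses of purity come in a forced order. Modulo \<open>tr(E)\<close> one has
  \<open>1 \<otimes> x tr(y) = tr(y) \<otimes> x = 0\<close>, but \<open>tr(y)\<close> may cross the
  tensor sign only if it comes from \<open>B\<close>; so invariants must be known to lie in
  \<open>p(B)\<close> before a trace equal to \<open>1\<close> can be produced. The same crossing
  brings traces in \<open>E \<otimes> A\<close> into the form \<open>1 \<otimes> a\<close> and shows
  that the proposed inverse of the counit undoes it on pure tensors. Descent is proved for modules
  with \<open>G\<close>-action. The cocycle category is joined to them by an isomorphism of
  categories that is the identity on morphisms, and the equivalence is transported along it.\<close>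

lemma op_cat_simps [simp]:
  "Obj (op_cat C) = Obj C" "Hom (op_cat C) X Y = Hom C Y X"
  "Ident (op_cat C) = Ident C" "Comp (op_cat C) X Y Z g f = Comp C Z Y X f g"
  by (simp_all add: op_cat_def)

lemma category_op_cat:
  assumes "category C"
  shows "category (op_cat C)"
proof -
  interpret category C by fact
  show ?thesis
    by unfold_locales
      (auto simp: Ident_in_Hom Comp_in_Hom Comp_Ident_left Comp_Ident_right Comp_assoc)
qed

text \<open>Closure under composition is the substantial part: the squares of \<open>f\<close> and
  \<open>k\<close> share the edge \<open>\<xi>2 g\<close>, and pasting them along it leaves
  \<open>T g\<close> applied to both factors, which functoriality of \<open>T g\<close>
  joins.\<close>

lemma (in G_category) category_cocycle_cat: "category (cocycle_cat G X T)"
proof -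
  note T = is_functor.FObj_in_Obj [OF T_functor] is_functor.FHom_in_Hom [OF T_functor]
    is_functor.FHom_Ident [OF T_functor] is_functor.FHom_Comp [OF T_functor]
  show ?thesis
  proof
    fix Y assume "Y \<in> Obj (cocycle_cat G X T)"
    then show "Ident (cocycle_cat G X T) Y \<in> Hom (cocycle_cat G X T) Y Y"
      by (auto simp: cocycle_cat_def Ident_in_Hom T PiE_iff Comp_Ident_left Comp_Ident_right)
  next
    fix Y1 Y2 Y3 f k
    assume Y: "Y1 \<in> Obj (cocycle_cat G X T)" "Y2 \<in> Obj (cocycle_cat G X T)" "Y3 \<in> Obj (cocycle_cat G X T)"
      and fk: "f \<in> Hom (cocycle_cat G X T) Y1 Y2" "k \<in> Hom (cocycle_cat G X T) Y2 Y3"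
    obtain A1 \<xi>1 A2 \<xi>2 A3 \<xi>3 where [simp]: "Y1 = (A1, \<xi>1)" "Y2 = (A2, \<xi>2)" "Y3 = (A3, \<xi>3)"
      by (cases Y1, cases Y2, cases Y3)
    have A: "A1 \<in> Obj X" "A2 \<in> Obj X" "A3 \<in> Obj X"
      and \<xi>: "\<And>g. g \<in> carrier G \<Longrightarrow> \<xi>1 g \<in> Hom X (FObj (T g) A1) A1"
        "\<And>g. g \<in> carrier G \<Longrightarrow> \<xi>2 g \<in> Hom X (FObj (T g) A2) A2"
        "\<And>g. g \<in> carrier G \<Longrightarrow> \<xi>3 g \<in> Hom X (FObj (T g) A3) A3"
      using Y by (auto simp: cocycle_cat_def)
    have f: "f \<in> Hom X A1 A2" and k: "k \<in> Hom X A2 A3"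
      and eqf: "\<And>g. g \<in> carrier G \<Longrightarrow> Comp X (FObj (T g) A1) A1 A2 f (\<xi>1 g) =
        Comp X (FObj (T g) A1) (FObj (T g) A2) A2 (\<xi>2 g) (FHom (T g) A1 A2 f)"
      and eqk: "\<And>g. g \<in> carrier G \<Longrightarrow> Comp X (FObj (T g) A2) A2 A3 k (\<xi>2 g) =
        Comp X (FObj (T g) A2) (FObj (T g) A3) A3 (\<xi>3 g) (FHom (T g) A2 A3 k)"
      using fk by (auto simp: cocycle_cat_def)
    have "Comp X (FObj (T g) A1) A1 A3 (Comp X A1 A2 A3 k f) (\<xi>1 g) =
        Comp X (FObj (T g) A1) (FObj (T g) A3) A3 (\<xi>3 g) (FHom (T g) A1 A3 (Comp X A1 A2 A3 k f))"
      if g: "g \<in> carrier G" for g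
    proof -
      note TA = T(1) [OF g A(1)] T(1) [OF g A(2)] T(1) [OF g A(3)]
      note Tf = T(2) [OF g A(1,2) f] and Tk = T(2) [OF g A(2,3) k]
      have "Comp X (FObj (T g) A1) A1 A3 (Comp X A1 A2 A3 k f) (\<xi>1 g)
          = Comp X (FObj (T g) A1) A2 A3 k (Comp X (FObj (T g) A1) A1 A2 f (\<xi>1 g))"
        using Comp_assoc [OF TA(1) A \<xi>(1) [OF g] f k] by simp
      also have "\<dots> = Comp X (FObj (T g) A1) A2 A3 k
          (Comp X (FObj (T g) A1) (FObj (T g) A2) A2 (\<xi>2 g) (FHom (T g) A1 A2 f))"
        by (simp add: eqf g)
      also have "\<dots> = Comp X (FObj (T g) A1) (FObj (T g) A2) A3
          (Comp X (FObj (T g) A2) A2 A3 k (\<xi>2 g)) (FHom (T g) A1 A2 f)"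
        by (rule Comp_assoc [OF TA(1,2) A(2,3) Tf \<xi>(2) [OF g] k])
      also have "\<dots> = Comp X (FObj (T g) A1) (FObj (T g) A2) A3
          (Comp X (FObj (T g) A2) (FObj (T g) A3) A3 (\<xi>3 g) (FHom (T g) A2 A3 k)) (FHom (T g) A1 A2 f)"
        by (simp add: eqk g)
      also have "\<dots> = Comp X (FObj (T g) A1) (FObj (T g) A3) A3 (\<xi>3 g)
          (Comp X (FObj (T g) A1) (FObj (T g) A2) (FObj (T g) A3) (FHom (T g) A2 A3 k) (FHom (T g) A1 A2 f))"
        using Comp_assoc [OF TA A(3) Tf Tk \<xi>(3) [OF g]] by simp
      finally show ?thesis by (simp add: T(4) [OF g A f k])
    qed
    then show "Comp (cocycle_cat G X T) Y1 Y2 Y3 k f \<in> Hom (cocycle_cat G X T) Y1 Y3"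
      using A f k by (simp add: cocycle_cat_def Comp_in_Hom)
  qed (auto simp: cocycle_cat_def Comp_Ident_left Comp_Ident_right Comp_assoc)
qed

section \<open>Transport of an equivalence along an isomorphism of categories\<close>

lemma is_functor_comp_funct:
  assumes "is_functor C D F" "is_functor D K H"
  shows "is_functor C K (comp_funct H F)"
proof -
  interpret F: is_functor C D F by fact
  interpret H: is_functor D K H by fact
  show ?thesis
    by unfold_locales
      (simp_all add: comp_funct_def F.FObj_in_Obj F.FHom_in_Hom F.FHom_Ident F.FHom_Comp
        H.FObj_in_Obj H.FHom_in_Hom H.FHom_Ident H.FHom_Comp)
qed

text \<open>\<open>cat_isomorphism\<close> asks for bijections on objects and on each hom-set rather
  than for an inverse functor, so the inverse is assembled from preimages.\<close>

definition inv_funct ::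
    "('o, 'm) category \<Rightarrow> ('o, 'm, 'p, 'n) funct \<Rightarrow> ('p, 'n, 'o, 'm) funct" where
  "inv_funct C J = (let O' = inv_into (Obj C) (FObj J) in
     \<lparr>FObj = O', FHom = (\<lambda>X Y. inv_into (Hom C (O' X) (O' Y)) (FHom J (O' X) (O' Y)))\<rparr>)"

locale cat_iso =
  fixes C :: "('o, 'm) category" and D :: "('p, 'n) category" and J
  assumes iso: "cat_isomorphism C D J"
begin

sublocale J: is_functor C D J
  using iso by (simp add: cat_isomorphism_def)

abbreviation "Ji \<equiv> inv_funct C J"

lemma bij_Obj: "bij_betw (FObj J) (Obj C) (Obj D)"
  using iso by (simp add: cat_isomorphism_def)

lemma bij_Hom: "X \<in> Obj C \<Longrightarrow> Y \<in> Obj C \<Longrightarrow> bij_betw (FHom J X Y) (Hom C X Y) (Hom D (FObj J X) (FObj J Y))"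
  using iso by (simp add: cat_isomorphism_def)

lemma inv_Obj: "X \<in> Obj D \<Longrightarrow> FObj Ji X \<in> Obj C" "X \<in> Obj D \<Longrightarrow> FObj J (FObj Ji X) = X"
    "Y \<in> Obj C \<Longrightarrow> FObj Ji (FObj J Y) = Y"
  using bij_Obj
  by (auto simp: inv_funct_def Let_def bij_betw_def inv_into_into f_inv_into_f inv_into_f_f)

lemma inv_Hom:
  assumes "X \<in> Obj D" "Y \<in> Obj D" "f \<in> Hom D X Y"
  shows "FHom Ji X Y f \<in> Hom C (FObj Ji X) (FObj Ji Y)"
    and "FHom J (FObj Ji X) (FObj Ji Y) (FHom Ji X Y f) = f"
proof -
  have b: "bij_betw (FHom J (FObj Ji X) (FObj Ji Y)) (Hom C (FObj Ji X) (FObj Ji Y)) (Hom D X Y)"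
    using bij_Hom [of "FObj Ji X" "FObj Ji Y"] assms by (simp add: inv_Obj)
  have eq: "FHom Ji X Y = inv_into (Hom C (FObj Ji X) (FObj Ji Y)) (FHom J (FObj Ji X) (FObj Ji Y))"
    by (simp add: inv_funct_def Let_def)
  show "FHom Ji X Y f \<in> Hom C (FObj Ji X) (FObj Ji Y)"
    and "FHom J (FObj Ji X) (FObj Ji Y) (FHom Ji X Y f) = f"
    unfolding eq using b assms(3) by (auto simp: bij_betw_def inv_into_into f_inv_into_f)
qed

text \<open>Faithfulness of \<open>J\<close>: equations about \<open>Ji\<close> are proved by
  applying \<open>J\<close> to both sides, where \<open>J\<close> after \<open>Ji\<close>
  cancels.\<close>

lemma Hom_eqI:
  assumes "X \<in> Obj C" "Y \<in> Obj C" "f \<in> Hom C X Y" "g \<in> Hom C X Y" "FHom J X Y f = FHom J X Y g"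
  shows "f = g"
  using bij_Hom [OF assms(1,2)] assms(3-5) by (auto simp: bij_betw_def dest: inj_onD)

lemma inv_Hom_left:
  assumes "X \<in> Obj C" "Y \<in> Obj C" "f \<in> Hom C X Y"
  shows "FHom Ji (FObj J X) (FObj J Y) (FHom J X Y f) = f"
  using assms inv_Hom [of "FObj J X" "FObj J Y" "FHom J X Y f"]
  by (intro Hom_eqI [of X Y]) (simp_all add: inv_Obj J.FObj_in_Obj J.FHom_in_Hom)

lemma is_functor_inv: "is_functor D C Ji"
proof
  fix X assume X: "X \<in> Obj D"
  then show "FObj Ji X \<in> Obj C" by (rule inv_Obj)
  show "FHom Ji X X (Ident D X) = Ident C (FObj Ji X)"
    using X inv_Hom [of X X "Ident D X"]
    by (intro Hom_eqI [of "FObj Ji X" "FObj Ji X"])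
      (simp_all add: inv_Obj J.source.Ident_in_Hom J.target.Ident_in_Hom J.FHom_Ident)
next
  fix X Y Z f g
  assume *: "X \<in> Obj D" "Y \<in> Obj D" "Z \<in> Obj D" "f \<in> Hom D X Y" "g \<in> Hom D Y Z"
  show "FHom Ji X Z (Comp D X Y Z g f) =
        Comp C (FObj Ji X) (FObj Ji Y) (FObj Ji Z) (FHom Ji Y Z g) (FHom Ji X Y f)"
    using * inv_Hom [of X Z "Comp D X Y Z g f"]
    by (intro Hom_eqI [of "FObj Ji X" "FObj Ji Z"])
      (simp_all add: inv_Obj inv_Hom J.source.Comp_in_Hom J.target.Comp_in_Hom J.FHom_Comp)
qed (rule inv_Hom)

lemma is_iso_inv:
  assumes "is_iso D X Y f" "X \<in> Obj D" "Y \<in> Obj D"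
  shows "is_iso C (FObj Ji X) (FObj Ji Y) (FHom Ji X Y f)"
proof -
  interpret Ji: is_functor D C Ji by (rule is_functor_inv)
  obtain g where "f \<in> Hom D X Y" "g \<in> Hom D Y X" "Comp D X Y X g f = Ident D X"
      "Comp D Y X Y f g = Ident D Y"
    using assms(1) by (auto simp: is_iso_def)
  then show ?thesis
    using assms(2,3) unfolding is_iso_def
    by (auto intro!: bexI [of _ "FHom Ji Y X g"] inv_Hom simp flip: Ji.FHom_Comp Ji.FHom_Ident)
qed

text \<open>\<open>J\<close> after \<open>Ji\<close> is the identity on the nose, so
  \<open>H J Ji F\<close> agrees with \<open>H F\<close> and the old unit serves again. The new
  counit at \<open>X\<close> is the old one at \<open>J X\<close>, brought back by
  \<open>Ji\<close>.\<close>

lemma cat_equivalence_inv: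
  assumes "cat_equivalence K D F H"
  shows "cat_equivalence K C (comp_funct Ji F) (comp_funct H J)"
    and "eq_funct K (comp_funct J (comp_funct Ji F)) F"
proof -
  interpret Ji: is_functor D C Ji by (rule is_functor_inv)
  interpret F: is_functor K D F using assms by (simp add: cat_equivalence_def)
  interpret H: is_functor D K H using assms by (simp add: cat_equivalence_def)
  obtain \<eta> \<epsilon> where \<eta>: "natural_iso K K id_funct (comp_funct H F) \<eta>"
      and \<epsilon>: "natural_iso D D (comp_funct F H) id_funct \<epsilon>"
    using assms by (auto simp: cat_equivalence_def)
  have \<eta>': "natural_iso K K id_funct (comp_funct (comp_funct H J) (comp_funct Ji F)) \<eta>"
    using \<eta> by (simp add: natural_iso_def comp_funct_def id_funct_def inv_Obj inv_Hom
        F.FObj_in_Obj F.FHom_in_Hom)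
  have \<epsilon>': "natural_iso C C (comp_funct (comp_funct Ji F) (comp_funct H J)) id_funct
      (\<lambda>X. FHom Ji (FObj F (FObj H (FObj J X))) (FObj J X) (\<epsilon> (FObj J X)))"
    unfolding natural_iso_def
  proof (intro conjI ballI)
    fix X assume X: "X \<in> Obj C"
    have "is_iso C (FObj Ji (FObj F (FObj H (FObj J X)))) (FObj Ji (FObj J X))
        (FHom Ji (FObj F (FObj H (FObj J X))) (FObj J X) (\<epsilon> (FObj J X)))"
      using \<epsilon> X by (intro is_iso_inv)
        (auto simp: natural_iso_def comp_funct_def id_funct_def J.FObj_in_Obj F.FObj_in_Obj H.FObj_in_Obj)
    then show "is_iso C (FObj (comp_funct (comp_funct Ji F) (comp_funct H J)) X) (FObj id_funct X)
        (FHom Ji (FObj F (FObj H (FObj J X))) (FObj J X) (\<epsilon> (FObj J X)))"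
      using X by (simp add: comp_funct_def id_funct_def inv_Obj)
  next
    fix X Y f assume *: "X \<in> Obj C" "Y \<in> Obj C" "f \<in> Hom C X Y"
    define X' Y' f' where "X' = FObj J X" and "Y' = FObj J Y" and "f' = FHom J X Y f"
    have X'Y': "X' \<in> Obj D" "Y' \<in> Obj D" "f' \<in> Hom D X' Y'"
      using * by (simp_all add: X'_def Y'_def f'_def J.FObj_in_Obj J.FHom_in_Hom)
    have e: "\<epsilon> X' \<in> Hom D (FObj F (FObj H X')) X'" "\<epsilon> Y' \<in> Hom D (FObj F (FObj H Y')) Y'"
      using \<epsilon> X'Y' by (auto simp: natural_iso_def is_iso_def comp_funct_def id_funct_def)
    have nat: "Comp D (FObj F (FObj H X')) (FObj F (FObj H Y')) Y' (\<epsilon> Y')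
          (FHom F (FObj H X') (FObj H Y') (FHom H X' Y' f')) =
        Comp D (FObj F (FObj H X')) X' Y' f' (\<epsilon> X')"
      using \<epsilon> X'Y' by (auto simp: natural_iso_def comp_funct_def id_funct_def)
    \<comment> \<open>With \<open>f\<close> written as a value of \<open>Ji\<close>, the wanted
      square is the image of the square \<open>nat\<close> under \<open>Ji\<close>.\<close>
    have f: "f = FHom Ji X' Y' f'"
      using * by (simp add: X'_def Y'_def f'_def inv_Hom_left)
    have "Comp C (FObj Ji (FObj F (FObj H X'))) (FObj Ji (FObj F (FObj H Y'))) (FObj Ji Y')
        (FHom Ji (FObj F (FObj H Y')) Y' (\<epsilon> Y')) (FHom Ji (FObj F (FObj H X')) (FObj F (FObj H Y'))
          (FHom F (FObj H X') (FObj H Y') (FHom H X' Y' f'))) =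
      Comp C (FObj Ji (FObj F (FObj H X'))) (FObj Ji X') (FObj Ji Y') (FHom Ji X' Y' f')
        (FHom Ji (FObj F (FObj H X')) X' (\<epsilon> X'))"
      using X'Y' e nat
      by (simp add: F.FObj_in_Obj H.FObj_in_Obj F.FHom_in_Hom H.FHom_in_Hom flip: Ji.FHom_Comp)
    then show "Comp C (FObj (comp_funct (comp_funct Ji F) (comp_funct H J)) X)
         (FObj (comp_funct (comp_funct Ji F) (comp_funct H J)) Y) (FObj id_funct Y)
         (FHom Ji (FObj F (FObj H (FObj J Y))) (FObj J Y) (\<epsilon> (FObj J Y)))
         (FHom (comp_funct (comp_funct Ji F) (comp_funct H J)) X Y f) =
        Comp C (FObj (comp_funct (comp_funct Ji F) (comp_funct H J)) X) (FObj id_funct X)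
         (FObj id_funct Y) (FHom id_funct X Y f)
         (FHom Ji (FObj F (FObj H (FObj J X))) (FObj J X) (\<epsilon> (FObj J X)))"
      using * by (simp add: comp_funct_def id_funct_def X'_def Y'_def f'_def inv_Obj inv_Hom_left)
  qed
  show "cat_equivalence K C (comp_funct Ji F) (comp_funct H J)"
    unfolding cat_equivalence_def
    using \<eta>' \<epsilon>' is_functor_comp_funct [OF F.is_functor_axioms Ji.is_functor_axioms]
      is_functor_comp_funct [OF J.is_functor_axioms H.is_functor_axioms] by blast
  show "eq_funct K (comp_funct J (comp_funct Ji F)) F"
    by (simp add: eq_funct_def comp_funct_def inv_Obj inv_Hom F.FObj_in_Obj F.FHom_in_Hom)
qed

end

section \<open>Modules\<close>

lemma mk_module_simps [simp]:
  "carrier (mk_module R S pls z sm) = S" "\<zero>\<^bsub>mk_module R S pls z sm\<^esub> = z"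
  "\<lbrakk>x \<in> S; y \<in> S\<rbrakk> \<Longrightarrow> x \<oplus>\<^bsub>mk_module R S pls z sm\<^esub> y = pls x y"
  "\<lbrakk>r \<in> carrier R; x \<in> S\<rbrakk> \<Longrightarrow> r \<odot>\<^bsub>mk_module R S pls z sm\<^esub> x = sm r x"
  by (simp_all add: mk_module_def)

lemma mk_module_idem:
  "mk_module R S (add (mk_module R S pls z sm)) z (smult (mk_module R S pls z sm)) = mk_module R S pls z sm"
  by (auto simp: mk_module_def restrict_def fun_eq_iff)

lemma strict_module_mk_module:
  "module R (mk_module R S pls z sm) \<Longrightarrow> strict_module R (mk_module R S pls z sm)"
  by (simp add: strict_module_def mk_module_idem)

text \<open>Up to closure and additive inverses the laws of a module are equations, so they pass to
  a surjective image. As \<open>N\<close> is not yet known to be a group, compatibility with zero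
  has to be assumed and cannot be derived from additivity.\<close>

lemma module_surj_image:
  assumes "module R M" and surj: "j ` carrier M = carrier N" and zero: "j \<zero>\<^bsub>M\<^esub> = \<zero>\<^bsub>N\<^esub>"
    and add: "\<And>x y. \<lbrakk>x \<in> carrier M; y \<in> carrier M\<rbrakk> \<Longrightarrow> j (x \<oplus>\<^bsub>M\<^esub> y) = j x \<oplus>\<^bsub>N\<^esub> j y"
    and smult: "\<And>r x. \<lbrakk>r \<in> carrier R; x \<in> carrier M\<rbrakk> \<Longrightarrow> j (r \<odot>\<^bsub>M\<^esub> x) = r \<odot>\<^bsub>N\<^esub> j x"
  shows "module R N"
proof -
  interpret M: module R M by fact
  have ex: "\<exists>x\<in>carrier M. u = j x" if "u \<in> carrier N" for u
    using that surj by auto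
  have j: "j x \<in> carrier N" if "x \<in> carrier M" for x using that surj by auto
  show ?thesis
  proof (rule moduleI)
    show "abelian_group N"
    proof (rule abelian_groupI)
      fix u assume "u \<in> carrier N"
      then obtain x where x: "x \<in> carrier M" "u = j x" using ex by blast
      then have "j (\<ominus>\<^bsub>M\<^esub> x) \<oplus>\<^bsub>N\<^esub> u = \<zero>\<^bsub>N\<^esub>"
        by (simp add: M.l_neg zero flip: add)
      then show "\<exists>v\<in>carrier N. v \<oplus>\<^bsub>N\<^esub> u = \<zero>\<^bsub>N\<^esub>"
        using x j by blast
    next
      show "\<zero>\<^bsub>N\<^esub> \<in> carrier N" using j [OF M.zero_closed] by (simp only: zero)
    next
      fix u assume "u \<in> carrier N"
      then obtain x where x: "x \<in> carrier M" "u = j x" using ex by blast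
      have "j (\<zero>\<^bsub>M\<^esub> \<oplus>\<^bsub>M\<^esub> x) = \<zero>\<^bsub>N\<^esub> \<oplus>\<^bsub>N\<^esub> u"
        using x by (simp only: add M.zero_closed zero)
      then show "\<zero>\<^bsub>N\<^esub> \<oplus>\<^bsub>N\<^esub> u = u" using x by simp
    qed (auto dest!: ex simp: j M.a_ac simp flip: add)
  qed (auto dest!: ex simp: j M.smult_l_distr M.smult_r_distr M.smult_assoc1 M.R.cring_axioms
      simp flip: add smult)
qed

text \<open>The module structure that a map \<open>j\<close> with additive and linear kernel relation puts on its image: a quotient
  of \<open>M\<close> in general, a copy of \<open>M\<close> if \<open>j\<close> is injective.\<close>

definition image_module :: "'r ring \<Rightarrow> ('r, 'a) module \<Rightarrow> ('a \<Rightarrow> 'c) \<Rightarrow> ('r, 'c) module" where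
  "image_module R M j = mk_module R (j ` carrier M)
     (\<lambda>u v. j (inv_into (carrier M) j u \<oplus>\<^bsub>M\<^esub> inv_into (carrier M) j v)) (j \<zero>\<^bsub>M\<^esub>)
     (\<lambda>r u. j (r \<odot>\<^bsub>M\<^esub> inv_into (carrier M) j u))"

definition is_congruence :: "'r ring \<Rightarrow> ('r, 'a) module \<Rightarrow> ('a \<Rightarrow> 'c) \<Rightarrow> bool" where
  "is_congruence R M j \<longleftrightarrow>
     (\<forall>x\<in>carrier M. \<forall>x'\<in>carrier M. \<forall>y\<in>carrier M. \<forall>y'\<in>carrier M. j x = j x' \<longrightarrow> j y = j y' \<longrightarrow>
       j (x \<oplus>\<^bsub>M\<^esub> y) = j (x' \<oplus>\<^bsub>M\<^esub> y')) \<and>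
     (\<forall>r\<in>carrier R. \<forall>x\<in>carrier M. \<forall>x'\<in>carrier M. j x = j x' \<longrightarrow> j (r \<odot>\<^bsub>M\<^esub> x) = j (r \<odot>\<^bsub>M\<^esub> x'))"

lemma is_congruence_inj: "inj_on j (carrier M) \<Longrightarrow> is_congruence R M j"
  unfolding is_congruence_def by (blast dest: inj_onD)

text \<open>The operations work with preimages picked by \<open>inv_into\<close>. Two preimages of
  one element have the same value under \<open>j\<close>, so the congruence condition makes the
  choice immaterial, and \<open>module_surj_image\<close> supplies the laws.\<close>

lemma image_module:
  fixes M :: "('r, 'a) module" and j :: "'a \<Rightarrow> 'c"
  assumes M: "module R M" and j: "is_congruence R M j"
  shows "strict_module R (image_module R M j)"
    and "carrier (image_module R M j) = j ` carrier M"
    and "\<zero>\<^bsub>image_module R M j\<^esub> = j \<zero>\<^bsub>M\<^esub>"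
    and "\<And>x y. \<lbrakk>x \<in> carrier M; y \<in> carrier M\<rbrakk> \<Longrightarrow> j (x \<oplus>\<^bsub>M\<^esub> y) = j x \<oplus>\<^bsub>image_module R M j\<^esub> j y"
    and "\<And>r x. \<lbrakk>r \<in> carrier R; x \<in> carrier M\<rbrakk> \<Longrightarrow> j (r \<odot>\<^bsub>M\<^esub> x) = r \<odot>\<^bsub>image_module R M j\<^esub> j x"
proof -
  interpret M: module R M by (rule M)
  let ?i = "inv_into (carrier M) j"
  have add: "j (x \<oplus>\<^bsub>M\<^esub> y) = j (x' \<oplus>\<^bsub>M\<^esub> y')"
    if "x \<in> carrier M" "x' \<in> carrier M" "y \<in> carrier M" "y' \<in> carrier M" "j x = j x'" "j y = j y'" for x x' y y'
    using j that unfolding is_congruence_def by blast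
  have smult: "j (r \<odot>\<^bsub>M\<^esub> x) = j (r \<odot>\<^bsub>M\<^esub> x')"
    if "r \<in> carrier R" "x \<in> carrier M" "x' \<in> carrier M" "j x = j x'" for r x x'
    using j that unfolding is_congruence_def by blast
  have i: "?i (j x) \<in> carrier M" "j (?i (j x)) = j x" if "x \<in> carrier M" for x
    using that by (simp_all add: inv_into_into f_inv_into_f)
  show c: "carrier (image_module R M j) = j ` carrier M"
    and z: "\<zero>\<^bsub>image_module R M j\<^esub> = j \<zero>\<^bsub>M\<^esub>"
    by (simp_all add: image_module_def)
  show a: "j (x \<oplus>\<^bsub>M\<^esub> y) = j x \<oplus>\<^bsub>image_module R M j\<^esub> j y"
    if "x \<in> carrier M" "y \<in> carrier M" for x y
    using that by (auto simp: image_module_def i intro: add)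
  show s: "j (r \<odot>\<^bsub>M\<^esub> x) = r \<odot>\<^bsub>image_module R M j\<^esub> j x"
    if "r \<in> carrier R" "x \<in> carrier M" for r x
    using that by (auto simp: image_module_def i intro: smult)
  have "module R (image_module R M j)"
    by (rule module_surj_image [OF M]) (auto simp: c z intro: a s)
  then show "strict_module R (image_module R M j)"
    unfolding image_module_def by (rule strict_module_mk_module)
qed

section \<open>Homomorphisms and the category of modules\<close>

lemma mod_homI:
  assumes "f \<in> extensional (carrier M)" "\<And>x. x \<in> carrier M \<Longrightarrow> f x \<in> carrier N"
    "\<And>x y. \<lbrakk>x \<in> carrier M; y \<in> carrier M\<rbrakk> \<Longrightarrow> f (x \<oplus>\<^bsub>M\<^esub> y) = f x \<oplus>\<^bsub>N\<^esub> f y"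
    "\<And>r x. \<lbrakk>r \<in> carrier R; x \<in> carrier M\<rbrakk> \<Longrightarrow> f (r \<odot>\<^bsub>M\<^esub> x) = r \<odot>\<^bsub>N\<^esub> f x"
  shows "f \<in> mod_hom R M N"
  using assms by (auto simp: mod_hom_def PiE_iff)

lemma mod_homD:
  assumes "f \<in> mod_hom R M N"
  shows "f \<in> extensional (carrier M)" "\<And>x. x \<in> carrier M \<Longrightarrow> f x \<in> carrier N"
    "\<And>x y. \<lbrakk>x \<in> carrier M; y \<in> carrier M\<rbrakk> \<Longrightarrow> f (x \<oplus>\<^bsub>M\<^esub> y) = f x \<oplus>\<^bsub>N\<^esub> f y"
    "\<And>r x. \<lbrakk>r \<in> carrier R; x \<in> carrier M\<rbrakk> \<Longrightarrow> f (r \<odot>\<^bsub>M\<^esub> x) = r \<odot>\<^bsub>N\<^esub> f x"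
  using assms by (auto simp: mod_hom_def PiE_iff)

lemma mod_hom_compose:
  assumes "module R L" "f \<in> mod_hom R L M" "g \<in> mod_hom R M N"
  shows "compose (carrier L) g f \<in> mod_hom R L N"
proof -
  interpret L: module R L by fact
  show ?thesis
    by (rule mod_homI) (simp_all add: compose_def mod_homD [OF assms(2)] mod_homD [OF assms(3)])
qed

lemma mod_hom_ident:
  assumes "module R M"
  shows "(\<lambda>x\<in>carrier M. x) \<in> mod_hom R M M"
proof -
  interpret M: module R M by fact
  show ?thesis by (rule mod_homI) simp_all
qed

lemma strict_moduleD: "strict_module R M \<Longrightarrow> module R M"
  by (simp add: strict_module_def)

lemma category_module_cat: "category (module_cat (R :: 'r ring) :: (('r, 'a) module, 'a \<Rightarrow> 'a) category)"
proof
  fix X Y :: "('r, 'a) module" and f :: "'a \<Rightarrow> 'a"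
  assume "f \<in> Hom (module_cat R) X Y"
  then have "f \<in> mod_hom R X Y" by (simp add: module_cat_def)
  note f = mod_homD(1,2) [OF this]
  show "Comp (module_cat R) X Y Y (Ident (module_cat R) Y) f = f"
    "Comp (module_cat R) X X Y f (Ident (module_cat R) X) = f"
    using f by (auto simp: module_cat_def compose_def restrict_def extensional_def fun_eq_iff)
next
  fix W X Y Z :: "('r, 'a) module" and f g h :: "'a \<Rightarrow> 'a"
  assume "f \<in> Hom (module_cat R) W X"
  then have "f \<in> mod_hom R W X" by (simp add: module_cat_def)
  note f = mod_homD(2) [OF this]
  show "Comp (module_cat R) W Y Z h (Comp (module_cat R) W X Y g f) =
       Comp (module_cat R) W X Z (Comp (module_cat R) X Y Z h g) f"
    using f by (auto simp: module_cat_def compose_def restrict_def fun_eq_iff)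
qed (auto simp: module_cat_def mod_hom_ident mod_hom_compose strict_moduleD)

lemma inv_into_mod_hom:
  assumes "module R M" "f \<in> mod_hom R M N" "bij_betw f (carrier M) (carrier N)"
  shows "(\<lambda>y\<in>carrier N. inv_into (carrier M) f y) \<in> mod_hom R N M"
proof -
  interpret M: module R M by fact
  note f = mod_homD [OF assms(2)]
  have ex: "\<exists>x\<in>carrier M. y = f x" if "y \<in> carrier N" for y
    using that assms(3) by (auto simp: bij_betw_def)
  have inv: "inv_into (carrier M) f (f x) = x" if "x \<in> carrier M" for x
    using that assms(3) by (simp add: bij_betw_def)
  show ?thesis
  proof (rule mod_homI)
    fix x y assume "x \<in> carrier N" "y \<in> carrier N"
    then obtain x' y' where "x' \<in> carrier M" "y' \<in> carrier M" "x = f x'" "y = f y'"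
      using ex by blast
    then show "restrict (inv_into (carrier M) f) (carrier N) (x \<oplus>\<^bsub>N\<^esub> y) =
      restrict (inv_into (carrier M) f) (carrier N) x \<oplus>\<^bsub>M\<^esub> restrict (inv_into (carrier M) f) (carrier N) y"
      by (simp add: inv f(2) flip: f(3))
  next
    fix r x assume "r \<in> carrier R" "x \<in> carrier N"
    then obtain x' where "x' \<in> carrier M" "x = f x'" using ex by blast
    then show "restrict (inv_into (carrier M) f) (carrier N) (r \<odot>\<^bsub>N\<^esub> x) =
        r \<odot>\<^bsub>M\<^esub> restrict (inv_into (carrier M) f) (carrier N) x"
      using \<open>r \<in> carrier R\<close> by (simp add: inv f(2) flip: f(4))
  qed (auto dest!: ex simp: inv)
qed

lemma is_iso_module_cat:
  assumes "module R M" "f \<in> mod_hom R M N" "bij_betw f (carrier M) (carrier N)"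
  shows "is_iso (module_cat R) M N f"
  unfolding is_iso_def
proof (intro conjI bexI)
  show "(\<lambda>y\<in>carrier N. inv_into (carrier M) f y) \<in> Hom (module_cat R) N M"
    using inv_into_mod_hom [OF assms] by (simp add: module_cat_def)
qed (use assms mod_homD(2) [OF assms(2)] in
    \<open>auto simp: module_cat_def compose_def bij_betw_def fun_eq_iff f_inv_into_f\<close>)

subsection \<open>Finite sums\<close>

text \<open>Sums over lists, because the pairs read off from an element of a tensor product may
  repeat and a sum over their set would lose multiplicities.\<close>

definition lsum :: "('a, 'x) ring_scheme \<Rightarrow> ('z \<Rightarrow> 'a) \<Rightarrow> 'z list \<Rightarrow> 'a" where
  "lsum M f zs = foldr (\<lambda>z s. f z \<oplus>\<^bsub>M\<^esub> s) zs \<zero>\<^bsub>M\<^esub>"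

lemma lsum_simps [simp]:
  "lsum M f [] = \<zero>\<^bsub>M\<^esub>" "lsum M f (z # zs) = f z \<oplus>\<^bsub>M\<^esub> lsum M f zs"
  by (simp_all add: lsum_def)

lemma lsum_cong: "(\<And>z. z \<in> set zs \<Longrightarrow> f z = f' z) \<Longrightarrow> lsum M f zs = lsum M f' zs"
  by (induction zs) simp_all

lemma (in abelian_monoid) lsum_closed [intro, simp]:
  "(\<And>z. z \<in> set zs \<Longrightarrow> f z \<in> carrier G) \<Longrightarrow> lsum G f zs \<in> carrier G"
  by (induction zs) simp_all

lemma (in abelian_monoid) lsum_add:
  assumes "\<And>z. z \<in> set zs \<Longrightarrow> f z \<in> carrier G" "\<And>z. z \<in> set zs \<Longrightarrow> f' z \<in> carrier G"
  shows "lsum G (\<lambda>z. f z \<oplus> f' z) zs = lsum G f zs \<oplus> lsum G f' zs"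
  using assms
proof (induction zs)
  case (Cons z zs)
  then have "lsum G f zs \<in> carrier G" "lsum G f' zs \<in> carrier G" by auto
  with Cons show ?case by (simp add: a_ac)
qed simp

lemma (in abelian_monoid) lsum_finsum:
  assumes "\<And>z a. z \<in> set zs \<Longrightarrow> a \<in> A \<Longrightarrow> f z a \<in> carrier G"
  shows "lsum G (\<lambda>z. \<Oplus>a\<in>A. f z a) zs = (\<Oplus>a\<in>A. lsum G (\<lambda>z. f z a) zs)"
  using assms
proof (induction zs)
  case (Cons z zs)
  then show ?case
    by (simp add: finsum_addf Pi_iff)
qed simp

lemma additive_zero:
  assumes "abelian_group M" "abelian_group N" "\<And>x. x \<in> carrier M \<Longrightarrow> f x \<in> carrier N"
    "\<And>x y. \<lbrakk>x \<in> carrier M; y \<in> carrier M\<rbrakk> \<Longrightarrow> f (x \<oplus>\<^bsub>M\<^esub> y) = f x \<oplus>\<^bsub>N\<^esub> f y"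
  shows "f \<zero>\<^bsub>M\<^esub> = \<zero>\<^bsub>N\<^esub>"
proof -
  interpret M: abelian_group M by fact
  interpret N: abelian_group N by fact
  have "f \<zero>\<^bsub>M\<^esub> \<oplus>\<^bsub>N\<^esub> f \<zero>\<^bsub>M\<^esub> = f \<zero>\<^bsub>M\<^esub>"
    using assms(4) [of "\<zero>\<^bsub>M\<^esub>" "\<zero>\<^bsub>M\<^esub>"] by simp
  then show ?thesis
    using assms(3) [of "\<zero>\<^bsub>M\<^esub>"] by (metis M.zero_closed N.add.l_cancel_one)
qed

lemma additive_lsum:
  assumes "abelian_group M" "abelian_group N" "\<And>x. x \<in> carrier M \<Longrightarrow> f x \<in> carrier N"
    "\<And>x y. \<lbrakk>x \<in> carrier M; y \<in> carrier M\<rbrakk> \<Longrightarrow> f (x \<oplus>\<^bsub>M\<^esub> y) = f x \<oplus>\<^bsub>N\<^esub> f y"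
    and "\<And>z. z \<in> set zs \<Longrightarrow> h z \<in> carrier M"
  shows "f (lsum M h zs) = lsum N (\<lambda>z. f (h z)) zs"
proof -
  interpret M: abelian_group M by fact
  show ?thesis
    using assms(5) by (induction zs) (simp_all add: additive_zero [OF assms(1-4)] assms(4))
qed

text \<open>For an infinite \<open>A\<close> both sums are zero by the default value of
  \<open>finsum\<close>, so traces can be handled before \<open>G\<close> is supposed
  finite.\<close>

lemma additive_finsum:
  assumes "abelian_group M" "abelian_group N" "\<And>x. x \<in> carrier M \<Longrightarrow> f x \<in> carrier N"
    "\<And>x y. \<lbrakk>x \<in> carrier M; y \<in> carrier M\<rbrakk> \<Longrightarrow> f (x \<oplus>\<^bsub>M\<^esub> y) = f x \<oplus>\<^bsub>N\<^esub> f y"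
    and "\<And>a. a \<in> A \<Longrightarrow> h a \<in> carrier M"
  shows "f (finsum M h A) = finsum N (\<lambda>a. f (h a)) A"
proof -
  interpret M: abelian_group M by fact
  interpret N: abelian_group N by fact
  show ?thesis
    using assms(5)
    by (induction A rule: infinite_finite_induct)
      (simp_all add: additive_zero [OF assms(1-4)] assms(3,4) Pi_iff)
qed

section \<open>Tensor products\<close>

locale tensor = M: module B M + N: module B N
  for B :: "'b ring" and M :: "('b, 'm) module" and N :: "('b, 'n) module"
begin

abbreviation "F \<equiv> free_Abelian_group (carrier M \<times> carrier N)"
abbreviation "K \<equiv> tensor_kernel B M N"
abbreviation "T \<equiv> tensor_group B M N"
abbreviation pt (infixl "\<otimes>\<^sub>t" 75) where "x \<otimes>\<^sub>t y \<equiv> pure_tensor B M N x y"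

sublocale F: comm_group F
  by (rule abelian_free_Abelian_group)

lemma rels_subset: "tensor_rels B M N \<subseteq> carrier F"
  by (auto simp: tensor_rels_def carrier_free_Abelian_group_iff
      dest!: subsetD [OF keys_diff] split: if_splits)

lemma subgroup_kernel: "subgroup K F"
  unfolding tensor_kernel_def by (rule F.generate_is_subgroup [OF rels_subset])

lemma normal_kernel: "K \<lhd> F"
  using subgroup_kernel by (simp add: F.normal_iff_subgroup)

lemma comm_group_tensor: "comm_group T"
  unfolding tensor_group_def by (rule F.abelian_FactGroup [OF subgroup_kernel])

sublocale T: comm_group T
  by (rule comm_group_tensor)

lemma coset_hom: "(\<lambda>c. K #>\<^bsub>F\<^esub> c) \<in> hom F T"
  unfolding tensor_group_def by (rule normal.r_coset_hom_Mod [OF normal_kernel])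

lemma coset_closed: "c \<in> carrier F \<Longrightarrow> K #>\<^bsub>F\<^esub> c \<in> carrier T"
  using coset_hom by (auto simp: hom_def)

lemma coset_add:
  "\<lbrakk>c \<in> carrier F; d \<in> carrier F\<rbrakk> \<Longrightarrow> K #>\<^bsub>F\<^esub> (c + d) = (K #>\<^bsub>F\<^esub> c) \<otimes>\<^bsub>T\<^esub> (K #>\<^bsub>F\<^esub> d)"
  using coset_hom by (auto simp: hom_def simp del: carrier_free_Abelian_group_iff)

lemma coset_zero: "K #>\<^bsub>F\<^esub> 0 = \<one>\<^bsub>T\<^esub>"
  using group_hom.hom_one [of F T "\<lambda>c. K #>\<^bsub>F\<^esub> c"] coset_hom
  by (simp add: group_hom_def group_hom_axioms_def)

lemma coset_eq:
  assumes "c \<in> carrier F" "d \<in> carrier F" "c - d \<in> K"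
  shows "K #>\<^bsub>F\<^esub> c = K #>\<^bsub>F\<^esub> d"
proof -
  have "(c - d) \<otimes>\<^bsub>F\<^esub> d \<in> K #>\<^bsub>F\<^esub> d"
    using assms(3) unfolding r_coset_def by blast
  then have "c \<in> K #>\<^bsub>F\<^esub> d" by simp
  then show ?thesis
    using F.repr_independence [OF _ assms(2) subgroup_kernel] by simp
qed

lemma frag_in_F [simp]: "\<lbrakk>x \<in> carrier M; y \<in> carrier N\<rbrakk> \<Longrightarrow> frag_of (x, y) \<in> carrier F"
  by simp

lemma pure_closed [simp]: "\<lbrakk>x \<in> carrier M; y \<in> carrier N\<rbrakk> \<Longrightarrow> x \<otimes>\<^sub>t y \<in> carrier T"
  unfolding pure_tensor_def by (intro coset_closed frag_in_F)

lemma F_add: "\<lbrakk>c \<in> carrier F; d \<in> carrier F\<rbrakk> \<Longrightarrow> c + d \<in> carrier F"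
  using F.m_closed [of c d] by (simp del: carrier_free_Abelian_group_iff)

lemma F_uminus: "c \<in> carrier F \<Longrightarrow> - c \<in> carrier F"
  using F.inv_closed [of c] by simp

lemma pure_add_left:
  assumes "x \<in> carrier M" "x' \<in> carrier M" "y \<in> carrier N"
  shows "(x \<oplus>\<^bsub>M\<^esub> x') \<otimes>\<^sub>t y = x \<otimes>\<^sub>t y \<otimes>\<^bsub>T\<^esub> x' \<otimes>\<^sub>t y"
proof -
  have "frag_of (x \<oplus>\<^bsub>M\<^esub> x', y) - frag_of (x, y) - frag_of (x', y) \<in> K"
    using assms unfolding tensor_kernel_def
    by (intro generate.incl) (auto simp: tensor_rels_def)
  then have "K #>\<^bsub>F\<^esub> frag_of (x \<oplus>\<^bsub>M\<^esub> x', y) = K #>\<^bsub>F\<^esub> (frag_of (x, y) + frag_of (x', y))"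
    using assms by (intro coset_eq F_add frag_in_F) (simp_all add: diff_diff_eq)
  then show ?thesis
    unfolding pure_tensor_def using assms by (simp only: coset_add frag_in_F)
qed

lemma pure_add_right:
  assumes "x \<in> carrier M" "y \<in> carrier N" "y' \<in> carrier N"
  shows "x \<otimes>\<^sub>t (y \<oplus>\<^bsub>N\<^esub> y') = x \<otimes>\<^sub>t y \<otimes>\<^bsub>T\<^esub> x \<otimes>\<^sub>t y'"
proof -
  have "frag_of (x, y \<oplus>\<^bsub>N\<^esub> y') - frag_of (x, y) - frag_of (x, y') \<in> K"
    using assms unfolding tensor_kernel_def
    by (intro generate.incl) (auto simp: tensor_rels_def)
  then have "K #>\<^bsub>F\<^esub> frag_of (x, y \<oplus>\<^bsub>N\<^esub> y') = K #>\<^bsub>F\<^esub> (frag_of (x, y) + frag_of (x, y'))"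
    using assms by (intro coset_eq F_add frag_in_F) (simp_all add: diff_diff_eq)
  then show ?thesis
    unfolding pure_tensor_def using assms by (simp only: coset_add frag_in_F)
qed

lemma pure_smult:
  assumes "b \<in> carrier B" "x \<in> carrier M" "y \<in> carrier N"
  shows "(b \<odot>\<^bsub>M\<^esub> x) \<otimes>\<^sub>t y = x \<otimes>\<^sub>t (b \<odot>\<^bsub>N\<^esub> y)"
proof -
  have "frag_of (b \<odot>\<^bsub>M\<^esub> x, y) - frag_of (x, b \<odot>\<^bsub>N\<^esub> y) \<in> K"
    using assms unfolding tensor_kernel_def
    by (intro generate.incl) (auto simp: tensor_rels_def)
  then show ?thesis
    unfolding pure_tensor_def using assms by (intro coset_eq frag_in_F) simp_all
qed

lemma pure_zero_left:
  assumes "y \<in> carrier N"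
  shows "\<zero>\<^bsub>M\<^esub> \<otimes>\<^sub>t y = \<one>\<^bsub>T\<^esub>"
  using pure_add_left [OF M.zero_closed M.zero_closed assms] assms
  by (simp add: T.l_cancel_one')

lemma pure_zero_right:
  assumes "x \<in> carrier M"
  shows "x \<otimes>\<^sub>t \<zero>\<^bsub>N\<^esub> = \<one>\<^bsub>T\<^esub>"
  using pure_add_right [OF assms N.zero_closed N.zero_closed] assms
  by (simp add: T.l_cancel_one')

lemma pure_minus_left:
  assumes "x \<in> carrier M" "y \<in> carrier N"
  shows "(\<ominus>\<^bsub>M\<^esub> x) \<otimes>\<^sub>t y = inv\<^bsub>T\<^esub> (x \<otimes>\<^sub>t y)"
  using pure_add_left [of "\<ominus>\<^bsub>M\<^esub> x" x y] assms
  by (intro T.inv_equality [symmetric]) (simp_all add: M.l_neg pure_zero_left)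

text \<open>No inverses have to be considered, since \<open>-(x \<otimes> y) = (-x) \<otimes> y\<close>.\<close>

lemma tensor_induct [consumes 1, case_names one pure]:
  assumes "t \<in> carrier T" and one: "P \<one>\<^bsub>T\<^esub>"
    and pure: "\<And>x y t. \<lbrakk>x \<in> carrier M; y \<in> carrier N; t \<in> carrier T; P t\<rbrakk> \<Longrightarrow> P (x \<otimes>\<^sub>t y \<otimes>\<^bsub>T\<^esub> t)"
  shows "P t"
proof -
  obtain c where c: "c \<in> carrier F" and t: "t = K #>\<^bsub>F\<^esub> c"
    using assms(1) by (auto simp: tensor_group_def FactGroup_def RCOSETS_def)
  have "Poly_Mapping.keys c \<subseteq> carrier M \<times> carrier N" using c by simp
  \<comment> \<open>\<open>frag_induction\<close> builds \<open>c\<close> from differences, so the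
    claim for \<open>- c\<close> has to be carried along. The quantified \<open>t\<close> allows the
    summands to be added one after the other.\<close>
  then have "c \<in> carrier F \<and> (\<forall>t\<in>carrier T. P t \<longrightarrow>
      P ((K #>\<^bsub>F\<^esub> c) \<otimes>\<^bsub>T\<^esub> t) \<and> P ((K #>\<^bsub>F\<^esub> (- c)) \<otimes>\<^bsub>T\<^esub> t))"
  proof (induction c rule: frag_induction)
    case zero
    then show ?case by (simp add: coset_zero)
  next
    case (one z)
    then obtain x y where z: "z = (x, y)" "x \<in> carrier M" "y \<in> carrier N" by auto
    have "(K #>\<^bsub>F\<^esub> (- frag_of z)) \<otimes>\<^bsub>T\<^esub> (K #>\<^bsub>F\<^esub> frag_of z) = \<one>\<^bsub>T\<^esub>"
      using coset_add [of "- frag_of z" "frag_of z"] z F_uminus [of "frag_of z"]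
      by (simp add: coset_zero)
    then have "K #>\<^bsub>F\<^esub> (- frag_of z) = inv\<^bsub>T\<^esub> (x \<otimes>\<^sub>t y)"
      using z F_uminus [of "frag_of z"]
      by (intro T.inv_equality [symmetric])
        (simp_all add: pure_tensor_def coset_closed del: carrier_free_Abelian_group_iff)
    then have "K #>\<^bsub>F\<^esub> (- frag_of z) = (\<ominus>\<^bsub>M\<^esub> x) \<otimes>\<^sub>t y"
      using z by (simp add: pure_minus_left)
    moreover have "K #>\<^bsub>F\<^esub> frag_of z = x \<otimes>\<^sub>t y" by (simp add: z pure_tensor_def)
    ultimately show ?case using z pure by simp
  next
    case (diff a b)
    then have ab: "a \<in> carrier F" "b \<in> carrier F" "- a \<in> carrier F" "- b \<in> carrier F"
      using F_uminus by blast+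
    have "a + - b \<in> carrier F" using ab by (intro F_add)
    then have "a - b \<in> carrier F" by (simp only: add_uminus_conv_diff)
    moreover have "P ((K #>\<^bsub>F\<^esub> (a - b)) \<otimes>\<^bsub>T\<^esub> t) \<and> P ((K #>\<^bsub>F\<^esub> (- (a - b))) \<otimes>\<^bsub>T\<^esub> t)"
      if t: "t \<in> carrier T" "P t" for t
    proof -
      have *: "K #>\<^bsub>F\<^esub> (a - b) = (K #>\<^bsub>F\<^esub> a) \<otimes>\<^bsub>T\<^esub> (K #>\<^bsub>F\<^esub> (- b))"
        "K #>\<^bsub>F\<^esub> (- (a - b)) = (K #>\<^bsub>F\<^esub> b) \<otimes>\<^bsub>T\<^esub> (K #>\<^bsub>F\<^esub> (- a))"
        using coset_add [of a "- b"] coset_add [of b "- a"] ab by simp_all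
      have "P ((K #>\<^bsub>F\<^esub> a) \<otimes>\<^bsub>T\<^esub> ((K #>\<^bsub>F\<^esub> (- b)) \<otimes>\<^bsub>T\<^esub> t))"
        "P ((K #>\<^bsub>F\<^esub> b) \<otimes>\<^bsub>T\<^esub> ((K #>\<^bsub>F\<^esub> (- a)) \<otimes>\<^bsub>T\<^esub> t))"
        using diff t ab coset_closed by blast+
      then show ?thesis
        using ab t coset_closed by (simp only: * T.m_assoc)
    qed
    ultimately show ?case by blast
  qed
  then have "P ((K #>\<^bsub>F\<^esub> c) \<otimes>\<^bsub>T\<^esub> \<one>\<^bsub>T\<^esub>)" using one by blast
  then show ?thesis using c by (simp only: t T.r_one coset_closed)
qed

end

text \<open>The source of most maps between tensor products here: multiplication by \<open>e\<close>
  on the left factor gives the scalars of \<open>E \<otimes> A\<close>, the action of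
  \<open>g\<close> on it gives the group action, and a homomorphism on the right factor gives
  functoriality.\<close>

lemma tensor_map:
  assumes "tensor B M N" "tensor B M' N'"
    and \<phi>: "\<And>x. x \<in> carrier M \<Longrightarrow> \<phi> x \<in> carrier M'"
      "\<And>x y. \<lbrakk>x \<in> carrier M; y \<in> carrier M\<rbrakk> \<Longrightarrow> \<phi> (x \<oplus>\<^bsub>M\<^esub> y) = \<phi> x \<oplus>\<^bsub>M'\<^esub> \<phi> y"
      "\<And>b x. \<lbrakk>b \<in> carrier B; x \<in> carrier M\<rbrakk> \<Longrightarrow> \<phi> (b \<odot>\<^bsub>M\<^esub> x) = b \<odot>\<^bsub>M'\<^esub> \<phi> x"
    and f: "\<And>x. x \<in> carrier N \<Longrightarrow> f x \<in> carrier N'"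
      "\<And>x y. \<lbrakk>x \<in> carrier N; y \<in> carrier N\<rbrakk> \<Longrightarrow> f (x \<oplus>\<^bsub>N\<^esub> y) = f x \<oplus>\<^bsub>N'\<^esub> f y"
      "\<And>b x. \<lbrakk>b \<in> carrier B; x \<in> carrier N\<rbrakk> \<Longrightarrow> f (b \<odot>\<^bsub>N\<^esub> x) = b \<odot>\<^bsub>N'\<^esub> f x"
  defines "h \<equiv> tensor_lift B M N (tensor_group B M' N') (\<lambda>x y. pure_tensor B M' N' (\<phi> x) (f y))"
  shows "h \<in> hom (tensor_group B M N) (tensor_group B M' N')"
    and "\<And>x y. \<lbrakk>x \<in> carrier M; y \<in> carrier N\<rbrakk> \<Longrightarrow> h (pure_tensor B M N x y) = pure_tensor B M' N' (\<phi> x) (f y)"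
proof -
  interpret S: tensor B M N by fact
  interpret T: tensor B M' N' by fact
  note facts = S.M.module_axioms S.N.module_axioms T.comm_group_tensor
  show "h \<in> hom (tensor_group B M N) (tensor_group B M' N')"
    unfolding h_def
    by (rule tensor_lift(1) [OF facts]) (simp_all add: \<phi> f T.pure_add_left T.pure_add_right T.pure_smult)
  show "h (pure_tensor B M N x y) = pure_tensor B M' N' (\<phi> x) (f y)"
    if "x \<in> carrier M" "y \<in> carrier N" for x y
    unfolding h_def
    by (rule tensor_lift(2) [OF facts _ _ _ _ that])
      (simp_all add: \<phi> f T.pure_add_left T.pure_add_right T.pure_smult)
qed

section \<open>Modules with semilinear group action\<close>

text \<open>Neither finiteness of \<open>G\<close> nor purity nor the Galois condition is supposed
  at this level. It carries the constructions on tensors, the functor of invariants and the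
  comparison with cocycles.\<close>

locale galois_data =
  fixes B :: "'b ring" and E :: "'e ring" and G :: "'g monoid"
    and p :: "'b \<Rightarrow> 'e" and act :: "'e \<Rightarrow> 'g \<Rightarrow> 'e"
  assumes cring_B: "cring B" and cring_E: "cring E" and p_hom: "p \<in> ring_hom B E"
    and group_G: "group G" and action: "ring_right_action G E act"
    and act_p: "\<lbrakk>b \<in> carrier B; g \<in> carrier G\<rbrakk> \<Longrightarrow> act (p b) g = p b"
begin

sublocale B: cring B by (rule cring_B)
sublocale E: cring E by (rule cring_E)
sublocale G: group G by (rule group_G)
sublocale p: ring_hom_cring B E p
  by unfold_locales (rule p_hom)

lemma act_iso: "g \<in> carrier G \<Longrightarrow> (\<lambda>e. act e g) \<in> ring_iso E E"
  using action by (simp add: ring_right_action_def)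

lemma act_closed [simp]: "\<lbrakk>e \<in> carrier E; g \<in> carrier G\<rbrakk> \<Longrightarrow> act e g \<in> carrier E"
  and act_add: "\<lbrakk>e \<in> carrier E; e' \<in> carrier E; g \<in> carrier G\<rbrakk>
      \<Longrightarrow> act (e \<oplus>\<^bsub>E\<^esub> e') g = act e g \<oplus>\<^bsub>E\<^esub> act e' g"
  and act_mult: "\<lbrakk>e \<in> carrier E; e' \<in> carrier E; g \<in> carrier G\<rbrakk>
      \<Longrightarrow> act (e \<otimes>\<^bsub>E\<^esub> e') g = act e g \<otimes>\<^bsub>E\<^esub> act e' g"
  and act_one [simp]: "g \<in> carrier G \<Longrightarrow> act \<one>\<^bsub>E\<^esub> g = \<one>\<^bsub>E\<^esub>"
  using act_iso [of g] by (auto simp: ring_iso_def ring_hom_def)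

lemma act_unit [simp]: "e \<in> carrier E \<Longrightarrow> act e \<one>\<^bsub>G\<^esub> = e"
  and act_act: "\<lbrakk>e \<in> carrier E; g \<in> carrier G; h \<in> carrier G\<rbrakk>
      \<Longrightarrow> act e (g \<otimes>\<^bsub>G\<^esub> h) = act (act e g) h"
  using action by (simp_all add: ring_right_action_def)

abbreviation "Ep \<equiv> restrict_scalars B p (self_module E)"
abbreviation "GM \<equiv> gmodule_cat B E p G act"

lemma module_self: "module E (self_module E)"
  unfolding self_module_def
  by (intro moduleI abelian_groupI E.is_cring)
    (auto simp: E.a_ac E.m_assoc E.l_distr E.r_distr intro: E.l_neg)

lemma module_restrict_scalars:
  assumes "module E D"
  shows "module B (restrict_scalars B p D)"
proof -
  interpret D: module E D by fact
  show ?thesis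
    unfolding restrict_scalars_def
    by (intro moduleI abelian_groupI cring_B)
      (auto simp: D.a_ac D.smult_l_distr D.smult_r_distr D.smult_assoc1 intro: D.l_neg)
qed

lemma restrict_scalars_simps [simp]:
  "carrier (restrict_scalars B p D) = carrier D" "\<zero>\<^bsub>restrict_scalars B p D\<^esub> = \<zero>\<^bsub>D\<^esub>"
  "\<lbrakk>x \<in> carrier D; y \<in> carrier D\<rbrakk> \<Longrightarrow> x \<oplus>\<^bsub>restrict_scalars B p D\<^esub> y = x \<oplus>\<^bsub>D\<^esub> y"
  "\<lbrakk>b \<in> carrier B; x \<in> carrier D\<rbrakk> \<Longrightarrow> b \<odot>\<^bsub>restrict_scalars B p D\<^esub> x = p b \<odot>\<^bsub>D\<^esub> x"
  by (simp_all add: restrict_scalars_def)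

lemma self_module_simps [simp]:
  "carrier (self_module E) = carrier E" "\<zero>\<^bsub>self_module E\<^esub> = \<zero>\<^bsub>E\<^esub>"
  "\<lbrakk>x \<in> carrier E; y \<in> carrier E\<rbrakk> \<Longrightarrow> x \<oplus>\<^bsub>self_module E\<^esub> y = x \<oplus>\<^bsub>E\<^esub> y"
  "\<lbrakk>b \<in> carrier E; x \<in> carrier E\<rbrakk> \<Longrightarrow> b \<odot>\<^bsub>self_module E\<^esub> x = b \<otimes>\<^bsub>E\<^esub> x"
  by (simp_all add: self_module_def)

lemma module_Ep: "module B Ep"
  by (intro module_restrict_scalars module_self)

text \<open>Spares checking the automorphism condition: \<open>d \<mapsto> dg\<close> is inverted by
  the action of the inverse of \<open>g\<close>, and it is \<open>B\<close>-linear because it is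
  semilinear and \<open>act\<close> fixes \<open>p b\<close>.\<close>

lemma gmodule_objI:
  assumes D: "strict_module E D" and ext: "\<rho> \<in> carrier D \<rightarrow>\<^sub>E carrier G \<rightarrow>\<^sub>E carrier D"
    and one: "\<And>d. d \<in> carrier D \<Longrightarrow> \<rho> d \<one>\<^bsub>G\<^esub> = d"
    and mult: "\<And>d g h. \<lbrakk>d \<in> carrier D; g \<in> carrier G; h \<in> carrier G\<rbrakk> \<Longrightarrow> \<rho> d (g \<otimes>\<^bsub>G\<^esub> h) = \<rho> (\<rho> d g) h"
    and add: "\<And>d d' g. \<lbrakk>d \<in> carrier D; d' \<in> carrier D; g \<in> carrier G\<rbrakk>
      \<Longrightarrow> \<rho> (d \<oplus>\<^bsub>D\<^esub> d') g = \<rho> d g \<oplus>\<^bsub>D\<^esub> \<rho> d' g"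
    and semilinear: "\<And>e d g. \<lbrakk>e \<in> carrier E; d \<in> carrier D; g \<in> carrier G\<rbrakk>
      \<Longrightarrow> \<rho> (e \<odot>\<^bsub>D\<^esub> d) g = act e g \<odot>\<^bsub>D\<^esub> \<rho> d g"
  shows "(D, \<rho>) \<in> Obj GM"
proof -
  interpret D: module E D using D by (rule strict_moduleD)
  have cl: "\<rho> d g \<in> carrier D" if "d \<in> carrier D" "g \<in> carrier G" for d g
    using ext that by (auto simp: PiE_iff)
  have "(\<lambda>d\<in>carrier D. \<rho> d g) \<in> mod_auto B (restrict_scalars B p D)" if g: "g \<in> carrier G" for g
  proof -
    have "bij_betw (\<lambda>d\<in>carrier D. \<rho> d g) (carrier D) (carrier D)"
      by (rule bij_betw_byWitness [where f' = "\<lambda>d. \<rho> d (inv\<^bsub>G\<^esub> g)"])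
        (use g in \<open>auto simp: cl one simp flip: mult\<close>)
    moreover have "(\<lambda>d\<in>carrier D. \<rho> d g) \<in> mod_hom B (restrict_scalars B p D) (restrict_scalars B p D)"
      by (rule mod_homI) (simp_all add: g cl add semilinear act_p)
    ultimately show ?thesis by (simp add: mod_auto_def)
  qed
  then show ?thesis
    using assms by (simp add: gmodule_cat_def module_cat_def)
qed

end

locale galois_module = galois_data B E G p act
  for B :: "'b ring" and E :: "'e ring" and G :: "'g monoid"
    and p :: "'b \<Rightarrow> 'e" and act :: "'e \<Rightarrow> 'g \<Rightarrow> 'e" +
  fixes D :: "('e, 'a) module" and \<rho> :: "'a \<Rightarrow> 'g \<Rightarrow> 'a"
  assumes obj: "(D, \<rho>) \<in> Obj (gmodule_cat B E p G act)"
begin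

lemma strict: "strict_module E D"
  using obj by (simp add: gmodule_cat_def module_cat_def)

sublocale D: module E D
  using strict by (rule strict_moduleD)

lemma \<rho>_ext: "\<rho> \<in> carrier D \<rightarrow>\<^sub>E carrier G \<rightarrow>\<^sub>E carrier D"
  using obj by (simp add: gmodule_cat_def)

lemma \<rho>_closed [simp]: "\<lbrakk>d \<in> carrier D; g \<in> carrier G\<rbrakk> \<Longrightarrow> \<rho> d g \<in> carrier D"
  using \<rho>_ext by (auto simp: PiE_iff)

lemma \<rho>_one [simp]: "d \<in> carrier D \<Longrightarrow> \<rho> d \<one>\<^bsub>G\<^esub> = d"
  and \<rho>_mult: "\<lbrakk>d \<in> carrier D; g \<in> carrier G; h \<in> carrier G\<rbrakk> \<Longrightarrow> \<rho> d (g \<otimes>\<^bsub>G\<^esub> h) = \<rho> (\<rho> d g) h"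
  and \<rho>_smult: "\<lbrakk>e \<in> carrier E; d \<in> carrier D; g \<in> carrier G\<rbrakk>
      \<Longrightarrow> \<rho> (e \<odot>\<^bsub>D\<^esub> d) g = act e g \<odot>\<^bsub>D\<^esub> \<rho> d g"
  using obj by (simp_all add: gmodule_cat_def)

lemma \<rho>_add:
  assumes "d \<in> carrier D" "d' \<in> carrier D" "g \<in> carrier G"
  shows "\<rho> (d \<oplus>\<^bsub>D\<^esub> d') g = \<rho> d g \<oplus>\<^bsub>D\<^esub> \<rho> d' g"
proof -
  have "(\<lambda>d\<in>carrier D. \<rho> d g) \<in> mod_hom B (restrict_scalars B p D) (restrict_scalars B p D)"
    using obj assms(3) by (simp add: gmodule_cat_def mod_auto_def)
  from mod_homD(3) [OF this, of d d'] show ?thesis using assms by simp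
qed

end

context galois_data
begin

lemma gmodule_cat_simps:
  "Hom GM X Y = {f \<in> mod_hom E (fst X) (fst Y).
     \<forall>d\<in>carrier (fst X). \<forall>g\<in>carrier G. f (snd X d g) = snd Y (f d) g}"
  "Ident GM X = (\<lambda>d\<in>carrier (fst X). d)"
  "Comp GM X Y Z k f = compose (carrier (fst X)) k f"
  by (simp_all add: gmodule_cat_def module_cat_def split_beta)

lemma gmodule_objD:
  assumes "X \<in> Obj GM"
  shows "galois_module B E G p act (fst X) (snd X)"
  using assms galois_data_axioms by (simp add: galois_module_def galois_module_axioms_def)

lemma category_GM: "category (GM :: (('e, 'a) module \<times> ('a \<Rightarrow> 'g \<Rightarrow> 'a), 'a \<Rightarrow> 'a) category)"
proof -
  interpret M: category "module_cat E :: (('e, 'a) module, 'a \<Rightarrow> 'a) category"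
    by (rule category_module_cat)
  have strict: "fst X \<in> Obj (module_cat E)" if "X \<in> Obj GM" for X :: "('e, 'a) module \<times> ('a \<Rightarrow> 'g \<Rightarrow> 'a)"
    using that by (auto simp: gmodule_cat_def)
  have hom: "f \<in> Hom (module_cat E) (fst X) (fst Y)" if "f \<in> Hom GM X Y"
    for X Y :: "('e, 'a) module \<times> ('a \<Rightarrow> 'g \<Rightarrow> 'a)" and f
    using that by (auto simp: gmodule_cat_def split_beta)
  have eqs: "Ident GM X = Ident (module_cat E) (fst X)"
    "Comp GM X Y Z = Comp (module_cat E) (fst X) (fst Y) (fst Z)"
    for X Y Z :: "('e, 'a) module \<times> ('a \<Rightarrow> 'g \<Rightarrow> 'a)"
    by (simp_all add: gmodule_cat_def split_beta)
  show ?thesis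
  proof
    fix X :: "('e, 'a) module \<times> ('a \<Rightarrow> 'g \<Rightarrow> 'a)"
    assume X: "X \<in> Obj GM"
    interpret X: galois_module B E G p act "fst X" "snd X" by (rule gmodule_objD [OF X])
    show "Ident GM X \<in> Hom GM X X"
      by (simp add: gmodule_cat_simps mod_hom_ident X.D.module_axioms)
  next
    fix X Y Z :: "('e, 'a) module \<times> ('a \<Rightarrow> 'g \<Rightarrow> 'a)" and f g
    assume *: "X \<in> Obj GM" "Y \<in> Obj GM" "Z \<in> Obj GM" "f \<in> Hom GM X Y" "g \<in> Hom GM Y Z"
    interpret X: galois_module B E G p act "fst X" "snd X" by (rule gmodule_objD [OF *(1)])
    have f: "f \<in> mod_hom E (fst X) (fst Y)" and g: "g \<in> mod_hom E (fst Y) (fst Z)"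
      using * by (auto simp: gmodule_cat_simps)
    show "Comp GM X Y Z g f \<in> Hom GM X Z"
      using *(4,5) mod_hom_compose [OF X.D.module_axioms f g] mod_homD(2) [OF f]
      by (simp add: gmodule_cat_simps compose_eq)
  qed (auto simp: eqs intro!: M.Comp_Ident_left M.Comp_Ident_right M.Comp_assoc dest: strict hom)
qed

lemma is_iso_GM:
  assumes X: "X \<in> Obj GM" and f: "f \<in> Hom GM X Y" and bij: "bij_betw f (carrier (fst X)) (carrier (fst Y))"
  shows "is_iso GM X Y f"
  unfolding is_iso_def
proof (intro conjI bexI)
  interpret X: galois_module B E G p act "fst X" "snd X" by (rule gmodule_objD [OF X])
  let ?h = "\<lambda>y\<in>carrier (fst Y). inv_into (carrier (fst X)) f y"
  have fm: "f \<in> mod_hom E (fst X) (fst Y)" using f by (simp add: gmodule_cat_simps)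
  have inv: "inv_into (carrier (fst X)) f (f x) = x" if "x \<in> carrier (fst X)" for x
    using that bij by (simp add: bij_betw_def)
  have "?h (snd Y d g) = snd X (?h d) g" if d: "d \<in> carrier (fst Y)" and g: "g \<in> carrier G" for d g
  proof -
    obtain x where x: "x \<in> carrier (fst X)" "d = f x" using d bij by (auto simp: bij_betw_def)
    have "snd Y d g = f (snd X x g)" using f x g by (simp add: gmodule_cat_simps)
    then show ?thesis using x g by (simp add: inv mod_homD(2) [OF fm])
  qed
  then show "?h \<in> Hom GM Y X"
    using inv_into_mod_hom [OF X.D.module_axioms fm bij] by (simp add: gmodule_cat_simps)
  show "Comp GM X Y X ?h f = Ident GM X"
    by (auto simp: gmodule_cat_simps compose_def fun_eq_iff inv mod_homD(2) [OF fm])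
  show "Comp GM Y X Y f ?h = Ident GM Y"
    using bij by (auto simp: gmodule_cat_simps compose_def fun_eq_iff bij_betw_def f_inv_into_f)
qed (rule f)

end

section \<open>Copies of a module with action on another type\<close>

context galois_module
begin

text \<open>\<open>encode\<close> is a bare choice, so its injectivity is a hypothesis until the
  size of the carrier has been bounded. The structure of the copy is that of
  \<open>image_module\<close>.\<close>

lemma copy_obj:
  fixes c :: "'a \<Rightarrow> 'c"
  defines "c \<equiv> encode (carrier D)"
  assumes inj: "inj_on c (carrier D)"
  shows "(copy_gmodule E G (D, \<rho>) :: ('e, 'c) module \<times> _) \<in> Obj (gmodule_cat B E p G act)"
    and "carrier (fst (copy_gmodule E G (D, \<rho>) :: ('e, 'c) module \<times> _)) = c ` carrier D"
    and "restrict c (carrier D) \<in> mod_hom E D (fst (copy_gmodule E G (D, \<rho>)))"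
    and "\<And>d g. \<lbrakk>d \<in> carrier D; g \<in> carrier G\<rbrakk> \<Longrightarrow> c (\<rho> d g) = snd (copy_gmodule E G (D, \<rho>)) (c d) g"
proof -
  define \<rho>' where "\<rho>' = (\<lambda>x\<in>c ` carrier D. \<lambda>g\<in>carrier G. c (\<rho> (inv_into (carrier D) c x) g))"
  have eq: "copy_gmodule E G (D, \<rho>) = (image_module E D c, \<rho>')"
    by (simp add: copy_gmodule_def image_module_def c_def \<rho>'_def decode_def Let_def)
  have inv: "inv_into (carrier D) c (c d) = d" if "d \<in> carrier D" for d
    using inj that by simp
  note I = image_module(1,2,4,5) [OF D.module_axioms is_congruence_inj [OF inj]]
  have \<rho>': "\<rho>' (c d) g = c (\<rho> d g)" if "d \<in> carrier D" "g \<in> carrier G" for d g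
    using that by (simp add: \<rho>'_def inv)
  have "(image_module E D c, \<rho>') \<in> Obj GM"
  proof (rule gmodule_objI [OF I(1)])
    show "\<rho>' \<in> carrier (image_module E D c) \<rightarrow>\<^sub>E carrier G \<rightarrow>\<^sub>E carrier (image_module E D c)"
      by (auto simp: \<rho>'_def I inv)
  qed (auto simp: I(2) \<rho>' \<rho>_mult \<rho>_add \<rho>_smult simp flip: I(3,4))
  then show "(copy_gmodule E G (D, \<rho>) :: ('e, 'c) module \<times> _) \<in> Obj GM" by (simp add: eq)
  show "carrier (fst (copy_gmodule E G (D, \<rho>) :: ('e, 'c) module \<times> _)) = c ` carrier D"
    by (simp add: eq I)
  show "restrict c (carrier D) \<in> mod_hom E D (fst (copy_gmodule E G (D, \<rho>)))"
    by (rule mod_homI) (simp_all add: eq I)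
  show "c (\<rho> d g) = snd (copy_gmodule E G (D, \<rho>)) (c d) g"
    if "d \<in> carrier D" "g \<in> carrier G" for d g
    using that by (simp add: eq \<rho>')
qed

end

subsection \<open>Extension of scalars\<close>

locale galois_ext = galois_data B E G p act + A: module B A
  for B :: "'b ring" and E :: "'e ring" and G :: "'g monoid"
    and p :: "'b \<Rightarrow> 'e" and act :: "'e \<Rightarrow> 'g \<Rightarrow> 'e" and A :: "('b, 'a) module"
begin

sublocale tensor B Ep A
  by (simp add: tensor_def module_Ep A.module_axioms)

abbreviation ext_pure (infixl "\<otimes>\<^sub>t" 75) where "e \<otimes>\<^sub>t a \<equiv> pure_tensor B Ep A e a"
abbreviation "X \<equiv> ext_module B E p A"
abbreviation "\<alpha> \<equiv> ext_action B E p G act A"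

lemma ext_simps [simp]:
  "carrier X = carrier T" "\<zero>\<^bsub>X\<^esub> = \<one>\<^bsub>T\<^esub>"
  "\<lbrakk>s \<in> carrier T; t \<in> carrier T\<rbrakk> \<Longrightarrow> s \<oplus>\<^bsub>X\<^esub> t = s \<otimes>\<^bsub>T\<^esub> t"
  by (simp_all add: ext_module_def Let_def)

lemma smult_hom: "e \<in> carrier E \<Longrightarrow> (\<lambda>t\<in>carrier T. e \<odot>\<^bsub>X\<^esub> t) \<in> hom T T"
  and smult_pure: "\<lbrakk>e \<in> carrier E; e' \<in> carrier E; a \<in> carrier A\<rbrakk> \<Longrightarrow> e \<odot>\<^bsub>X\<^esub> e' \<otimes>\<^sub>t a = (e \<otimes>\<^bsub>E\<^esub> e') \<otimes>\<^sub>t a"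
proof -
  have *: "tensor_lift B Ep A T (\<lambda>e' a. (e \<otimes>\<^bsub>E\<^esub> e') \<otimes>\<^sub>t a) \<in> hom T T \<and>
      (\<forall>e'\<in>carrier E. \<forall>a\<in>carrier A. tensor_lift B Ep A T (\<lambda>e' a. (e \<otimes>\<^bsub>E\<^esub> e') \<otimes>\<^sub>t a) (e' \<otimes>\<^sub>t a) =
         (e \<otimes>\<^bsub>E\<^esub> e') \<otimes>\<^sub>t a)" if e: "e \<in> carrier E" for e
    using tensor_map [OF tensor_axioms tensor_axioms, of "\<lambda>e'. e \<otimes>\<^bsub>E\<^esub> e'" "\<lambda>a. a"] e
    by (simp add: E.r_distr E.m_lcomm)
  then show "e \<in> carrier E \<Longrightarrow> (\<lambda>t\<in>carrier T. e \<odot>\<^bsub>X\<^esub> t) \<in> hom T T"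
    by (auto simp: ext_module_def Let_def hom_def Pi_iff)
  show "\<lbrakk>e \<in> carrier E; e' \<in> carrier E; a \<in> carrier A\<rbrakk> \<Longrightarrow> e \<odot>\<^bsub>X\<^esub> e' \<otimes>\<^sub>t a = (e \<otimes>\<^bsub>E\<^esub> e') \<otimes>\<^sub>t a"
    using * by (simp add: ext_module_def Let_def)
qed

lemma smult_closed_T [simp]: "\<lbrakk>e \<in> carrier E; t \<in> carrier T\<rbrakk> \<Longrightarrow> e \<odot>\<^bsub>X\<^esub> t \<in> carrier T"
  and smult_mult_T: "\<lbrakk>e \<in> carrier E; s \<in> carrier T; t \<in> carrier T\<rbrakk>
      \<Longrightarrow> e \<odot>\<^bsub>X\<^esub> (s \<otimes>\<^bsub>T\<^esub> t) = (e \<odot>\<^bsub>X\<^esub> s) \<otimes>\<^bsub>T\<^esub> (e \<odot>\<^bsub>X\<^esub> t)"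
  and smult_one_T: "e \<in> carrier E \<Longrightarrow> e \<odot>\<^bsub>X\<^esub> \<one>\<^bsub>T\<^esub> = \<one>\<^bsub>T\<^esub>"
  using smult_hom [of e] group_hom.hom_one [of T T "\<lambda>t\<in>carrier T. e \<odot>\<^bsub>X\<^esub> t"]
  by (auto simp: hom_def Pi_iff group_hom_def group_hom_axioms_def)

text \<open>\<open>tensor_induct\<close> in the additive notation of the module \<open>X\<close>.
  The rules \<open>ext_simps(2,3)\<close> rewrite this notation back to the multiplicative group
  \<open>T\<close>, hence their removal from the simplifier in inductions over tensors.\<close>

lemma ext_induct [consumes 1, case_names zero pure]:
  assumes "t \<in> carrier T" "P \<zero>\<^bsub>X\<^esub>"
    "\<And>e a t. \<lbrakk>e \<in> carrier E; a \<in> carrier A; t \<in> carrier T; P t\<rbrakk> \<Longrightarrow> P (e \<otimes>\<^sub>t a \<oplus>\<^bsub>X\<^esub> t)"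
  shows "P t"
  using assms(1) by (induction rule: tensor_induct) (use assms(2,3) in auto)

lemma module_ext: "module E X"
proof (rule moduleI)
  show "abelian_group X"
    by (rule abelian_groupI) (auto simp: T.m_ac intro: T.l_inv)
  \<comment> \<open>Both laws are additive in \<open>x\<close>, so a single induction down to pure
    tensors covers them.\<close>
  have x: "(a \<oplus>\<^bsub>E\<^esub> b) \<odot>\<^bsub>X\<^esub> x = a \<odot>\<^bsub>X\<^esub> x \<oplus>\<^bsub>X\<^esub> b \<odot>\<^bsub>X\<^esub> x \<and>
      (a \<otimes>\<^bsub>E\<^esub> b) \<odot>\<^bsub>X\<^esub> x = a \<odot>\<^bsub>X\<^esub> (b \<odot>\<^bsub>X\<^esub> x)"
    if *: "a \<in> carrier E" "b \<in> carrier E" "x \<in> carrier X" for a b x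
    using that(3) unfolding ext_simps(1)
  proof (induction rule: ext_induct)
    case (pure e c t)
    have "((a \<oplus>\<^bsub>E\<^esub> b) \<otimes>\<^bsub>E\<^esub> e) \<otimes>\<^sub>t c = (a \<otimes>\<^bsub>E\<^esub> e) \<otimes>\<^sub>t c \<otimes>\<^bsub>T\<^esub> (b \<otimes>\<^bsub>E\<^esub> e) \<otimes>\<^sub>t c"
      using pure * pure_add_left [of "a \<otimes>\<^bsub>E\<^esub> e" "b \<otimes>\<^bsub>E\<^esub> e" c] by (simp add: E.l_distr)
    with pure * show ?case
      by (simp add: smult_mult_T smult_pure E.m_assoc T.m_ac)
  qed (use * in \<open>simp add: smult_one_T\<close>)
  fix a b x
  assume *: "a \<in> carrier E" "b \<in> carrier E" "x \<in> carrier X"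
  show "(a \<oplus>\<^bsub>E\<^esub> b) \<odot>\<^bsub>X\<^esub> x = a \<odot>\<^bsub>X\<^esub> x \<oplus>\<^bsub>X\<^esub> b \<odot>\<^bsub>X\<^esub> x"
    "(a \<otimes>\<^bsub>E\<^esub> b) \<odot>\<^bsub>X\<^esub> x = a \<odot>\<^bsub>X\<^esub> (b \<odot>\<^bsub>X\<^esub> x)"
    using x [OF *] by simp_all
next
  fix x assume "x \<in> carrier X"
  then have "x \<in> carrier T" by simp
  then show "\<one>\<^bsub>E\<^esub> \<odot>\<^bsub>X\<^esub> x = x"
    by (induction rule: ext_induct) (simp_all add: smult_one_T smult_mult_T smult_pure)
qed (simp_all add: cring_E smult_mult_T)

lemma strict_ext: "strict_module E X"
  using module_ext unfolding ext_module_def Let_def by (rule strict_module_mk_module)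

sublocale X: module E X
  by (rule module_ext)

lemma action_lift:
  assumes g: "g \<in> carrier G"
  shows "tensor_lift B Ep A T (\<lambda>e a. act e g \<otimes>\<^sub>t a) \<in> hom T T"
    and "\<lbrakk>e \<in> carrier E; a \<in> carrier A\<rbrakk>
      \<Longrightarrow> tensor_lift B Ep A T (\<lambda>e a. act e g \<otimes>\<^sub>t a) (e \<otimes>\<^sub>t a) = act e g \<otimes>\<^sub>t a"
  using tensor_map [OF tensor_axioms tensor_axioms, of "\<lambda>e. act e g" "\<lambda>a. a"] g
  by (simp_all add: act_add act_mult act_p)

lemma ext_action_eq:
  "\<lbrakk>t \<in> carrier T; g \<in> carrier G\<rbrakk> \<Longrightarrow> \<alpha> t g = tensor_lift B Ep A T (\<lambda>e a. act e g \<otimes>\<^sub>t a) t"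
  by (simp add: ext_action_def Let_def)

lemma ext_action_pure:
  "\<lbrakk>e \<in> carrier E; a \<in> carrier A; g \<in> carrier G\<rbrakk> \<Longrightarrow> \<alpha> (e \<otimes>\<^sub>t a) g = act e g \<otimes>\<^sub>t a"
  by (simp add: ext_action_eq action_lift)

lemma ext_action_closed [simp]: "\<lbrakk>t \<in> carrier T; g \<in> carrier G\<rbrakk> \<Longrightarrow> \<alpha> t g \<in> carrier T"
  using action_lift(1) [of g] by (auto simp: ext_action_eq hom_def)

lemma ext_action_add:
  "\<lbrakk>s \<in> carrier T; t \<in> carrier T; g \<in> carrier G\<rbrakk> \<Longrightarrow> \<alpha> (s \<oplus>\<^bsub>X\<^esub> t) g = \<alpha> s g \<oplus>\<^bsub>X\<^esub> \<alpha> t g"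
  using action_lift(1) [of g] ext_action_closed [of s g] ext_action_closed [of t g]
  by (simp add: ext_action_eq hom_def)

lemma ext_action_zero: "g \<in> carrier G \<Longrightarrow> \<alpha> \<zero>\<^bsub>X\<^esub> g = \<zero>\<^bsub>X\<^esub>"
  by (rule additive_zero [of X X "\<lambda>t. \<alpha> t g"])
    (simp_all only: X.abelian_group_axioms ext_simps(1) ext_action_closed ext_action_add)

text \<open>Each law is additive in the tensor, so it follows from the value of the action on pure
  tensors.\<close>

lemma ext_obj: "(X, \<alpha>) \<in> Obj GM"
proof (rule gmodule_objI)
  show "\<alpha> \<in> carrier X \<rightarrow>\<^sub>E carrier G \<rightarrow>\<^sub>E carrier X"
    using ext_action_closed by (auto simp: PiE_iff ext_action_def extensional_def Let_def)
  note ind = ext_action_add ext_action_zero ext_action_pure act_act act_mult X.smult_r_distr smult_pure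
  show "\<alpha> d \<one>\<^bsub>G\<^esub> = d" if "d \<in> carrier X" for d
    using that unfolding ext_simps(1)
    by (induction rule: ext_induct) (simp_all add: ind del: ext_simps(2,3))
  show "\<alpha> d (g \<otimes>\<^bsub>G\<^esub> h) = \<alpha> (\<alpha> d g) h"
    if "d \<in> carrier X" "g \<in> carrier G" "h \<in> carrier G" for d g h
    using that(1) unfolding ext_simps(1)
  proof (induction rule: ext_induct)
    case (pure e a t)
    then show ?case using that(2,3)
      by (simp add: ind ext_action_add del: ext_simps(2,3))
  qed (use that in \<open>simp add: ind del: ext_simps(2,3)\<close>)
  show "\<alpha> (e \<odot>\<^bsub>X\<^esub> d) g = act e g \<odot>\<^bsub>X\<^esub> \<alpha> d g"
    if "e \<in> carrier E" "d \<in> carrier X" "g \<in> carrier G" for e d g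
    using that(2) unfolding ext_simps(1)
  proof (induction rule: ext_induct)
    case (pure e a t)
    then show ?case using that
      by (simp add: ind ext_action_add del: ext_simps(2,3))
  qed (use that in \<open>simp add: ind del: ext_simps(2,3)\<close>)
  show "\<alpha> (d \<oplus>\<^bsub>X\<^esub> d') g = \<alpha> d g \<oplus>\<^bsub>X\<^esub> \<alpha> d' g"
    if "d \<in> carrier X" "d' \<in> carrier X" "g \<in> carrier G" for d d' g
    using that by (simp add: ext_action_add del: ext_simps(3))
qed (rule strict_ext)

sublocale X: galois_module B E G p act X \<alpha>
  by unfold_locales (rule ext_obj)

end

section \<open>Traces\<close>

text \<open>Right translation permutes the group; this is the reason why traces are
  invariant.\<close>

lemma (in group) finsum_translate:
  assumes "abelian_monoid M" "h \<in> carrier G" "\<And>g. g \<in> carrier G \<Longrightarrow> f g \<in> carrier M"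
  shows "finsum M (\<lambda>g. f (g \<otimes> h)) (carrier G) = finsum M f (carrier G)"
proof -
  interpret M: abelian_monoid M by fact
  have inj: "inj_on (\<lambda>g. g \<otimes> h) (carrier G)"
    using assms(2) by (auto intro!: inj_onI)
  have img: "(\<lambda>g. g \<otimes> h) ` carrier G = carrier G"
  proof (intro equalityI subsetI)
    fix g assume "g \<in> carrier G"
    then have "g = (g \<otimes> inv h) \<otimes> h" "g \<otimes> inv h \<in> carrier G"
      using assms(2) by (simp_all add: m_assoc)
    then show "g \<in> (\<lambda>g. g \<otimes> h) ` carrier G" by (rule image_eqI)
  qed (use assms(2) in auto)
  show ?thesis
    using M.finsum_reindex [of f "\<lambda>g. g \<otimes> h" "carrier G"] inj assms(3)
    by (simp add: img Pi_iff)
qed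

context galois_data
begin

text \<open>The trace written with the addition of \<open>E\<close> itself;
  \<open>self_module E\<close> shares it only on the carrier, so the trace of that module is a
  different term, identified with this one in \<open>trE_eq\<close>.\<close>

definition trE :: "'e \<Rightarrow> 'e" where
  "trE e = (\<Oplus>\<^bsub>E\<^esub>g\<in>carrier G. act e g)"

lemma trE_closed [simp]: "e \<in> carrier E \<Longrightarrow> trE e \<in> carrier E"
  by (simp add: trE_def Pi_iff)

text \<open>Galois coordinates in the sense of Chase, Harrison and Rosenberg. The name comes from
  the case \<open>D = E\<close> of \<open>tr_dual_basis\<close>: there the elements \<open>x\<close>
  and the functionals \<open>e \<mapsto> tr(y e)\<close> reproduce every \<open>e\<close>.\<close>

definition is_dual_basis :: "('e \<times> 'e) list \<Rightarrow> bool" where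
  "is_dual_basis L \<longleftrightarrow> set L \<subseteq> carrier E \<times> carrier E \<and> (\<forall>g\<in>carrier G.
     lsum E (\<lambda>(x, y). x \<otimes>\<^bsub>E\<^esub> act y g) L = (if g = \<one>\<^bsub>G\<^esub> then \<one>\<^bsub>E\<^esub> else \<zero>\<^bsub>E\<^esub>))"

text \<open>Lets the results on traces in modules with action be applied to
  \<open>E\<close>.\<close>

lemma self_obj: "(self_module E, \<lambda>e\<in>carrier E. \<lambda>g\<in>carrier G. act e g) \<in> Obj GM"
  by (rule gmodule_objI)
    (use module_self in \<open>auto simp: act_act act_add act_mult self_module_def intro!: strict_module_mk_module\<close>)

end

section \<open>Traces in a module with semilinear action\<close>

context galois_module
begin

definition tr :: "'a \<Rightarrow> 'a" where
  "tr d = (\<Oplus>\<^bsub>D\<^esub>g\<in>carrier G. \<rho> d g)"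

lemma tr_closed [simp]: "d \<in> carrier D \<Longrightarrow> tr d \<in> carrier D"
  by (simp add: tr_def Pi_iff)

lemma tr_add:
  assumes "d \<in> carrier D" "d' \<in> carrier D"
  shows "tr (d \<oplus>\<^bsub>D\<^esub> d') = tr d \<oplus>\<^bsub>D\<^esub> tr d'"
proof -
  have "tr (d \<oplus>\<^bsub>D\<^esub> d') = (\<Oplus>\<^bsub>D\<^esub>g\<in>carrier G. \<rho> d g \<oplus>\<^bsub>D\<^esub> \<rho> d' g)"
    unfolding tr_def using assms by (intro D.finsum_cong') (simp_all add: \<rho>_add Pi_iff)
  also have "\<dots> = tr d \<oplus>\<^bsub>D\<^esub> tr d'"
    unfolding tr_def using assms by (intro D.finsum_addf) (simp_all add: Pi_iff)
  finally show ?thesis .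
qed

lemma tr_zero: "tr \<zero>\<^bsub>D\<^esub> = \<zero>\<^bsub>D\<^esub>"
  by (rule additive_zero [OF D.abelian_group_axioms D.abelian_group_axioms]) (simp_all add: tr_add)

lemma tr_fixed:
  assumes "d \<in> carrier D" "h \<in> carrier G"
  shows "\<rho> (tr d) h = tr d"
proof -
  have "\<rho> (tr d) h = (\<Oplus>\<^bsub>D\<^esub>g\<in>carrier G. \<rho> (\<rho> d g) h)"
    unfolding tr_def using assms
    by (intro additive_finsum [where f = "\<lambda>d. \<rho> d h"] D.abelian_group_axioms) (simp_all add: \<rho>_add)
  also have "\<dots> = (\<Oplus>\<^bsub>D\<^esub>g\<in>carrier G. \<rho> d (g \<otimes>\<^bsub>G\<^esub> h))"
    using assms by (intro D.finsum_cong') (simp_all add: \<rho>_mult Pi_iff)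
  also have "\<dots> = tr d"
    unfolding tr_def using assms
    by (intro G.finsum_translate D.abelian_monoid_axioms) simp_all
  finally show ?thesis .
qed

text \<open>The projection formula: for invariant \<open>d\<close>, semilinearity gives
  \<open>(ed)g = (eg)d\<close>, and \<open>d\<close> leaves the sum.\<close>

lemma tr_smult_fixed:
  assumes "e \<in> carrier E" "d \<in> carrier D" "\<And>g. g \<in> carrier G \<Longrightarrow> \<rho> d g = d"
  shows "tr (e \<odot>\<^bsub>D\<^esub> d) = trE e \<odot>\<^bsub>D\<^esub> d"
proof -
  have "trE e \<odot>\<^bsub>D\<^esub> d = (\<Oplus>\<^bsub>D\<^esub>g\<in>carrier G. act e g \<odot>\<^bsub>D\<^esub> d)"
    unfolding trE_def using assms
    by (intro additive_finsum [where f = "\<lambda>e. e \<odot>\<^bsub>D\<^esub> d"] E.abelian_group_axioms D.abelian_group_axioms)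
      (simp_all add: D.smult_l_distr)
  also have "\<dots> = tr (e \<odot>\<^bsub>D\<^esub> d)"
    unfolding tr_def using assms by (intro D.finsum_cong') (simp_all add: \<rho>_smult Pi_iff)
  finally show ?thesis by simp
qed

text \<open>Exchanging the sums gives
  \<open>\<Sum> x tr(yd) = \<Sum>\<^sub>g (\<Sum> x (yg)) (dg)\<close>. The inner coefficient is the
  delta function at the identity of \<open>G\<close>, which leaves \<open>d\<close>.\<close>

lemma tr_dual_basis:
  assumes fin: "finite (carrier G)" and L: "is_dual_basis L"
    and d: "d \<in> carrier D"
  shows "lsum D (\<lambda>(x, y). x \<odot>\<^bsub>D\<^esub> tr (y \<odot>\<^bsub>D\<^esub> d)) L = d"
proof -
  let ?f = "\<lambda>z g. (fst z \<otimes>\<^bsub>E\<^esub> act (snd z) g) \<odot>\<^bsub>D\<^esub> \<rho> d g"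
  have L': "fst z \<in> carrier E" "snd z \<in> carrier E" if "z \<in> set L" for z
    using L that by (auto simp: is_dual_basis_def)
  have delta: "lsum E (\<lambda>z. fst z \<otimes>\<^bsub>E\<^esub> act (snd z) g) L = (if g = \<one>\<^bsub>G\<^esub> then \<one>\<^bsub>E\<^esub> else \<zero>\<^bsub>E\<^esub>)"
    if "g \<in> carrier G" for g
    using L that by (simp add: is_dual_basis_def case_prod_beta')
  have "lsum D (\<lambda>(x, y). x \<odot>\<^bsub>D\<^esub> tr (y \<odot>\<^bsub>D\<^esub> d)) L = lsum D (\<lambda>z. \<Oplus>\<^bsub>D\<^esub>g\<in>carrier G. ?f z g) L"
  proof (rule lsum_cong, unfold case_prod_beta')
    fix z assume z: "z \<in> set L"
    have "fst z \<odot>\<^bsub>D\<^esub> tr (snd z \<odot>\<^bsub>D\<^esub> d) = (\<Oplus>\<^bsub>D\<^esub>g\<in>carrier G. fst z \<odot>\<^bsub>D\<^esub> \<rho> (snd z \<odot>\<^bsub>D\<^esub> d) g)"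
      unfolding tr_def using L' [OF z] d
      by (intro additive_finsum [where f = "\<lambda>d. fst z \<odot>\<^bsub>D\<^esub> d"] D.abelian_group_axioms)
        (simp_all add: D.smult_r_distr)
    also have "\<dots> = (\<Oplus>\<^bsub>D\<^esub>g\<in>carrier G. ?f z g)"
      using L' [OF z] d by (intro D.finsum_cong') (simp_all add: \<rho>_smult D.smult_assoc1 Pi_iff)
    finally show "fst z \<odot>\<^bsub>D\<^esub> tr (snd z \<odot>\<^bsub>D\<^esub> d) = (\<Oplus>\<^bsub>D\<^esub>g\<in>carrier G. ?f z g)" .
  qed
  also have "\<dots> = (\<Oplus>\<^bsub>D\<^esub>g\<in>carrier G. lsum D (\<lambda>z. ?f z g) L)"
    using L' d by (intro D.lsum_finsum) simp
  \<comment> \<open>The condition is oriented as \<open>finsum_singleton\<close> expects it.\<close>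
  also have "\<dots> = (\<Oplus>\<^bsub>D\<^esub>g\<in>carrier G. if \<one>\<^bsub>G\<^esub> = g then \<rho> d g else \<zero>\<^bsub>D\<^esub>)"
  proof (rule D.finsum_cong')
    fix g assume g: "g \<in> carrier G"
    have "lsum E (\<lambda>z. fst z \<otimes>\<^bsub>E\<^esub> act (snd z) g) L \<odot>\<^bsub>D\<^esub> \<rho> d g = lsum D (\<lambda>z. ?f z g) L"
      using L' d g
      by (intro additive_lsum [where f = "\<lambda>e. e \<odot>\<^bsub>D\<^esub> \<rho> d g"] E.abelian_group_axioms D.abelian_group_axioms)
        (simp_all add: D.smult_l_distr)
    then show "lsum D (\<lambda>z. ?f z g) L = (if \<one>\<^bsub>G\<^esub> = g then \<rho> d g else \<zero>\<^bsub>D\<^esub>)"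
      using delta [OF g] d g by (auto split: if_splits)
  qed (use d in auto)
  also have "\<dots> = d"
    using D.finsum_singleton [of "\<one>\<^bsub>G\<^esub>" "carrier G" "\<rho> d"] fin d by (simp add: Pi_iff)
  finally show ?thesis .
qed

end

section \<open>Traces in the ring itself\<close>

context galois_data
begin

interpretation S: galois_module B E G p act "self_module E" "\<lambda>e\<in>carrier E. \<lambda>g\<in>carrier G. act e g"
  by unfold_locales (rule self_obj)

text \<open>The two additions agree on the carrier only, so the sums are compared by viewing the
  identity as an additive map from \<open>E\<close> to \<open>self_module E\<close>.\<close>

lemma trE_eq: "e \<in> carrier E \<Longrightarrow> S.tr e = trE e"
  unfolding S.tr_def trE_def
  by (subst additive_finsum [where f = id and N = "self_module E", simplified])
    (auto simp: E.abelian_group_axioms S.D.abelian_group_axioms Pi_iff intro!: S.D.finsum_cong')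

lemma trE_add: "\<lbrakk>e \<in> carrier E; e' \<in> carrier E\<rbrakk> \<Longrightarrow> trE (e \<oplus>\<^bsub>E\<^esub> e') = trE e \<oplus>\<^bsub>E\<^esub> trE e'"
  using S.tr_add [of e e'] by (simp add: trE_eq)

lemma trE_fixed: "\<lbrakk>e \<in> carrier E; g \<in> carrier G\<rbrakk> \<Longrightarrow> act (trE e) g = trE e"
  using S.tr_fixed [of e g] by (simp add: trE_eq)

lemma trE_mult_fixed:
  assumes "e \<in> carrier E" "x \<in> carrier E" "\<And>g. g \<in> carrier G \<Longrightarrow> act x g = x"
  shows "trE (e \<otimes>\<^bsub>E\<^esub> x) = trE e \<otimes>\<^bsub>E\<^esub> x"
  using S.tr_smult_fixed [of e x] assms by (simp add: trE_eq)

lemma trE_dual_basis: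
  assumes fin: "finite (carrier G)" and L: "is_dual_basis L"
    and e: "e \<in> carrier E"
  shows "lsum E (\<lambda>(x, y). x \<otimes>\<^bsub>E\<^esub> trE (y \<otimes>\<^bsub>E\<^esub> e)) L = e"
proof -
  have L': "set L \<subseteq> carrier E \<times> carrier E" using L by (simp add: is_dual_basis_def)
  have "lsum E (\<lambda>(x, y). x \<otimes>\<^bsub>E\<^esub> trE (y \<otimes>\<^bsub>E\<^esub> e)) L =
      lsum (self_module E) (\<lambda>(x, y). x \<otimes>\<^bsub>E\<^esub> trE (y \<otimes>\<^bsub>E\<^esub> e)) L"
    using L' e by (intro additive_lsum [where f = id and N = "self_module E", simplified])
      (auto simp: E.abelian_group_axioms S.D.abelian_group_axioms)
  also have "\<dots> = lsum (self_module E) (\<lambda>(x, y). x \<odot>\<^bsub>self_module E\<^esub> S.tr (y \<odot>\<^bsub>self_module E\<^esub> e)) L"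
    using L' e by (intro lsum_cong) (auto simp: trE_eq)
  also have "\<dots> = e"
    using S.tr_dual_basis [OF fin L] e by simp
  finally show ?thesis .
qed

end

section \<open>Galois descent\<close>

text \<open>\<open>U\<close> fixes the universe in which purity is tested. Its size serves two
  purposes: quotients of \<open>E\<close> must embed into it, and so must
  \<open>E \<otimes> A\<close> for every \<open>A\<close> on it.\<close>

locale galois_descent = galois_data B E G p act
  for B :: "'b ring" and E :: "'e ring" and G :: "'g monoid"
    and p :: "'b \<Rightarrow> 'e" and act :: "'e \<Rightarrow> 'g \<Rightarrow> 'e" +
  fixes U :: "'u itself"
  assumes finite_G: "finite (carrier G)"
    and infinite_U: "infinite (UNIV :: 'u set)"
    and small_E: "carrier E \<lesssim> (UNIV :: 'u set)"
    and pure: "pure_mono U B E p"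
    and galois: "bij_betw (galois_map B E p G act)
      (carrier (tensor_group B (restrict_scalars B p (self_module E)) (restrict_scalars B p (self_module E))))
      (carrier (map_algebra G E))"
begin

abbreviation "GE \<equiv> map_algebra G E"

interpretation EE: galois_ext B E G p act Ep
  by (simp add: galois_ext_def galois_data_axioms module_Ep)

text \<open>Needed for the universal property of the tensor product to apply to the Galois
  map.\<close>

lemma comm_group_GE: "comm_group (add_monoid GE)"
proof (rule comm_groupI)
  fix u assume u: "u \<in> carrier (add_monoid GE)"
  then have "(\<lambda>g\<in>carrier G. \<ominus>\<^bsub>E\<^esub> u g) \<in> carrier (add_monoid GE)"
    by (auto simp: map_algebra_def PiE_iff)
  moreover have "(\<lambda>g\<in>carrier G. \<ominus>\<^bsub>E\<^esub> u g) \<otimes>\<^bsub>add_monoid GE\<^esub> u = \<one>\<^bsub>add_monoid GE\<^esub>"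
    using u by (auto simp: map_algebra_def PiE_iff E.l_neg fun_eq_iff)
  ultimately show "\<exists>v\<in>carrier (add_monoid GE). v \<otimes>\<^bsub>add_monoid GE\<^esub> u = \<one>\<^bsub>add_monoid GE\<^esub>" by blast
qed (auto simp: map_algebra_def PiE_iff E.a_ac fun_eq_iff extensional_def)

lemma galois_map:
  shows "galois_map B E p G act \<in> hom EE.T (add_monoid GE)"
    and "\<lbrakk>e \<in> carrier E; e' \<in> carrier E\<rbrakk>
      \<Longrightarrow> galois_map B E p G act (pure_tensor B Ep Ep e e') = (\<lambda>g\<in>carrier G. act e g \<otimes>\<^bsub>E\<^esub> e')"
proof -
  note facts = module_Ep module_Ep comm_group_GE
  note simps = map_algebra_def PiE_iff act_add act_mult act_p E.l_distr E.r_distr E.m_ac fun_eq_iff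
  show "galois_map B E p G act \<in> hom EE.T (add_monoid GE)"
    unfolding galois_map_def Let_def by (rule tensor_lift(1) [OF facts]) (auto simp: simps)
  show "galois_map B E p G act (pure_tensor B Ep Ep e e') = (\<lambda>g\<in>carrier G. act e g \<otimes>\<^bsub>E\<^esub> e')"
    if "e \<in> carrier E" "e' \<in> carrier E"
    unfolding galois_map_def Let_def
    by (rule tensor_lift(2) [OF facts]) (use that in \<open>auto simp: simps\<close>)
qed

text \<open>A preimage of the delta function is a sum of pure tensors, and the Galois map turns this
  sum into the required identity. The induction records such a list for an arbitrary tensor, since
  the partial sums need not map to a delta function.\<close>

lemma dual_basis_exists: "\<exists>L. is_dual_basis L"
proof -
  let ?\<delta> = "\<lambda>g\<in>carrier G. if g = \<one>\<^bsub>G\<^esub> then \<one>\<^bsub>E\<^esub> else \<zero>\<^bsub>E\<^esub>"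
  have "?\<delta> \<in> carrier GE" by (auto simp: map_algebra_def)
  then obtain t where t: "t \<in> carrier EE.T" "galois_map B E p G act t = ?\<delta>"
    unfolding bij_betw_imp_surj_on [OF galois, symmetric] by (auto simp del: restrict_apply)
  have "\<exists>L. set L \<subseteq> carrier E \<times> carrier E \<and> (\<forall>g\<in>carrier G.
      galois_map B E p G act t g = lsum E (\<lambda>(x, y). x \<otimes>\<^bsub>E\<^esub> act y g) L)"
    using t(1)
  proof (induction rule: EE.tensor_induct)
    case one
    have "galois_map B E p G act \<one>\<^bsub>EE.T\<^esub> = \<one>\<^bsub>add_monoid GE\<^esub>"
      using galois_map(1) comm_group_GE
      by (intro group_hom.hom_one) (simp add: group_hom_def group_hom_axioms_def comm_group_def)
    then show ?case by (intro exI [of _ "[]"]) (simp add: map_algebra_def)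
  next
    case (pure e e' t)
    then obtain L where L: "set L \<subseteq> carrier E \<times> carrier E" "\<And>g. g \<in> carrier G \<Longrightarrow>
        galois_map B E p G act t g = lsum E (\<lambda>(x, y). x \<otimes>\<^bsub>E\<^esub> act y g) L" by blast
    have "galois_map B E p G act (pure_tensor B Ep Ep e e' \<otimes>\<^bsub>EE.T\<^esub> t) =
        galois_map B E p G act (pure_tensor B Ep Ep e e') \<otimes>\<^bsub>add_monoid GE\<^esub> galois_map B E p G act t"
      by (rule hom_mult [OF galois_map(1) EE.pure_closed]) (fact pure)+
    also have "\<dots> = (\<lambda>g\<in>carrier G. (act e g \<otimes>\<^bsub>E\<^esub> e') \<oplus>\<^bsub>E\<^esub> galois_map B E p G act t g)"
      using pure(1,2) by (simp add: galois_map(2) map_algebra_def fun_eq_iff)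
    \<comment> \<open>The pair is reversed: \<open>e \<otimes> e'\<close> contributes
      \<open>(eg)e'\<close>, so the factor moved by \<open>g\<close> becomes the second
      component.\<close>
    finally have "galois_map B E p G act (pure_tensor B Ep Ep e e' \<otimes>\<^bsub>EE.T\<^esub> t) g =
        lsum E (\<lambda>(x, y). x \<otimes>\<^bsub>E\<^esub> act y g) ((e', e) # L)" if "g \<in> carrier G" for g
      using that pure(1,2) L(2) by (simp add: E.m_comm)
    then show ?case using L(1) pure(1,2)
      by (intro exI [of _ "(e', e) # L"]) (simp del: lsum_simps)
  qed
  then obtain L where L: "set L \<subseteq> carrier E \<times> carrier E" "\<And>g. g \<in> carrier G \<Longrightarrow>
      galois_map B E p G act t g = lsum E (\<lambda>(x, y). x \<otimes>\<^bsub>E\<^esub> act y g) L"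
    by blast
  have "lsum E (\<lambda>(x, y). x \<otimes>\<^bsub>E\<^esub> act y g) L = ?\<delta> g" if "g \<in> carrier G" for g
    using L(2) [OF that] by (simp only: t(2))
  then have "is_dual_basis L"
    unfolding is_dual_basis_def using L(1) by simp
  then show ?thesis ..
qed

text \<open>Packages purity for \<open>E / K\<close> with \<open>K\<close> a
  \<open>B\<close>-submodule: \<open>N\<close> is a copy of the quotient on \<open>'u\<close> and
  \<open>j\<close> the projection. If \<open>j x \<otimes> 1\<close> vanishes, purity gives
  \<open>j x = 0\<close>, that is, \<open>x \<in> K\<close>. The existential form hides the choice
  of representatives.\<close>

lemma pure_quotient:
  assumes K: "K \<subseteq> carrier E" "\<zero>\<^bsub>E\<^esub> \<in> K" "\<forall>x\<in>K. \<forall>y\<in>K. x \<oplus>\<^bsub>E\<^esub> y \<in> K"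
    and K_smult: "\<forall>b\<in>carrier B. \<forall>x\<in>K. p b \<otimes>\<^bsub>E\<^esub> x \<in> K"
  shows "\<exists>(N :: ('b, 'u) module) j. module B N \<and> (\<forall>x\<in>carrier E. j x \<in> carrier N) \<and>
    (\<forall>x\<in>carrier E. \<forall>y\<in>carrier E. j (x \<oplus>\<^bsub>E\<^esub> y) = j x \<oplus>\<^bsub>N\<^esub> j y) \<and>
    (\<forall>b\<in>carrier B. \<forall>x\<in>carrier E. j (p b \<otimes>\<^bsub>E\<^esub> x) = b \<odot>\<^bsub>N\<^esub> j x) \<and>
    (\<forall>x\<in>K. j x = \<zero>\<^bsub>N\<^esub>) \<and>
    (\<forall>x\<in>carrier E. pure_tensor B N Ep (j x) \<one>\<^bsub>E\<^esub> = \<one>\<^bsub>tensor_group B N Ep\<^esub> \<longrightarrow> x \<in> K)"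
proof -
  \<comment> \<open>Closure under negation comes from the scalar \<open>-1\<close> of
    \<open>B\<close>.\<close>
  have K_minus: "\<ominus>\<^bsub>E\<^esub> x \<in> K" if "x \<in> K" for x
  proof -
    have "p (\<ominus>\<^bsub>B\<^esub> \<one>\<^bsub>B\<^esub>) \<otimes>\<^bsub>E\<^esub> x = \<ominus>\<^bsub>E\<^esub> x"
      using that K(1) by (auto simp: E.l_minus)
    then show ?thesis using K_smult that by (metis B.a_inv_closed B.one_closed)
  qed
  obtain i :: "'e \<Rightarrow> 'u" where i: "inj_on i (carrier E)"
    using small_E by (auto simp: lepoll_def)
  \<comment> \<open>\<open>r\<close> picks a representative of each coset of \<open>K\<close>;
    following it by \<open>i\<close> names the coset by an element of \<open>'u\<close>.\<close>
  define r where "r x = (SOME y. y \<in> carrier E \<and> x \<ominus>\<^bsub>E\<^esub> y \<in> K)" for x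
  have r: "r x \<in> carrier E \<and> x \<ominus>\<^bsub>E\<^esub> r x \<in> K" if "x \<in> carrier E" for x
    unfolding r_def by (rule someI [of _ x]) (use that K(2) in \<open>simp add: E.r_neg E.minus_eq\<close>)
  have trans: "x \<ominus>\<^bsub>E\<^esub> z \<in> K" if "x \<ominus>\<^bsub>E\<^esub> y \<in> K" "y \<ominus>\<^bsub>E\<^esub> z \<in> K"
    "x \<in> carrier E" "y \<in> carrier E" "z \<in> carrier E" for x y z
  proof -
    have "(x \<ominus>\<^bsub>E\<^esub> y) \<oplus>\<^bsub>E\<^esub> (y \<ominus>\<^bsub>E\<^esub> z) = x \<ominus>\<^bsub>E\<^esub> z"
      using that by algebra
    then show ?thesis using K(3) that(1,2) by metis
  qed
  have sym: "y \<ominus>\<^bsub>E\<^esub> x \<in> K" if "x \<ominus>\<^bsub>E\<^esub> y \<in> K" "x \<in> carrier E" "y \<in> carrier E" for x y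
  proof -
    have "\<ominus>\<^bsub>E\<^esub> (x \<ominus>\<^bsub>E\<^esub> y) = y \<ominus>\<^bsub>E\<^esub> x" using that by algebra
    then show ?thesis using K_minus [OF that(1)] by simp
  qed
  define j where "j x = i (r x)" for x
  have j: "j x = j y \<longleftrightarrow> x \<ominus>\<^bsub>E\<^esub> y \<in> K" if xy: "x \<in> carrier E" "y \<in> carrier E" for x y
  proof
    assume "j x = j y"
    then have "r x = r y" using i r [OF xy(1)] r [OF xy(2)] by (auto simp: j_def dest: inj_onD)
    then show "x \<ominus>\<^bsub>E\<^esub> y \<in> K"
      using r [OF xy(1)] r [OF xy(2)] xy trans [of x "r y" y] sym [of y "r y"] by simp
  next
    assume "x \<ominus>\<^bsub>E\<^esub> y \<in> K"
    then have "(x \<ominus>\<^bsub>E\<^esub> z \<in> K) = (y \<ominus>\<^bsub>E\<^esub> z \<in> K)" if "z \<in> carrier E" for z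
      using xy that sym [of x y] trans [of x y z] trans [of y x z] by blast
    \<comment> \<open>Congruent elements give the same predicate to the choice operator, hence the
      same representative.\<close>
    then have "r x = r y" unfolding r_def by (intro arg_cong [where f = Eps]) blast
    then show "j x = j y" by (simp add: j_def)
  qed
  let ?N = "image_module B Ep j"
  have j_add: "j (x \<oplus>\<^bsub>Ep\<^esub> y) = j (x' \<oplus>\<^bsub>Ep\<^esub> y')"
    if "x \<in> carrier Ep" "x' \<in> carrier Ep" "y \<in> carrier Ep" "y' \<in> carrier Ep" "j x = j x'" "j y = j y'" for x x' y y'
  proof -
    have c: "x \<in> carrier E" "x' \<in> carrier E" "y \<in> carrier E" "y' \<in> carrier E" using that by simp_all
    then have "(x \<oplus>\<^bsub>E\<^esub> y) \<ominus>\<^bsub>E\<^esub> (x' \<oplus>\<^bsub>E\<^esub> y') = (x \<ominus>\<^bsub>E\<^esub> x') \<oplus>\<^bsub>E\<^esub> (y \<ominus>\<^bsub>E\<^esub> y')"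
      by algebra
    then show ?thesis using that(5,6) c by (simp add: j K(3))
  qed
  have j_smult: "j (b \<odot>\<^bsub>Ep\<^esub> x) = j (b \<odot>\<^bsub>Ep\<^esub> x')"
    if "b \<in> carrier B" "x \<in> carrier Ep" "x' \<in> carrier Ep" "j x = j x'" for b x x'
  proof -
    have c: "x \<in> carrier E" "x' \<in> carrier E" "p b \<in> carrier E" using that by simp_all
    then have "(p b \<otimes>\<^bsub>E\<^esub> x) \<ominus>\<^bsub>E\<^esub> (p b \<otimes>\<^bsub>E\<^esub> x') = p b \<otimes>\<^bsub>E\<^esub> (x \<ominus>\<^bsub>E\<^esub> x')"
      by algebra
    then show ?thesis using that(1,4) c by (simp add: j K_smult)
  qed
  have "is_congruence B Ep j"
    unfolding is_congruence_def using j_add j_smult by blast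
  note I = image_module [OF module_Ep this]
  have N: "module B ?N" using I(1) by (rule strict_moduleD)
  interpret N: tensor B ?N Ep by (simp add: tensor_def N module_Ep)
  have j_zero: "j x = j \<zero>\<^bsub>E\<^esub> \<longleftrightarrow> x \<in> K" if "x \<in> carrier E" for x
    using that by (simp add: j E.minus_eq)
  have "x \<in> K" if x: "x \<in> carrier E"
    and eq: "pure_tensor B ?N Ep (j x) \<one>\<^bsub>E\<^esub> = \<one>\<^bsub>tensor_group B ?N Ep\<^esub>" for x
  proof -
    have "pure_tensor B ?N Ep (j \<zero>\<^bsub>E\<^esub>) \<one>\<^bsub>E\<^esub> = \<one>\<^bsub>tensor_group B ?N Ep\<^esub>"
      using N.pure_zero_left [of "\<one>\<^bsub>E\<^esub>"] by (simp add: I(3))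
    moreover have inj: "inj_on (\<lambda>n. pure_tensor B ?N Ep n \<one>\<^bsub>E\<^esub>) (carrier ?N)"
      using pure N unfolding pure_mono_def by blast
    ultimately have "j x = j \<zero>\<^bsub>E\<^esub>"
      by (intro inj_onD [OF inj]) (use x eq in \<open>simp_all add: I(2)\<close>)
    then show "x \<in> K" using x by (simp add: j_zero)
  qed
  moreover have "j x = \<zero>\<^bsub>?N\<^esub>" if "x \<in> K" for x
    using that j_zero K(1) by (auto simp: I(3))
  moreover have "j (x \<oplus>\<^bsub>E\<^esub> y) = j x \<oplus>\<^bsub>?N\<^esub> j y" if "x \<in> carrier E" "y \<in> carrier E" for x y
    using I(4) [of x y] that by simp
  moreover have "j (p b \<otimes>\<^bsub>E\<^esub> x) = b \<odot>\<^bsub>?N\<^esub> j x" if "b \<in> carrier B" "x \<in> carrier E" for b x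
    using I(5) [of b x] that by simp
  moreover have "j x \<in> carrier ?N" if "x \<in> carrier E" for x
    using that by (simp add: I(2))
  ultimately show ?thesis
    using N by (intro exI [of _ ?N] exI [of _ j]) blast
qed

text \<open>For invariant \<open>x\<close> both \<open>x \<otimes> 1\<close> and
  \<open>1 \<otimes> x\<close> go to the constant function \<open>x\<close>, so they coincide.
  Projecting the left factor to \<open>E / p(B)\<close> kills the second, hence also the first, and
  purity puts \<open>x\<close> into \<open>p(B)\<close>.\<close>

lemma fixed_in_base:
  assumes x: "x \<in> carrier E" "\<And>g. g \<in> carrier G \<Longrightarrow> act x g = x"
  shows "x \<in> p ` carrier B"
proof -
  have p0: "p b \<oplus>\<^bsub>E\<^esub> p b' \<in> p ` carrier B" "p b \<otimes>\<^bsub>E\<^esub> p b' \<in> p ` carrier B"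
    if "b \<in> carrier B" "b' \<in> carrier B" for b b'
    using that by (auto simp flip: p.hom_add p.hom_mult)
  have K1: "\<zero>\<^bsub>E\<^esub> \<in> p ` carrier B" and "\<one>\<^bsub>E\<^esub> \<in> p ` carrier B"
    by (rule image_eqI [of _ _ "\<zero>\<^bsub>B\<^esub>"], simp_all) (rule image_eqI [of _ _ "\<one>\<^bsub>B\<^esub>"], simp_all)
  have K0: "p ` carrier B \<subseteq> carrier E" by auto
  have K2: "\<forall>x\<in>p ` carrier B. \<forall>y\<in>p ` carrier B. x \<oplus>\<^bsub>E\<^esub> y \<in> p ` carrier B"
    using p0 by blast
  have K3: "\<forall>b\<in>carrier B. \<forall>x\<in>p ` carrier B. p b \<otimes>\<^bsub>E\<^esub> x \<in> p ` carrier B"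
    using p0 by blast
  obtain N :: "('b, 'u) module" and j where N: "module B N"
    and j: "\<forall>x\<in>carrier E. j x \<in> carrier N"
    "\<forall>x\<in>carrier E. \<forall>y\<in>carrier E. j (x \<oplus>\<^bsub>E\<^esub> y) = j x \<oplus>\<^bsub>N\<^esub> j y"
    "\<forall>b\<in>carrier B. \<forall>x\<in>carrier E. j (p b \<otimes>\<^bsub>E\<^esub> x) = b \<odot>\<^bsub>N\<^esub> j x"
    "\<forall>x\<in>p ` carrier B. j x = \<zero>\<^bsub>N\<^esub>"
    "\<forall>x\<in>carrier E. pure_tensor B N Ep (j x) \<one>\<^bsub>E\<^esub> = \<one>\<^bsub>tensor_group B N Ep\<^esub> \<longrightarrow> x \<in> p ` carrier B"
    using pure_quotient [OF K0 K1 K2 K3] by blast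
  interpret N: tensor B N Ep by (simp add: tensor_def N module_Ep)
  \<comment> \<open>The projection \<open>j\<close> tensored with the identity of
    \<open>E\<close>.\<close>
  let ?h = "tensor_lift B Ep Ep N.T (\<lambda>x y. pure_tensor B N Ep (j x) y)"
  have h: "?h (pure_tensor B Ep Ep e e') = pure_tensor B N Ep (j e) e'"
    if "e \<in> carrier E" "e' \<in> carrier E" for e e'
    using tensor_map(2) [OF EE.tensor_axioms N.tensor_axioms, of j "\<lambda>e. e" e e'] that j(1-3) by simp
  have "galois_map B E p G act (pure_tensor B Ep Ep x \<one>\<^bsub>E\<^esub>) =
      galois_map B E p G act (pure_tensor B Ep Ep \<one>\<^bsub>E\<^esub> x)"
    using x by (simp add: galois_map(2) fun_eq_iff)
  then have "pure_tensor B Ep Ep x \<one>\<^bsub>E\<^esub> = pure_tensor B Ep Ep \<one>\<^bsub>E\<^esub> x"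
    by (rule inj_onD [OF bij_betw_imp_inj_on [OF galois]]) (use x in simp_all)
  then have "pure_tensor B N Ep (j x) \<one>\<^bsub>E\<^esub> = pure_tensor B N Ep (j \<one>\<^bsub>E\<^esub>) x"
    using h [of x "\<one>\<^bsub>E\<^esub>"] h [of "\<one>\<^bsub>E\<^esub>" x] x by simp
  also have "\<dots> = \<one>\<^bsub>N.T\<^esub>"
    using bspec [OF j(4) \<open>\<one>\<^bsub>E\<^esub> \<in> p ` carrier B\<close>] x by (simp add: N.pure_zero_left)
  finally show ?thesis using j(5) x by blast
qed

lemma trE_in_base: "e \<in> carrier E \<Longrightarrow> trE e \<in> p ` carrier B"
  by (intro fixed_in_base) (simp_all add: trE_fixed)

text \<open>Modulo \<open>tr(E)\<close> one has
  \<open>1 \<otimes> x tr(y) = tr(y) \<otimes> x = 0\<close>, as \<open>tr(y)\<close> comes from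
  \<open>B\<close>. Summing over a dual basis gives \<open>1 \<otimes> 1 = 0\<close>, and purity for
  \<open>E / tr(E)\<close> yields \<open>1 \<in> tr(E)\<close>.\<close>

lemma trE_onto: "\<exists>c\<in>carrier E. trE c = \<one>\<^bsub>E\<^esub>"
proof -
  obtain L where L: "is_dual_basis L" using dual_basis_exists by blast
  have K1: "\<zero>\<^bsub>E\<^esub> \<in> trE ` carrier E"
  proof (rule image_eqI)
    show "\<zero>\<^bsub>E\<^esub> = trE \<zero>\<^bsub>E\<^esub>"
      by (rule additive_zero [symmetric]) (simp_all add: E.abelian_group_axioms trE_add)
  qed simp
  have K3: "\<forall>b\<in>carrier B. \<forall>x\<in>trE ` carrier E. p b \<otimes>\<^bsub>E\<^esub> x \<in> trE ` carrier E"
  proof (intro ballI)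
    fix b x assume b: "b \<in> carrier B" and "x \<in> trE ` carrier E"
    then obtain e where e: "e \<in> carrier E" "x = trE e" by blast
    \<comment> \<open>\<open>p b\<close> is invariant, so the projection formula makes
      \<open>tr(E)\<close> a \<open>B\<close>-submodule.\<close>
    have "trE (e \<otimes>\<^bsub>E\<^esub> p b) = p b \<otimes>\<^bsub>E\<^esub> x"
      using trE_mult_fixed [of e "p b"] b e by (simp add: act_p E.m_comm)
    then show "p b \<otimes>\<^bsub>E\<^esub> x \<in> trE ` carrier E"
      using b e by (metis E.m_closed image_eqI p.hom_closed)
  qed
  have K0: "trE ` carrier E \<subseteq> carrier E" by auto
  have K2: "\<forall>x\<in>trE ` carrier E. \<forall>y\<in>trE ` carrier E. x \<oplus>\<^bsub>E\<^esub> y \<in> trE ` carrier E"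
  proof (intro ballI)
    fix x y assume "x \<in> trE ` carrier E" "y \<in> trE ` carrier E"
    then obtain e e' where e: "e \<in> carrier E" "e' \<in> carrier E" "x = trE e" "y = trE e'" by blast
    then have "trE (e \<oplus>\<^bsub>E\<^esub> e') = x \<oplus>\<^bsub>E\<^esub> y" by (simp add: trE_add)
    then show "x \<oplus>\<^bsub>E\<^esub> y \<in> trE ` carrier E"
      using e by (metis E.a_closed image_eqI)
  qed
  obtain N :: "('b, 'u) module" and j where N: "module B N"
    and j: "\<forall>x\<in>carrier E. j x \<in> carrier N"
    "\<forall>x\<in>carrier E. \<forall>y\<in>carrier E. j (x \<oplus>\<^bsub>E\<^esub> y) = j x \<oplus>\<^bsub>N\<^esub> j y"
    "\<forall>b\<in>carrier B. \<forall>x\<in>carrier E. j (p b \<otimes>\<^bsub>E\<^esub> x) = b \<odot>\<^bsub>N\<^esub> j x"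
    "\<forall>x\<in>trE ` carrier E. j x = \<zero>\<^bsub>N\<^esub>"
    "\<forall>x\<in>carrier E. pure_tensor B N Ep (j x) \<one>\<^bsub>E\<^esub> = \<one>\<^bsub>tensor_group B N Ep\<^esub> \<longrightarrow> x \<in> trE ` carrier E"
    using pure_quotient [OF K0 K1 K2 K3] by blast
  interpret N: tensor B N Ep by (simp add: tensor_def N module_Ep)
  have zero: "pure_tensor B N Ep (j \<one>\<^bsub>E\<^esub>) (x \<otimes>\<^bsub>E\<^esub> trE y) = \<one>\<^bsub>N.T\<^esub>"
    if xy: "x \<in> carrier E" "y \<in> carrier E" for x y
  proof -
    obtain b where b: "b \<in> carrier B" "trE y = p b" using trE_in_base [OF xy(2)] by blast
    have "pure_tensor B N Ep (j \<one>\<^bsub>E\<^esub>) (x \<otimes>\<^bsub>E\<^esub> trE y) = pure_tensor B N Ep (b \<odot>\<^bsub>N\<^esub> j \<one>\<^bsub>E\<^esub>) x"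
      using N.pure_smult [of b "j \<one>\<^bsub>E\<^esub>" x] b that j(1) by (simp add: E.m_comm)
    also have "b \<odot>\<^bsub>N\<^esub> j \<one>\<^bsub>E\<^esub> = j (trE y)" using bspec [OF bspec [OF j(3) b(1)] E.one_closed] b by simp
    also have "\<dots> = \<zero>\<^bsub>N\<^esub>" using j(4) that by blast
    finally show ?thesis using that by (simp add: N.pure_zero_left)
  qed
  \<comment> \<open>The factor \<open>\<one>\<close> after \<open>y\<close> prepares for
    \<open>trE_dual_basis\<close> at \<open>e = 1\<close>, which evaluates the sum to
    \<open>1\<close> when \<open>L\<close> is a dual basis.\<close>
  have "pure_tensor B N Ep (j \<one>\<^bsub>E\<^esub>) (lsum E (\<lambda>(x, y). x \<otimes>\<^bsub>E\<^esub> trE (y \<otimes>\<^bsub>E\<^esub> \<one>\<^bsub>E\<^esub>)) L) = \<one>\<^bsub>N.T\<^esub>"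
    if "set L \<subseteq> carrier E \<times> carrier E" for L
    using that
  proof (induction L)
    case Nil
    then show ?case using N.pure_zero_right [of "j \<one>\<^bsub>E\<^esub>"] j(1) by simp
  next
    case (Cons z L)
    obtain x y where z: "z = (x, y)" by (cases z)
    have "lsum E (\<lambda>(x, y). x \<otimes>\<^bsub>E\<^esub> trE (y \<otimes>\<^bsub>E\<^esub> \<one>\<^bsub>E\<^esub>)) L \<in> carrier E"
      using Cons by (intro E.lsum_closed) auto
    then show ?case
      using Cons z zero [of x y] j(1)
        N.pure_add_right [of "j \<one>\<^bsub>E\<^esub>" "x \<otimes>\<^bsub>E\<^esub> trE y" "lsum E (\<lambda>(x, y). x \<otimes>\<^bsub>E\<^esub> trE (y \<otimes>\<^bsub>E\<^esub> \<one>\<^bsub>E\<^esub>)) L"]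
      by simp
  qed
  moreover have "lsum E (\<lambda>(x, y). x \<otimes>\<^bsub>E\<^esub> trE (y \<otimes>\<^bsub>E\<^esub> \<one>\<^bsub>E\<^esub>)) L = \<one>\<^bsub>E\<^esub>"
    using L by (intro trE_dual_basis finite_G) simp_all
  ultimately have "\<one>\<^bsub>E\<^esub> \<in> trE ` carrier E"
    using L bspec [OF j(5) E.one_closed] unfolding is_dual_basis_def by metis
  then show ?thesis by force
qed

end

section \<open>The \<open>B\<close>-module of invariants\<close>

context galois_module
begin

abbreviation "Fix \<equiv> fixed_points G (D, \<rho>)"
abbreviation "A0 \<equiv> FObj (fixed_funct B p G) (D, \<rho>)"

lemma Fix_iff: "d \<in> Fix \<longleftrightarrow> d \<in> carrier D \<and> (\<forall>g\<in>carrier G. \<rho> d g = d)"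
  by (simp add: fixed_points_def)

lemma Fix_closed:
  shows "d \<in> Fix \<Longrightarrow> d \<in> carrier D" "d \<in> Fix \<Longrightarrow> g \<in> carrier G \<Longrightarrow> \<rho> d g = d"
    and "\<lbrakk>d \<in> Fix; d' \<in> Fix\<rbrakk> \<Longrightarrow> d \<oplus>\<^bsub>D\<^esub> d' \<in> Fix"
    and "\<lbrakk>b \<in> carrier B; d \<in> Fix\<rbrakk> \<Longrightarrow> p b \<odot>\<^bsub>D\<^esub> d \<in> Fix"
    and "\<zero>\<^bsub>D\<^esub> \<in> Fix"
    and "d \<in> carrier D \<Longrightarrow> tr d \<in> Fix"
proof -
  have "\<rho> \<zero>\<^bsub>D\<^esub> g = \<zero>\<^bsub>D\<^esub>" if "g \<in> carrier G" for g
    by (rule additive_zero [where M = D and f = "\<lambda>d. \<rho> d g"])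
      (simp_all add: D.abelian_group_axioms \<rho>_add that)
  then show "\<zero>\<^bsub>D\<^esub> \<in> Fix" by (simp add: Fix_iff)
qed (simp_all add: Fix_iff \<rho>_add \<rho>_smult act_p tr_fixed)

lemma A0_simps [simp]:
  "carrier A0 = Fix" "\<zero>\<^bsub>A0\<^esub> = \<zero>\<^bsub>D\<^esub>"
  "\<lbrakk>d \<in> Fix; d' \<in> Fix\<rbrakk> \<Longrightarrow> d \<oplus>\<^bsub>A0\<^esub> d' = d \<oplus>\<^bsub>D\<^esub> d'"
  "\<lbrakk>b \<in> carrier B; d \<in> Fix\<rbrakk> \<Longrightarrow> b \<odot>\<^bsub>A0\<^esub> d = p b \<odot>\<^bsub>D\<^esub> d"
  using Fix_closed(1) by (simp_all add: fixed_funct_def Let_def)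

lemma module_A0: "module B A0"
proof (rule moduleI)
  show "abelian_group A0"
  proof (rule abelian_groupI)
    fix d assume d: "d \<in> carrier A0"
    \<comment> \<open>The negative is written as a multiple by a scalar of \<open>B\<close>, so that
      it is visibly invariant.\<close>
    have "p (\<ominus>\<^bsub>B\<^esub> \<one>\<^bsub>B\<^esub>) \<odot>\<^bsub>D\<^esub> d \<oplus>\<^bsub>D\<^esub> d = (p (\<ominus>\<^bsub>B\<^esub> \<one>\<^bsub>B\<^esub>) \<oplus>\<^bsub>E\<^esub> \<one>\<^bsub>E\<^esub>) \<odot>\<^bsub>D\<^esub> d"
      using d by (simp add: D.smult_l_distr Fix_closed(1))
    also have "\<dots> = \<zero>\<^bsub>D\<^esub>" using d by (simp add: E.l_neg Fix_closed(1))
    finally show "\<exists>d'\<in>carrier A0. d' \<oplus>\<^bsub>A0\<^esub> d = \<zero>\<^bsub>A0\<^esub>"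
      using d Fix_closed(4) [of "\<ominus>\<^bsub>B\<^esub> \<one>\<^bsub>B\<^esub>" d] by (intro bexI [of _ "p (\<ominus>\<^bsub>B\<^esub> \<one>\<^bsub>B\<^esub>) \<odot>\<^bsub>D\<^esub> d"]) simp_all
  qed (simp_all add: Fix_closed D.a_ac)
qed (simp_all add: cring_B Fix_closed D.smult_l_distr D.smult_r_distr D.smult_assoc1)

lemma strict_A0: "strict_module B A0"
  using module_A0 unfolding fixed_funct_def by (simp add: Let_def strict_module_mk_module)

end

section \<open>The counit of the adjunction\<close>

locale galois_counit = galois_module B E G p act D \<rho>
  for B :: "'b ring" and E :: "'e ring" and G :: "'g monoid" and p :: "'b \<Rightarrow> 'e"
    and act :: "'e \<Rightarrow> 'g \<Rightarrow> 'e" and D :: "('e, 'a) module" and \<rho> :: "'a \<Rightarrow> 'g \<Rightarrow> 'a"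
begin

text \<open>Attached to a locale of its own, because each \<open>galois_ext\<close> in turn contains
  a \<open>galois_module\<close>, and an inclusion in both directions would be circular.\<close>

sublocale ext: galois_ext B E G p act A0
  by (simp add: galois_ext_def galois_data_axioms module_A0)

definition counit :: "('e \<times> 'a \<Rightarrow>\<^sub>0 int) set \<Rightarrow> 'a" where
  "counit = tensor_lift B Ep A0 (add_monoid D) (\<lambda>e a. e \<odot>\<^bsub>D\<^esub> a)"

lemma counit_hom: "counit \<in> hom ext.T (add_monoid D)"
  and counit_pure: "\<lbrakk>e \<in> carrier E; d \<in> Fix\<rbrakk> \<Longrightarrow> counit (pure_tensor B Ep A0 e d) = e \<odot>\<^bsub>D\<^esub> d"
proof -
  note facts = module_Ep module_A0 D.a_comm_group
  note simps = Fix_closed D.smult_l_distr D.smult_r_distr D.smult_assoc1 E.m_comm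
  show "counit \<in> hom ext.T (add_monoid D)"
    unfolding counit_def by (rule tensor_lift(1) [OF facts]) (simp_all add: simps flip: D.smult_assoc1)
  show "counit (pure_tensor B Ep A0 e d) = e \<odot>\<^bsub>D\<^esub> d" if "e \<in> carrier E" "d \<in> Fix"
    unfolding counit_def
    by (rule tensor_lift(2) [OF facts]) (use that in \<open>simp_all add: simps flip: D.smult_assoc1\<close>)
qed

lemma counit_closed [simp]: "t \<in> carrier ext.T \<Longrightarrow> counit t \<in> carrier D"
  and counit_add: "\<lbrakk>s \<in> carrier ext.T; t \<in> carrier ext.T\<rbrakk> \<Longrightarrow> counit (s \<oplus>\<^bsub>ext.X\<^esub> t) = counit s \<oplus>\<^bsub>D\<^esub> counit t"
  using counit_hom by (auto simp: hom_def)

lemma counit_zero: "counit \<zero>\<^bsub>ext.X\<^esub> = \<zero>\<^bsub>D\<^esub>"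
  by (rule additive_zero [OF ext.X.abelian_group_axioms D.abelian_group_axioms])
    (simp_all add: counit_add del: ext.ext_simps(3))

lemma counit_smult:
  assumes "e \<in> carrier E" "t \<in> carrier ext.T"
  shows "counit (e \<odot>\<^bsub>ext.X\<^esub> t) = e \<odot>\<^bsub>D\<^esub> counit t"
  using assms(2)
proof (induction rule: ext.ext_induct)
  case (pure e' d t)
  then show ?case
    using assms(1) by (simp add: ext.X.smult_r_distr counit_add counit_pure ext.smult_pure
        D.smult_r_distr D.smult_assoc1 Fix_closed del: ext.ext_simps(3))
qed (use assms(1) in \<open>simp add: counit_zero del: ext.ext_simps(2)\<close>)

lemma counit_act:
  assumes "g \<in> carrier G" "t \<in> carrier ext.T"
  shows "counit (ext.\<alpha> t g) = \<rho> (counit t) g"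
  using assms(2)
proof (induction rule: ext.ext_induct)
  case zero
  have "\<rho> \<zero>\<^bsub>D\<^esub> g = \<zero>\<^bsub>D\<^esub>" using Fix_closed(2) [OF Fix_closed(5) assms(1)] .
  then show ?case using assms(1) by (simp add: counit_zero ext.ext_action_zero del: ext.ext_simps(2))
next
  case (pure e d t)
  then show ?case
    using assms(1) by (simp add: ext.ext_action_add counit_add counit_pure ext.ext_action_pure
        \<rho>_add \<rho>_smult Fix_closed del: ext.ext_simps(3))
qed

text \<open>The Galois condition and purity enter only through the dual basis \<open>L\<close> and
  the hypothesis on traces. \<open>counit\<close> after \<open>?s\<close> is the identity by
  \<open>tr_dual_basis\<close>; the other composite is additive and therefore needs checking only on
  pure tensors.\<close>

lemma bij_counit:
  assumes fin: "finite (carrier G)" and L: "is_dual_basis L"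
    and base: "\<And>e. e \<in> carrier E \<Longrightarrow> trE e \<in> p ` carrier B"
  shows "bij_betw counit (carrier ext.T) (carrier D)"
proof -
  let ?s = "\<lambda>d. lsum ext.X (\<lambda>(x, y). pure_tensor B Ep A0 x (tr (y \<odot>\<^bsub>D\<^esub> d))) L"
  have L': "fst z \<in> carrier E" "snd z \<in> carrier E" if "z \<in> set L" for z
    using L that by (auto simp: is_dual_basis_def)
  have pt: "pure_tensor B Ep A0 (fst z) (tr (snd z \<odot>\<^bsub>D\<^esub> d)) \<in> carrier ext.T"
    if "z \<in> set L" "d \<in> carrier D" for z d
    using that L' by (simp add: Fix_closed)
  have s_closed: "?s d \<in> carrier ext.T" if "d \<in> carrier D" for d
    using ext.X.lsum_closed [of L "\<lambda>(x, y). pure_tensor B Ep A0 x (tr (y \<odot>\<^bsub>D\<^esub> d))"] pt that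
    by (simp add: case_prod_beta')
  have s_add: "?s (d \<oplus>\<^bsub>D\<^esub> d') = ?s d \<oplus>\<^bsub>ext.X\<^esub> ?s d'" if d: "d \<in> carrier D" "d' \<in> carrier D" for d d'
  proof -
    have "?s (d \<oplus>\<^bsub>D\<^esub> d') = lsum ext.X (\<lambda>z. pure_tensor B Ep A0 (fst z) (tr (snd z \<odot>\<^bsub>D\<^esub> d)) \<oplus>\<^bsub>ext.X\<^esub>
        pure_tensor B Ep A0 (fst z) (tr (snd z \<odot>\<^bsub>D\<^esub> d'))) L"
      unfolding case_prod_beta
    proof (rule lsum_cong)
      fix z assume "z \<in> set L"
      with L' [of z] d show "pure_tensor B Ep A0 (fst z) (tr (snd z \<odot>\<^bsub>D\<^esub> (d \<oplus>\<^bsub>D\<^esub> d'))) =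
        pure_tensor B Ep A0 (fst z) (tr (snd z \<odot>\<^bsub>D\<^esub> d)) \<oplus>\<^bsub>ext.X\<^esub>
        pure_tensor B Ep A0 (fst z) (tr (snd z \<odot>\<^bsub>D\<^esub> d'))"
        using ext.pure_add_right [of "fst z" "tr (snd z \<odot>\<^bsub>D\<^esub> d)" "tr (snd z \<odot>\<^bsub>D\<^esub> d')"]
        by (simp add: D.smult_r_distr tr_add Fix_closed)
    qed
    also have "\<dots> = ?s d \<oplus>\<^bsub>ext.X\<^esub> ?s d'"
      unfolding case_prod_beta' using pt d by (intro ext.X.lsum_add) (simp_all del: ext.ext_simps(3))
    finally show ?thesis .
  qed
  have s_zero: "?s \<zero>\<^bsub>D\<^esub> = \<zero>\<^bsub>ext.X\<^esub>"
    by (rule additive_zero [OF D.abelian_group_axioms ext.X.abelian_group_axioms])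
      (simp_all only: s_closed s_add ext.ext_simps(1))
  have counit_s: "counit (?s d) = d" if d: "d \<in> carrier D" for d
  proof -
    have "counit (?s d) = lsum D (\<lambda>z. counit (pure_tensor B Ep A0 (fst z) (tr (snd z \<odot>\<^bsub>D\<^esub> d)))) L"
      unfolding case_prod_beta' using pt d
      by (intro additive_lsum ext.X.abelian_group_axioms D.abelian_group_axioms)
        (simp_all only: counit_add counit_closed ext.ext_simps(1))
    also have "\<dots> = lsum D (\<lambda>(x, y). x \<odot>\<^bsub>D\<^esub> tr (y \<odot>\<^bsub>D\<^esub> d)) L"
      using L' d by (intro lsum_cong) (simp add: case_prod_beta' counit_pure Fix_closed)
    also have "\<dots> = d" by (rule tr_dual_basis [OF fin L d])
    finally show ?thesis .
  qed
  \<comment> \<open>For invariant \<open>a\<close>, \<open>tr(y(ea)) = tr(ye) a\<close>. The scalar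
    \<open>tr(ye)\<close> comes from \<open>B\<close> and moves to the left factor, where
    \<open>\<Sum> x tr(ye) = e\<close>.\<close>
  have s_smult: "?s (e \<odot>\<^bsub>D\<^esub> a) = pure_tensor B Ep A0 e a" if e: "e \<in> carrier E" and a: "a \<in> Fix" for e a
  proof -
    note aD = Fix_closed(1) [OF a]
    have "?s (e \<odot>\<^bsub>D\<^esub> a) = lsum ext.X (\<lambda>z. pure_tensor B Ep A0 (fst z \<otimes>\<^bsub>E\<^esub> trE (snd z \<otimes>\<^bsub>E\<^esub> e)) a) L"
      unfolding case_prod_beta
    proof (rule lsum_cong)
      fix z assume "z \<in> set L"
      note z = L' [OF this]
      obtain b where b: "b \<in> carrier B" "trE (snd z \<otimes>\<^bsub>E\<^esub> e) = p b"
        using base [of "snd z \<otimes>\<^bsub>E\<^esub> e"] z e by auto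
      have "tr (snd z \<odot>\<^bsub>D\<^esub> (e \<odot>\<^bsub>D\<^esub> a)) = p b \<odot>\<^bsub>D\<^esub> a"
        using tr_smult_fixed [of "snd z \<otimes>\<^bsub>E\<^esub> e" a] z e a b by (simp add: Fix_closed D.smult_assoc1)
      then show "pure_tensor B Ep A0 (fst z) (tr (snd z \<odot>\<^bsub>D\<^esub> (e \<odot>\<^bsub>D\<^esub> a))) =
          pure_tensor B Ep A0 (fst z \<otimes>\<^bsub>E\<^esub> trE (snd z \<otimes>\<^bsub>E\<^esub> e)) a"
        using ext.pure_smult [of b "fst z" a] z b a by (simp add: E.m_comm)
    qed
    also have "\<dots> = pure_tensor B Ep A0 (lsum E (\<lambda>z. fst z \<otimes>\<^bsub>E\<^esub> trE (snd z \<otimes>\<^bsub>E\<^esub> e)) L) a"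
      using L' e a ext.pure_add_left
      by (intro additive_lsum [where f = "\<lambda>x. pure_tensor B Ep A0 x a", symmetric]
          E.abelian_group_axioms ext.X.abelian_group_axioms) simp_all
    also have "\<dots> = pure_tensor B Ep A0 e a"
      using trE_dual_basis [OF fin L e] by (simp add: case_prod_beta')
    finally show ?thesis .
  qed
  have s_counit: "?s (counit t) = t" if "t \<in> carrier ext.T" for t
    using that
  proof (induction rule: ext.ext_induct)
    case (pure e a t)
    then have "counit (pure_tensor B Ep A0 e a \<oplus>\<^bsub>ext.X\<^esub> t) = e \<odot>\<^bsub>D\<^esub> a \<oplus>\<^bsub>D\<^esub> counit t"
      by (simp add: counit_add counit_pure del: ext.ext_simps(3))
    then show ?case using pure by (simp only: s_add s_smult A0_simps counit_closed Fix_closed D.smult_closed)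
  qed (simp only: counit_zero s_zero)
  show ?thesis
    by (rule bij_betw_byWitness [where f' = ?s])
      (use s_counit counit_s s_closed in auto)
qed

end

context galois_descent
begin

lemma bij_counit_descent:
  assumes "galois_counit B E G p act D \<rho>"
  shows "bij_betw (galois_counit.counit B E G p D \<rho>) (carrier (tensor_group B Ep (FObj (fixed_funct B p G) (D, \<rho>)))) (carrier D)"
proof -
  obtain L where "is_dual_basis L" using dual_basis_exists by blast
  then show ?thesis
    by (intro galois_counit.bij_counit [OF assms finite_G] trE_in_base)
qed

end

section \<open>The unit of the adjunction\<close>

locale descent_ext = galois_descent B E G p act U + galois_ext B E G p act A
  for B :: "'b ring" and E :: "'e ring" and G :: "'g monoid"
    and p :: "'b \<Rightarrow> 'e" and act :: "'e \<Rightarrow> 'g \<Rightarrow> 'e" and U :: "'u itself" and A :: "('b, 'u) module"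
begin

text \<open>\<open>pure_mono\<close> speaks of \<open>a \<otimes> 1\<close> in
  \<open>A \<otimes> E\<close>; interchanging the factors brings the equation into that
  form.\<close>

lemma unit_inj:
  assumes a: "a \<in> carrier A" "a' \<in> carrier A" and eq: "\<one>\<^bsub>E\<^esub> \<otimes>\<^sub>t a = \<one>\<^bsub>E\<^esub> \<otimes>\<^sub>t a'"
  shows "a = a'"
proof -
  interpret S: tensor B A Ep by (simp add: tensor_def module_Ep A.module_axioms)
  let ?h = "tensor_lift B Ep A S.T (\<lambda>e a. pure_tensor B A Ep a e)"
  have h: "?h (\<one>\<^bsub>E\<^esub> \<otimes>\<^sub>t a) = pure_tensor B A Ep a \<one>\<^bsub>E\<^esub>" if "a \<in> carrier A" for a
    by (rule tensor_lift(2) [OF module_Ep A.module_axioms S.comm_group_tensor])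
      (use that in \<open>simp_all add: S.pure_add_left S.pure_add_right S.pure_smult
        del: restrict_scalars_simps(3,4)\<close>)
  have "inj_on (\<lambda>n. pure_tensor B A Ep n \<one>\<^bsub>E\<^esub>) (carrier A)"
    using pure A.module_axioms unfolding pure_mono_def by blast
  from inj_onD [OF this _ a] show ?thesis
    using h [OF a(1)] h [OF a(2)] eq by simp
qed

text \<open>\<open>e \<otimes> a\<close> is the multiple by \<open>e\<close> of the invariant tensor
  \<open>1 \<otimes> a\<close>, so its trace is \<open>tr(e) \<otimes> a\<close>. As
  \<open>tr(e) = p b\<close>, this equals \<open>1 \<otimes> ba\<close>.\<close>

lemma trace_pure: "t \<in> carrier T \<Longrightarrow> \<exists>a\<in>carrier A. X.tr t = \<one>\<^bsub>E\<^esub> \<otimes>\<^sub>t a"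
proof (induction rule: ext_induct)
  case zero
  then show ?case using pure_zero_right [of "\<one>\<^bsub>E\<^esub>"]
    by (intro bexI [of _ "\<zero>\<^bsub>A\<^esub>"]) (simp_all add: X.tr_zero [simplified])
next
  case (pure e a t)
  then obtain a' where a': "a' \<in> carrier A" "X.tr t = \<one>\<^bsub>E\<^esub> \<otimes>\<^sub>t a'" by blast
  obtain b where b: "b \<in> carrier B" "trE e = p b" using trE_in_base [OF pure(1)] by blast
  have "X.tr (e \<otimes>\<^sub>t a) = X.tr (e \<odot>\<^bsub>X\<^esub> \<one>\<^bsub>E\<^esub> \<otimes>\<^sub>t a)"
    using pure by (simp add: smult_pure)
  also have "\<dots> = trE e \<odot>\<^bsub>X\<^esub> \<one>\<^bsub>E\<^esub> \<otimes>\<^sub>t a"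
    using pure by (intro X.tr_smult_fixed) (simp_all add: ext_action_pure)
  also have "\<dots> = \<one>\<^bsub>E\<^esub> \<otimes>\<^sub>t (b \<odot>\<^bsub>A\<^esub> a)"
    using pure b pure_smult [of b "\<one>\<^bsub>E\<^esub>" a] by (simp add: smult_pure)
  finally have "X.tr (e \<otimes>\<^sub>t a \<oplus>\<^bsub>X\<^esub> t) = \<one>\<^bsub>E\<^esub> \<otimes>\<^sub>t (b \<odot>\<^bsub>A\<^esub> a \<oplus>\<^bsub>A\<^esub> a')"
    using pure a' b pure_add_right [of "\<one>\<^bsub>E\<^esub>" "b \<odot>\<^bsub>A\<^esub> a" a']
      X.tr_add [of "e \<otimes>\<^sub>t a" t] by simp
  then show ?case using pure a' b by blast
qed

lemma unit_surj:
  assumes t: "t \<in> carrier T" "\<And>g. g \<in> carrier G \<Longrightarrow> \<alpha> t g = t"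
  shows "\<exists>a\<in>carrier A. t = \<one>\<^bsub>E\<^esub> \<otimes>\<^sub>t a"
proof -
  obtain c where c: "c \<in> carrier E" "trE c = \<one>\<^bsub>E\<^esub>" using trE_onto by blast
  have "X.tr (c \<odot>\<^bsub>X\<^esub> t) = t"
    using X.tr_smult_fixed [of c t] t c by simp
  then show ?thesis using trace_pure [of "c \<odot>\<^bsub>X\<^esub> t"] t c by simp
qed

end

section \<open>The equivalence\<close>

lemma lepoll_times_UNIV:
  assumes "infinite (UNIV :: 'u set)" "S \<lesssim> (UNIV :: 'u set)"
  shows "S \<times> (UNIV :: 'u set) \<lesssim> (UNIV :: 'u set)"
proof -
  have "|S| \<le>o |UNIV :: 'u set|"
    using assms(2) unfolding lepoll_def card_of_ordLeq .
  then have "|S \<times> (UNIV :: 'u set)| \<le>o |UNIV :: 'u set|"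
    by (intro card_of_Sigma_ordLeq_infinite assms(1)) simp_all
  then show ?thesis unfolding lepoll_def card_of_ordLeq .
qed

lemma inj_on_encode:
  assumes "S \<lesssim> (UNIV :: 'u set)"
  shows "inj_on (encode S :: 's \<Rightarrow> 'u) S"
proof -
  have "\<exists>i :: 's \<Rightarrow> 'u. inj_on i S" using assms by (auto simp: lepoll_def)
  then show ?thesis unfolding encode_def by (rule someI_ex)
qed

lemma module_cat_simps [simp]:
  "Obj (module_cat R) = {M. strict_module R M}" "Hom (module_cat R) = mod_hom R"
  "Ident (module_cat R) M = (\<lambda>x\<in>carrier M. x)"
  "Comp (module_cat R) L M N g f = compose (carrier L) g f"
  by (simp_all add: module_cat_def)

section \<open>The size of \<open>E \<otimes> A\<close> and its copy on \<open>'u\<close>\<close>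

context descent_ext
begin

text \<open>\<open>E \<otimes> A\<close> is a quotient of a free abelian group, and such a group is
  no larger than an infinite generating set. This bound is what makes \<open>encode\<close>
  injective.\<close>

lemma small_tensor: "carrier T \<lesssim> (UNIV :: 'u set)"
proof -
  \<comment> \<open>All of \<open>'u\<close> replaces the carrier of \<open>A\<close>, because the
    generating set must be infinite even for finite \<open>E\<close> and \<open>A\<close>.\<close>
  let ?S = "carrier E \<times> (UNIV :: 'u set)"
  have inf: "infinite ?S"
    using infinite_U E.zero_closed by (auto simp: finite_cartesian_product_iff)
  have "carrier T = (\<lambda>c. K #>\<^bsub>F\<^esub> c) ` carrier F"
    by (auto simp: tensor_group_def FactGroup_def RCOSETS_def)
  then have "carrier T \<lesssim> carrier F" by (simp only: image_lepoll)
  also have "carrier F \<lesssim> carrier (free_Abelian_group ?S)"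
    by (intro subset_imp_lepoll) auto
  also have "\<dots> \<approx> ?S" by (rule eqpoll_free_Abelian_group_infinite [OF inf])
  also have "?S \<lesssim> (UNIV :: 'u set)" by (rule lepoll_times_UNIV [OF infinite_U small_E])
  finally show ?thesis .
qed

abbreviation "C \<equiv> (FObj (ext_funct B E p G act) A :: ('e, 'u) module \<times> _)"
abbreviation "c \<equiv> (encode (carrier T) :: _ \<Rightarrow> 'u)"

lemma c_inj: "inj_on c (carrier T)"
  by (rule inj_on_encode [OF small_tensor])

lemma C_eq: "C = copy_gmodule E G (X, \<alpha>)"
  by (simp add: ext_funct_def Let_def)

lemma C_obj: "C \<in> Obj GM"
  and C_carrier: "carrier (fst C) = c ` carrier T"
  and c_hom: "restrict c (carrier T) \<in> mod_hom E X (fst C)"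
  and c_act: "\<lbrakk>t \<in> carrier T; g \<in> carrier G\<rbrakk> \<Longrightarrow> c (\<alpha> t g) = snd C (c t) g"
  unfolding C_eq using X.copy_obj [where 'c = 'u] c_inj by simp_all

lemma c_closed: "t \<in> carrier T \<Longrightarrow> c t \<in> carrier (fst C)"
  by (simp add: C_carrier)

lemma c_add: "\<lbrakk>s \<in> carrier T; t \<in> carrier T\<rbrakk> \<Longrightarrow> c (s \<oplus>\<^bsub>X\<^esub> t) = c s \<oplus>\<^bsub>fst C\<^esub> c t"
  and c_smult: "\<lbrakk>e \<in> carrier E; t \<in> carrier T\<rbrakk> \<Longrightarrow> c (e \<odot>\<^bsub>X\<^esub> t) = e \<odot>\<^bsub>fst C\<^esub> c t"
  using mod_homD(3,4) [OF c_hom] by simp_all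

lemma decode_c: "t \<in> carrier T \<Longrightarrow> decode (carrier T) (c t) = t"
  using c_inj by (simp add: decode_def)

lemma C_cases:
  assumes "x \<in> carrier (fst C)"
  obtains t where "t \<in> carrier T" "x = c t"
  using assms by (auto simp: C_carrier)

lemma isomorphic_copy: "gmodule_isomorphic E G (X, \<alpha>) C"
proof -
  have "bij_betw (restrict c (carrier T)) (carrier T) (carrier (fst C))"
    using c_inj by (simp add: bij_betw_def C_carrier)
  then show ?thesis
    unfolding gmodule_isomorphic_def using c_hom c_act
    by (auto simp: case_prod_beta intro!: bexI [of _ "restrict c (carrier T)"])
qed

end

section \<open>Functoriality of extension of scalars\<close>

context galois_data
begin

text \<open>The morphism part of \<open>ext_funct\<close> without codes, so that linearity and
  equivariance can be proved by induction over tensors.\<close>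

definition ext_map :: "('b, 'a) module \<Rightarrow> ('b, 'c) module \<Rightarrow> ('a \<Rightarrow> 'c)
    \<Rightarrow> ('e \<times> 'a \<Rightarrow>\<^sub>0 int) set \<Rightarrow> ('e \<times> 'c \<Rightarrow>\<^sub>0 int) set" where
  "ext_map A A' f = tensor_lift B Ep A (tensor_group B Ep A') (\<lambda>e a. pure_tensor B Ep A' e (f a))"

lemma ext_map:
  assumes A: "module B A" and A': "module B A'" and f: "f \<in> mod_hom B A A'"
  shows "\<And>e a. \<lbrakk>e \<in> carrier E; a \<in> carrier A\<rbrakk> \<Longrightarrow>
      ext_map A A' f (pure_tensor B Ep A e a) = pure_tensor B Ep A' e (f a)"
    and "\<And>t. t \<in> carrier (tensor_group B Ep A) \<Longrightarrow> ext_map A A' f t \<in> carrier (tensor_group B Ep A')"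
    and "\<And>s t. \<lbrakk>s \<in> carrier (tensor_group B Ep A); t \<in> carrier (tensor_group B Ep A)\<rbrakk> \<Longrightarrow>
      ext_map A A' f (s \<oplus>\<^bsub>ext_module B E p A\<^esub> t) = ext_map A A' f s \<oplus>\<^bsub>ext_module B E p A'\<^esub> ext_map A A' f t"
    and "ext_map A A' f \<zero>\<^bsub>ext_module B E p A\<^esub> = \<zero>\<^bsub>ext_module B E p A'\<^esub>"
    and "\<And>e t. \<lbrakk>e \<in> carrier E; t \<in> carrier (tensor_group B Ep A)\<rbrakk> \<Longrightarrow>
      ext_map A A' f (e \<odot>\<^bsub>ext_module B E p A\<^esub> t) = e \<odot>\<^bsub>ext_module B E p A'\<^esub> ext_map A A' f t"
    and "\<And>g t. \<lbrakk>g \<in> carrier G; t \<in> carrier (tensor_group B Ep A)\<rbrakk> \<Longrightarrow>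
      ext_map A A' f (ext_action B E p G act A t g) = ext_action B E p G act A' (ext_map A A' f t) g"
proof -
  interpret A: galois_ext B E G p act A by (simp add: galois_ext_def galois_data_axioms A)
  interpret A': galois_ext B E G p act A' by (simp add: galois_ext_def galois_data_axioms A')
  note f = mod_homD(2-4) [OF f]
  have hom: "ext_map A A' f \<in> hom A.T A'.T"
    unfolding ext_map_def
    by (rule tensor_map(1) [OF A.tensor_axioms A'.tensor_axioms, of "\<lambda>e. e"]) (simp_all add: f)
  show on_pure: "ext_map A A' f (pure_tensor B Ep A e a) = pure_tensor B Ep A' e (f a)"
    if "e \<in> carrier E" "a \<in> carrier A" for e a
    unfolding ext_map_def
    by (rule tensor_map(2) [OF A.tensor_axioms A'.tensor_axioms, of "\<lambda>e. e"]) (simp_all add: f that)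
  show closed: "ext_map A A' f t \<in> carrier A'.T" if "t \<in> carrier A.T" for t
    using hom that by (auto simp: hom_def)
  show add: "ext_map A A' f (s \<oplus>\<^bsub>A.X\<^esub> t) = ext_map A A' f s \<oplus>\<^bsub>A'.X\<^esub> ext_map A A' f t"
    if "s \<in> carrier A.T" "t \<in> carrier A.T" for s t
    using hom that closed by (simp add: hom_def)
  show zero: "ext_map A A' f \<zero>\<^bsub>A.X\<^esub> = \<zero>\<^bsub>A'.X\<^esub>"
    by (rule additive_zero [OF A.X.abelian_group_axioms A'.X.abelian_group_axioms])
      (simp_all only: closed add A.ext_simps(1) A'.ext_simps(1))
  show "ext_map A A' f (e \<odot>\<^bsub>A.X\<^esub> t) = e \<odot>\<^bsub>A'.X\<^esub> ext_map A A' f t"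
    if e: "e \<in> carrier E" and t: "t \<in> carrier A.T" for e t
    using t
  proof (induction rule: A.ext_induct)
    case (pure e' a t)
    then show ?case using e f(1)
      by (simp add: A.X.smult_r_distr A'.X.smult_r_distr add on_pure
          A.smult_pure A'.smult_pure closed del: A.ext_simps(3) A'.ext_simps(3))
  qed (use e in \<open>simp add: zero del: A.ext_simps(2) A'.ext_simps(2)\<close>)
  show "ext_map A A' f (A.\<alpha> t g) = A'.\<alpha> (ext_map A A' f t) g"
    if g: "g \<in> carrier G" and t: "t \<in> carrier A.T" for g t
    using t
  proof (induction rule: A.ext_induct)
    case (pure e' a t)
    then show ?case using g f(1)
      by (simp add: A.ext_action_add A'.ext_action_add add on_pure
          A.ext_action_pure A'.ext_action_pure closed del: A.ext_simps(3) A'.ext_simps(3))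
  qed (use g in \<open>simp add: zero A.ext_action_zero A'.ext_action_zero del: A.ext_simps(2) A'.ext_simps(2)\<close>)
qed

end

section \<open>Functoriality of the invariants\<close>

context galois_data
begin

lemma galois_counitI: "X \<in> Obj GM \<Longrightarrow> galois_counit B E G p act (fst X) (snd X)"
  by (simp add: galois_counit_def gmodule_objD)

lemma fixed_funct_simps:
  "FObj (fixed_funct B p G) X = FObj (fixed_funct B p G) (fst X, snd X)"
  "FHom (fixed_funct B p G) X Y f = restrict f (fixed_points G X)"
  by (simp_all add: fixed_funct_def)

lemma fixed_hom:
  assumes X: "X \<in> Obj GM" and Y: "Y \<in> Obj GM" and f: "f \<in> Hom GM X Y"
  shows "restrict f (fixed_points G X) \<in>
    mod_hom B (FObj (fixed_funct B p G) X) (FObj (fixed_funct B p G) Y)"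
proof -
  interpret X: galois_counit B E G p act "fst X" "snd X" by (rule galois_counitI [OF X])
  \<comment> \<open>The locale facts mention the pair \<open>(fst X, snd X)\<close>;
    \<open>prod.collapse\<close> restores \<open>X\<close>.\<close>
  note [simp] = X.A0_simps [unfolded prod.collapse]
  note X_Fix = X.Fix_iff [unfolded prod.collapse] and X_cl = X.Fix_closed [unfolded prod.collapse]
  interpret Y: galois_counit B E G p act "fst Y" "snd Y" by (rule galois_counitI [OF Y])
  note [simp] = Y.A0_simps [unfolded prod.collapse]
  note Y_Fix = Y.Fix_iff [unfolded prod.collapse] and Y_cl = Y.Fix_closed [unfolded prod.collapse]
  have fm: "f \<in> mod_hom E (fst X) (fst Y)"
    and fa: "\<And>d g. \<lbrakk>d \<in> carrier (fst X); g \<in> carrier G\<rbrakk> \<Longrightarrow> f (snd X d g) = snd Y (f d) g"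
    using f by (auto simp: gmodule_cat_simps)
  note f' = mod_homD(2-4) [OF fm]
  have fx: "f d \<in> fixed_points G Y" if "d \<in> fixed_points G X" for d
    using that by (auto simp: X_Fix Y_Fix f' simp flip: fa)
  have "restrict f (fixed_points G X) \<in> mod_hom B X.A0 Y.A0"
    by (rule mod_homI) (simp_all add: fx X_cl f')
  then show ?thesis by simp
qed

lemma is_functor_fixed:
  "is_functor (GM :: (('e, 'a) module \<times> _, 'a \<Rightarrow> 'a) category) (module_cat B) (fixed_funct B p G)"
proof (intro is_functor.intro is_functor_axioms.intro category_GM category_module_cat)
  fix X Y Z :: "('e, 'a) module \<times> ('a \<Rightarrow> 'g \<Rightarrow> 'a)" and f g
  assume X: "X \<in> Obj GM"
  interpret X: galois_counit B E G p act "fst X" "snd X" by (rule galois_counitI [OF X])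
  note [simp] = X.A0_simps [unfolded prod.collapse]
  note X_Fix = X.Fix_iff [unfolded prod.collapse] and X_cl = X.Fix_closed [unfolded prod.collapse]
  show "FObj (fixed_funct B p G) X \<in> Obj (module_cat B)"
    using X.strict_A0 by simp
  show "FHom (fixed_funct B p G) X X (Ident GM X) = Ident (module_cat B) (FObj (fixed_funct B p G) X)"
    using X_cl(1) by (auto simp: fixed_funct_simps(2) gmodule_cat_simps fun_eq_iff)
  assume Y: "Y \<in> Obj GM" and f: "f \<in> Hom GM X Y"
  show fm: "FHom (fixed_funct B p G) X Y f \<in> Hom (module_cat B) (FObj (fixed_funct B p G) X) (FObj (fixed_funct B p G) Y)"
    using fixed_hom [OF X Y f] by (simp add: fixed_funct_simps(2))
  assume Z: "Z \<in> Obj GM" and g: "g \<in> Hom GM Y Z"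
  interpret Y: galois_counit B E G p act "fst Y" "snd Y" by (rule galois_counitI [OF Y])
  note [simp] = Y.A0_simps [unfolded prod.collapse]
  note Y_Fix = Y.Fix_iff [unfolded prod.collapse] and Y_cl = Y.Fix_closed [unfolded prod.collapse]
  have "f d \<in> fixed_points G Y" if "d \<in> fixed_points G X" for d
    using mod_homD(2) [OF fixed_hom [OF X Y f], of d] that by simp
  then show "FHom (fixed_funct B p G) X Z (Comp GM X Y Z g f) =
     Comp (module_cat B) (FObj (fixed_funct B p G) X) (FObj (fixed_funct B p G) Y)
       (FObj (fixed_funct B p G) Z) (FHom (fixed_funct B p G) Y Z g) (FHom (fixed_funct B p G) X Y f)"
    using X_cl(1)
    by (auto simp: fixed_funct_simps(2) gmodule_cat_simps fun_eq_iff compose_def)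
qed

end

section \<open>The two functors on \<open>'u\<close> and their natural isomorphisms\<close>

context galois_descent
begin

abbreviation "Fu \<equiv> (ext_funct B E p G act :: (('b, 'u) module, _, ('e, 'u) module \<times> _, _) funct)"
abbreviation "Hu \<equiv> (fixed_funct B p G :: (('e, 'u) module \<times> _, _, ('b, 'u) module, _) funct)"

lemma descent_extI: "module B (A :: ('b, 'u) module) \<Longrightarrow> descent_ext B E G p act U A"
  by (simp add: descent_ext_def galois_descent_axioms galois_ext_def galois_data_axioms)

text \<open>Together with \<open>C_cases\<close>, which writes elements of the copy as codes, this
  reduces statements about \<open>Fu\<close> on morphisms to statements about
  \<open>ext_map\<close>.\<close>

lemma FHom_encode:
  fixes A A' :: "('b, 'u) module"
  assumes "module B A" "t \<in> carrier (tensor_group B Ep A)"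
  shows "FHom Fu A A' f (encode (carrier (tensor_group B Ep A)) t) =
    encode (carrier (tensor_group B Ep A')) (ext_map A A' f t)"
proof -
  interpret A: descent_ext B E G p act U A by (rule descent_extI) fact
  show ?thesis using assms(2) by (simp add: ext_funct_def Let_def A.decode_c ext_map_def)
qed

lemma is_functor_ext: "is_functor (module_cat B) GM Fu"
proof (intro is_functor.intro is_functor_axioms.intro category_GM category_module_cat)
  fix A A' A'' :: "('b, 'u) module" and f f' :: "'u \<Rightarrow> 'u"
  assume "A \<in> Obj (module_cat B)"
  then have A: "module B A" by (simp add: strict_moduleD)
  interpret A: descent_ext B E G p act U A by (rule descent_extI [OF A])
  show "FObj Fu A \<in> Obj GM" by (rule A.C_obj)
  \<comment> \<open>Equality of morphisms can then be tested on the codes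
    \<open>A.c t\<close>.\<close>
  have ext: "FHom Fu A A' f \<in> extensional (carrier (fst A.C))" for A' f
    unfolding A.C_carrier by (simp add: ext_funct_def Let_def)
  define i where "i = (\<lambda>x\<in>carrier A. x)"
  have i: "i \<in> mod_hom B A A" "\<And>a. a \<in> carrier A \<Longrightarrow> i a = a"
    by (simp_all add: i_def mod_hom_ident [OF A])
  have "ext_map A A i t = t" if "t \<in> carrier A.T" for t
    using that
  proof (induction rule: A.ext_induct)
    case (pure e a t)
    then show ?case
      by (simp add: ext_map [OF A A i(1)] i(2) del: A.ext_simps(3))
  qed (rule ext_map(4) [OF A A i(1)])
  then show "FHom Fu A A (Ident (module_cat B) A) = Ident GM (FObj Fu A)"
    by (intro extensionalityI [OF ext]) (auto simp: gmodule_cat_simps FHom_encode [OF A] A.c_closed simp flip: i_def elim!: A.C_cases)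
  assume "A' \<in> Obj (module_cat B)" and "f \<in> Hom (module_cat B) A A'"
  then have A': "module B A'" and f: "f \<in> mod_hom B A A'" by (simp_all add: strict_moduleD)
  interpret A': descent_ext B E G p act U A' by (rule descent_extI [OF A'])
  note ef = ext_map [OF A A' f]
  have "FHom Fu A A' f \<in> mod_hom E (fst A.C) (fst A'.C)"
  proof (rule mod_homI [OF ext])
    fix x y assume "x \<in> carrier (fst A.C)" "y \<in> carrier (fst A.C)"
    then obtain s t where st: "s \<in> carrier A.T" "t \<in> carrier A.T" "x = A.c s" "y = A.c t"
      by (metis A.C_cases)
    have "FHom Fu A A' f (A.c (s \<oplus>\<^bsub>A.X\<^esub> t)) = A'.c (ext_map A A' f s \<oplus>\<^bsub>A'.X\<^esub> ext_map A A' f t)"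
      using st A.X.a_closed [of s t] by (simp add: FHom_encode [OF A] ef del: A.ext_simps(3))
    then show "FHom Fu A A' f (x \<oplus>\<^bsub>fst A.C\<^esub> y) = FHom Fu A A' f x \<oplus>\<^bsub>fst A'.C\<^esub> FHom Fu A A' f y"
      using st by (simp add: A.c_add A'.c_add ef FHom_encode [OF A] del: A.ext_simps(3) A'.ext_simps(3))
  next
    fix x assume "x \<in> carrier (fst A.C)"
    then show "FHom Fu A A' f x \<in> carrier (fst A'.C)"
      by (auto elim!: A.C_cases simp: FHom_encode [OF A] A'.c_closed ef)
  next
    fix e x assume e: "e \<in> carrier E" and "x \<in> carrier (fst A.C)"
    then obtain t where t: "t \<in> carrier A.T" "x = A.c t" by (metis A.C_cases)
    have "FHom Fu A A' f (A.c (e \<odot>\<^bsub>A.X\<^esub> t)) = A'.c (e \<odot>\<^bsub>A'.X\<^esub> ext_map A A' f t)"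
      using e t by (simp add: FHom_encode [OF A] ef)
    then show "FHom Fu A A' f (e \<odot>\<^bsub>fst A.C\<^esub> x) = e \<odot>\<^bsub>fst A'.C\<^esub> FHom Fu A A' f x"
      using e t by (simp add: A.c_smult A'.c_smult ef FHom_encode [OF A])
  qed
  moreover have "FHom Fu A A' f (snd A.C x g) = snd A'.C (FHom Fu A A' f x) g"
    if x: "x \<in> carrier (fst A.C)" and g: "g \<in> carrier G" for x g
  proof -
    obtain t where t: "t \<in> carrier A.T" "x = A.c t" using x by (metis A.C_cases)
    then show ?thesis
      using g by (simp add: FHom_encode [OF A] ef flip: A.c_act A'.c_act)
  qed
  ultimately show fm: "FHom Fu A A' f \<in> Hom GM (FObj Fu A) (FObj Fu A')"
    by (simp add: gmodule_cat_simps)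
  assume "A'' \<in> Obj (module_cat B)" and "f' \<in> Hom (module_cat B) A' A''"
  then have A'': "module B A''" and f': "f' \<in> mod_hom B A' A''" by (simp_all add: strict_moduleD)
  interpret A'': descent_ext B E G p act U A'' by (rule descent_extI [OF A''])
  note ef' = ext_map [OF A' A'' f'] and ef'' = ext_map [OF A A'' mod_hom_compose [OF A f f']]
  have *: "ext_map A A'' (compose (carrier A) f' f) t = ext_map A' A'' f' (ext_map A A' f t)"
    if "t \<in> carrier A.T" for t
    using that
  proof (induction rule: A.ext_induct)
    case (pure e a t)
    then show ?case using mod_homD(2) [OF f, of a]
      by (simp add: ef ef' ef'' compose_eq del: A.ext_simps(3) A'.ext_simps(3) A''.ext_simps(3))
  qed (simp only: ef(4) ef'(4) ef''(4))
  have "FHom Fu A A'' (compose (carrier A) f' f) = compose (carrier (fst A.C)) (FHom Fu A' A'' f') (FHom Fu A A' f)"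
  proof (rule extensionalityI [OF ext])
    fix x assume x: "x \<in> carrier (fst A.C)"
    then obtain t where t: "t \<in> carrier A.T" "x = A.c t" by (metis A.C_cases)
    then show "FHom Fu A A'' (compose (carrier A) f' f) x =
        compose (carrier (fst A.C)) (FHom Fu A' A'' f') (FHom Fu A A' f) x"
      using x by (simp add: compose_eq FHom_encode [OF A] FHom_encode [OF A'] * ef(2))
  qed simp
  then show "FHom Fu A A'' (Comp (module_cat B) A A' A'' f' f) =
      Comp GM (FObj Fu A) (FObj Fu A') (FObj Fu A'') (FHom Fu A' A'' f') (FHom Fu A A' f)"
    by (simp add: gmodule_cat_simps)
qed

definition unit_map :: "('b, 'u) module \<Rightarrow> 'u \<Rightarrow> 'u" where
  "unit_map A = (\<lambda>a\<in>carrier A. encode (carrier (tensor_group B Ep A)) (pure_tensor B Ep A \<one>\<^bsub>E\<^esub> a))"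

text \<open>\<open>c\<close> is injective and equivariant, so the invariants of the copy are the
  codes of the invariant tensors. Bijectivity of the unit is then \<open>unit_inj\<close> and
  \<open>unit_surj\<close>; naturality is the value of \<open>ext_map\<close> on
  \<open>1 \<otimes> a\<close>.\<close>

lemma unit_natural: "natural_iso (module_cat B) (module_cat B) id_funct (comp_funct Hu Fu) unit_map"
  unfolding natural_iso_def
proof (intro conjI ballI)
  fix A :: "('b, 'u) module" assume "A \<in> Obj (module_cat B)"
  then have A: "module B A" by (simp add: strict_moduleD)
  interpret A: descent_ext B E G p act U A by (rule descent_extI [OF A])
  interpret C: galois_counit B E G p act "fst A.C" "snd A.C" by (rule galois_counitI [OF A.C_obj])
  note [simp] = C.A0_simps [unfolded prod.collapse]
  note C_Fix = C.Fix_iff [unfolded prod.collapse] and C_cl = C.Fix_closed [unfolded prod.collapse]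
  have fx: "A.c (pure_tensor B Ep A \<one>\<^bsub>E\<^esub> a) \<in> fixed_points G A.C" if "a \<in> carrier A" for a
    using that by (simp add: C_Fix A.c_closed A.ext_action_pure flip: A.c_act)
  have "unit_map A \<in> mod_hom B A C.A0"
  proof (rule mod_homI)
    fix a a' assume a: "a \<in> carrier A" "a' \<in> carrier A"
    then have "A.c (pure_tensor B Ep A \<one>\<^bsub>E\<^esub> a \<oplus>\<^bsub>A.X\<^esub> pure_tensor B Ep A \<one>\<^bsub>E\<^esub> a') =
        A.c (pure_tensor B Ep A \<one>\<^bsub>E\<^esub> a) \<oplus>\<^bsub>fst A.C\<^esub> A.c (pure_tensor B Ep A \<one>\<^bsub>E\<^esub> a')"
      by (intro A.c_add) simp_all
    then show "unit_map A (a \<oplus>\<^bsub>A\<^esub> a') = unit_map A a \<oplus>\<^bsub>C.A0\<^esub> unit_map A a'"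
      using a fx by (simp add: unit_map_def A.pure_add_right)
  next
    fix b a assume a: "b \<in> carrier B" "a \<in> carrier A"
    then have "A.c (p b \<odot>\<^bsub>A.X\<^esub> pure_tensor B Ep A \<one>\<^bsub>E\<^esub> a) = p b \<odot>\<^bsub>fst A.C\<^esub> A.c (pure_tensor B Ep A \<one>\<^bsub>E\<^esub> a)"
      by (intro A.c_smult) simp_all
    then show "unit_map A (b \<odot>\<^bsub>A\<^esub> a) = b \<odot>\<^bsub>C.A0\<^esub> unit_map A a"
      using a fx A.pure_smult [of b "\<one>\<^bsub>E\<^esub>" a] by (simp add: unit_map_def A.smult_pure)
  qed (simp_all add: unit_map_def fx)
  moreover have "bij_betw (unit_map A) (carrier A) (carrier C.A0)"
    unfolding bij_betw_def
  proof (intro conjI inj_onI equalityI subsetI)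
    fix a a' assume "a \<in> carrier A" "a' \<in> carrier A" "unit_map A a = unit_map A a'"
    then show "a = a'"
      by (intro A.unit_inj) (auto simp: unit_map_def dest!: inj_onD [OF A.c_inj])
  next
    fix x assume "x \<in> carrier C.A0"
    then have x: "x \<in> carrier (fst A.C)" "\<And>g. g \<in> carrier G \<Longrightarrow> snd A.C x g = x"
      by (simp_all add: C_Fix)
    then obtain t where t: "t \<in> carrier A.T" "x = A.c t" by (metis A.C_cases)
    \<comment> \<open>Invariance is pulled back along the injective equivariant map
      \<open>A.c\<close>.\<close>
    have "A.\<alpha> t g = t" if g: "g \<in> carrier G" for g
      using x(2) [OF g] t g by (intro inj_onD [OF A.c_inj]) (simp_all add: A.c_act)
    then obtain a where "a \<in> carrier A" "t = pure_tensor B Ep A \<one>\<^bsub>E\<^esub> a"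
      using A.unit_surj [OF t(1)] by blast
    then show "x \<in> unit_map A ` carrier A" using t by (auto simp: unit_map_def)
  qed (auto simp: unit_map_def fx)
  ultimately have "is_iso (module_cat B) A C.A0 (unit_map A)"
    by (rule is_iso_module_cat [OF A])
  then show "is_iso (module_cat B) (FObj id_funct A) (FObj (comp_funct Hu Fu) A) (unit_map A)"
    by (simp add: id_funct_def comp_funct_def)
  fix A' :: "('b, 'u) module" and f
  assume "A' \<in> Obj (module_cat B)" and "f \<in> Hom (module_cat B) (A :: ('b, 'u) module) A'"
  then have A': "module B A'" and f: "f \<in> mod_hom B A A'" by (simp_all add: strict_moduleD)
  have "unit_map A' (f a) = restrict (FHom Fu A A' f) (fixed_points G A.C) (unit_map A a)" if a: "a \<in> carrier A" for a
    using a fx [OF a] mod_homD(2) [OF f a]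
    by (simp add: unit_map_def FHom_encode [OF A] ext_map(1) [OF A A' f])
  then show "Comp (module_cat B) (FObj id_funct A) (FObj id_funct A') (FObj (comp_funct Hu Fu) A')
      (unit_map A') (FHom id_funct A A' f) =
    Comp (module_cat B) (FObj id_funct A) (FObj (comp_funct Hu Fu) A) (FObj (comp_funct Hu Fu) A')
      (FHom (comp_funct Hu Fu) A A' f) (unit_map A)"
    by (auto simp: id_funct_def comp_funct_def fixed_funct_simps(2) compose_def fun_eq_iff)
qed

definition counit_map :: "('e, 'u) module \<times> ('u \<Rightarrow> 'g \<Rightarrow> 'u) \<Rightarrow> 'u \<Rightarrow> 'u" where
  "counit_map Y = (let S = carrier (tensor_group B Ep (FObj Hu Y)) in
     (\<lambda>x\<in>encode S ` S. galois_counit.counit B E G p (fst Y) (snd Y) (decode S x)))"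

text \<open>On codes, \<open>counit_map\<close> is the counit on tensors, which supplies linearity,
  equivariance and bijectivity. Naturality is first shown on tensors, where it reduces to linearity
  of \<open>k\<close>.\<close>

lemma counit_natural: "natural_iso GM GM (comp_funct Fu Hu) id_funct counit_map"
  unfolding natural_iso_def
proof (intro conjI ballI)
  fix Y :: "('e, 'u) module \<times> ('u \<Rightarrow> 'g \<Rightarrow> 'u)" assume Y: "Y \<in> Obj GM"
  obtain D \<rho> where Y_eq: "Y = (D, \<rho>)" by (cases Y)
  interpret Y: galois_counit B E G p act D \<rho> using galois_counitI [OF Y] by (simp add: Y_eq)
  interpret A: descent_ext B E G p act U Y.A0 by (rule descent_extI [OF Y.module_A0])
  have eq: "counit_map Y (A.c t) = Y.counit t" if "t \<in> carrier Y.ext.T" for t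
    using that by (simp add: counit_map_def Y_eq Let_def A.decode_c)
  have ext: "counit_map Y \<in> extensional (carrier (fst A.C))"
    by (simp add: counit_map_def Y_eq Let_def A.C_carrier)
  have "counit_map Y \<in> mod_hom E (fst A.C) D"
  proof (rule mod_homI [OF ext])
    fix x y assume "x \<in> carrier (fst A.C)" "y \<in> carrier (fst A.C)"
    then obtain s t where st: "s \<in> carrier Y.ext.T" "t \<in> carrier Y.ext.T" "x = A.c s" "y = A.c t"
      by (metis A.C_cases)
    have "counit_map Y (A.c (s \<oplus>\<^bsub>Y.ext.X\<^esub> t)) = Y.counit s \<oplus>\<^bsub>D\<^esub> Y.counit t"
      using st Y.ext.X.a_closed [of s t] by (simp add: eq Y.counit_add del: Y.ext.ext_simps(3))
    then show "counit_map Y (x \<oplus>\<^bsub>fst A.C\<^esub> y) = counit_map Y x \<oplus>\<^bsub>D\<^esub> counit_map Y y"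
      using st by (simp add: A.c_add eq del: Y.ext.ext_simps(3))
  next
    fix e x assume e: "e \<in> carrier E" and "x \<in> carrier (fst A.C)"
    then obtain t where t: "t \<in> carrier Y.ext.T" "x = A.c t" by (metis A.C_cases)
    have "counit_map Y (A.c (e \<odot>\<^bsub>Y.ext.X\<^esub> t)) = e \<odot>\<^bsub>D\<^esub> Y.counit t"
      using e t by (simp add: eq Y.counit_smult)
    then show "counit_map Y (e \<odot>\<^bsub>fst A.C\<^esub> x) = e \<odot>\<^bsub>D\<^esub> counit_map Y x"
      using e t by (simp add: A.c_smult eq)
  qed (auto elim!: A.C_cases simp: eq)
  moreover have "counit_map Y (snd A.C x g) = \<rho> (counit_map Y x) g"
    if x: "x \<in> carrier (fst A.C)" and g: "g \<in> carrier G" for x g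
  proof -
    obtain t where t: "t \<in> carrier Y.ext.T" "x = A.c t" using x by (metis A.C_cases)
    then show ?thesis using g by (simp add: eq Y.counit_act flip: A.c_act)
  qed
  ultimately have hom: "counit_map Y \<in> Hom GM A.C Y"
    by (simp add: gmodule_cat_simps Y_eq)
  \<comment> \<open>The composite is the counit on tensors. As \<open>A.c\<close> is bijective onto
    the copy, bijectivity passes to \<open>counit_map\<close>.\<close>
  have "bij_betw (counit_map Y \<circ> A.c) (carrier Y.ext.T) (carrier D)"
    using bij_counit_descent [OF Y.galois_counit_axioms] by (rule bij_betw_cong [THEN iffD1, rotated]) (simp add: eq)
  moreover have "bij_betw A.c (carrier Y.ext.T) (carrier (fst A.C))"
    using A.c_inj by (simp add: bij_betw_def A.C_carrier)
  ultimately have "bij_betw (counit_map Y) (carrier (fst A.C)) (carrier D)"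
    by (simp add: bij_betw_comp_iff)
  then have "is_iso GM A.C Y (counit_map Y)"
    using is_iso_GM [OF A.C_obj hom] by (simp add: Y_eq)
  then show "is_iso GM (FObj (comp_funct Fu Hu) Y) (FObj id_funct Y) (counit_map Y)"
    by (simp add: id_funct_def comp_funct_def Y_eq)
  fix Y' :: "('e, 'u) module \<times> ('u \<Rightarrow> 'g \<Rightarrow> 'u)" and k
  assume Y': "Y' \<in> Obj GM" and k: "k \<in> Hom GM Y Y'"
  obtain D' \<rho>' where Y'_eq: "Y' = (D', \<rho>')" by (cases Y')
  interpret Y': galois_counit B E G p act D' \<rho>' using galois_counitI [OF Y'] by (simp add: Y'_eq)
  interpret A': descent_ext B E G p act U Y'.A0 by (rule descent_extI [OF Y'.module_A0])
  have eq': "counit_map Y' (A'.c t) = Y'.counit t" if "t \<in> carrier Y'.ext.T" for t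
    using that by (simp add: counit_map_def Y_eq Y'_eq Let_def A'.decode_c)
  have km: "k \<in> mod_hom E D D'" using k by (simp add: gmodule_cat_simps Y_eq Y'_eq)
  \<comment> \<open>This is \<open>k\<close> under the functor of invariants; the equation
    \<open>*\<close> is naturality before encoding.\<close>
  define r where "r = restrict k Y.Fix"
  have k0: "r \<in> mod_hom B Y.A0 Y'.A0"
    using fixed_hom [OF Y Y' k] by (simp add: Y_eq Y'_eq r_def)
  note ek = ext_map [OF Y.module_A0 Y'.module_A0 k0]
  have k_fix: "k a \<in> Y'.Fix" if "a \<in> Y.Fix" for a
    using mod_homD(2) [OF k0, of a] that by (simp add: r_def)
  have r: "r a = k a" if "a \<in> Y.Fix" for a
    using that by (simp add: r_def)
  have *: "Y'.counit (ext_map Y.A0 Y'.A0 r t) = k (Y.counit t)" if "t \<in> carrier Y.ext.T" for t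
    using that
  proof (induction rule: Y.ext.ext_induct)
    case zero
    have "k \<zero>\<^bsub>D\<^esub> = \<zero>\<^bsub>D'\<^esub>"
      by (rule additive_zero [OF Y.D.abelian_group_axioms Y'.D.abelian_group_axioms])
        (simp_all add: mod_homD [OF km])
    then show ?case by (simp only: ek(4) Y.counit_zero Y'.counit_zero)
  next
    case (pure e a t)
    then show ?case using k_fix [of a]
      by (simp add: ek r Y.counit_add Y'.counit_add Y.counit_pure Y'.counit_pure mod_homD [OF km]
          Y.Fix_closed del: Y.ext.ext_simps(3) Y'.ext.ext_simps(3))
  qed
  have "compose (carrier (fst A.C)) (counit_map Y') (FHom Fu Y.A0 Y'.A0 r) =
      compose (carrier (fst A.C)) k (counit_map Y)"
  proof (rule extensionalityI)
    fix x assume x: "x \<in> carrier (fst A.C)"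
    then obtain t where t: "t \<in> carrier Y.ext.T" "x = A.c t" by (metis A.C_cases)
    show "compose (carrier (fst A.C)) (counit_map Y') (FHom Fu Y.A0 Y'.A0 r) x =
        compose (carrier (fst A.C)) k (counit_map Y) x"
      using x t by (simp add: compose_eq FHom_encode [OF Y.module_A0] eq eq' * ek(2))
  qed simp_all
  then show "Comp GM (FObj (comp_funct Fu Hu) Y) (FObj (comp_funct Fu Hu) Y') (FObj id_funct Y')
      (counit_map Y') (FHom (comp_funct Fu Hu) Y Y' k) =
    Comp GM (FObj (comp_funct Fu Hu) Y) (FObj id_funct Y) (FObj id_funct Y')
      (FHom id_funct Y Y' k) (counit_map Y)"
    by (simp add: id_funct_def comp_funct_def gmodule_cat_simps fixed_funct_simps(2) Y_eq Y'_eq r_def)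
qed

lemma cat_equivalence_ext_fixed: "cat_equivalence (module_cat B) GM Fu Hu"
  unfolding cat_equivalence_def
  using is_functor_ext is_functor_fixed unit_natural counit_natural by blast

end

section \<open>Cocycles\<close>

context galois_data
begin

lemma twist_module_simps [simp]:
  "carrier (twist_module E act g D) = carrier D" "\<zero>\<^bsub>twist_module E act g D\<^esub> = \<zero>\<^bsub>D\<^esub>"
  "\<lbrakk>x \<in> carrier D; y \<in> carrier D\<rbrakk> \<Longrightarrow> x \<oplus>\<^bsub>twist_module E act g D\<^esub> y = x \<oplus>\<^bsub>D\<^esub> y"
  "\<lbrakk>e \<in> carrier E; x \<in> carrier D\<rbrakk> \<Longrightarrow> e \<odot>\<^bsub>twist_module E act g D\<^esub> x = act e g \<odot>\<^bsub>D\<^esub> x"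
  by (simp_all add: twist_module_def)

lemma strict_twist:
  assumes "module E D" "g \<in> carrier G"
  shows "strict_module E (twist_module E act g D)"
proof -
  interpret D: module E D by fact
  have "module E (twist_module E act g D)"
    by (intro moduleI abelian_groupI cring_E)
      (use assms(2) in \<open>auto simp: D.a_ac D.smult_l_distr D.smult_r_distr D.smult_assoc1 act_add act_mult
        intro: D.l_neg\<close>)
  then show ?thesis unfolding twist_module_def by (rule strict_module_mk_module)
qed

text \<open>\<open>act e \<one> = e\<close> is known on the carrier only. Strictness of
  \<open>D\<close>, which erases all other values, turns this into an equality of records.\<close>

lemma twist_one:
  assumes "strict_module E D"
  shows "twist_module E act \<one>\<^bsub>G\<^esub> D = D"
proof -
  have "twist_module E act \<one>\<^bsub>G\<^esub> D = mk_module E (carrier D) (add D) \<zero>\<^bsub>D\<^esub> (smult D)"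
    by (auto simp: twist_module_def mk_module_def restrict_def fun_eq_iff)
  then show ?thesis using assms by (simp add: strict_module_def)
qed

text \<open>Twisting turns the right action on scalars into a left action on modules: in the double
  twist a scalar is moved by \<open>h\<close> first and then acts through \<open>g\<close>.\<close>

lemma twist_mult:
  assumes "module E D" "g \<in> carrier G" "h \<in> carrier G"
  shows "twist_module E act (h \<otimes>\<^bsub>G\<^esub> g) D = twist_module E act h (twist_module E act g D)"
  using assms
  by (auto simp: twist_module_def [of E act "h \<otimes>\<^bsub>G\<^esub> g"] twist_module_def [of E act h] mk_module_def
      restrict_def fun_eq_iff act_act)

lemma mod_hom_twist:
  "f \<in> mod_hom E D D' \<Longrightarrow> g \<in> carrier G
    \<Longrightarrow> f \<in> mod_hom E (twist_module E act g D) (twist_module E act g D')"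
  by (intro mod_homI) (simp_all add: mod_homD)

abbreviation "EOp \<equiv> op_cat (module_cat E)"
abbreviation "Tw \<equiv> twist E act"

lemma G_category_twist:
  "G_category G (EOp :: (('e, 'a) module, 'a \<Rightarrow> 'a) category) Tw"
proof (intro G_category.intro G_category_axioms.intro group_G category_op_cat category_module_cat)
  fix g assume g: "g \<in> carrier G"
  show "is_functor (EOp :: (('e, 'a) module, 'a \<Rightarrow> 'a) category) EOp (Tw g)"
    by (intro is_functor.intro is_functor_axioms.intro category_op_cat category_module_cat)
      (use g in \<open>simp_all add: twist_def strict_twist strict_moduleD mod_hom_twist\<close>)
next
  show "eq_funct (EOp :: (('e, 'a) module, 'a \<Rightarrow> 'a) category) (Tw \<one>\<^bsub>G\<^esub>) id_funct"
    by (simp add: eq_funct_def twist_def id_funct_def twist_one)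
next
  fix g h assume "g \<in> carrier G" "h \<in> carrier G"
  then show "eq_funct (EOp :: (('e, 'a) module, 'a \<Rightarrow> 'a) category) (Tw (h \<otimes>\<^bsub>G\<^esub> g)) (comp_funct (Tw h) (Tw g))"
    by (simp add: eq_funct_def twist_def comp_funct_def twist_mult strict_moduleD)
qed

abbreviation "ZC \<equiv> op_cat (cocycle_cat G EOp Tw)"

lemma category_ZC: "category (ZC :: (('e, 'a) module \<times> ('g \<Rightarrow> 'a \<Rightarrow> 'a), 'a \<Rightarrow> 'a) category)"
  by (intro category_op_cat G_category.category_cocycle_cat G_category_twist)

text \<open>In the opposite category the arrow \<open>\<xi>\<^sub>g\<close> from \<open>g(D)\<close>
  to \<open>D\<close> is a homomorphism from \<open>D\<close> to its twist. The composite in the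
  cocycle condition reverses too, so \<open>hg\<close> acts by \<open>h\<close> first and then by
  \<open>g\<close>, as a right action must.\<close>

lemma ZC_obj_iff:
  "(D, \<xi>) \<in> Obj ZC \<longleftrightarrow> strict_module E D \<and>
    \<xi> \<in> (\<Pi>\<^sub>E g\<in>carrier G. mod_hom E D (twist_module E act g D)) \<and> \<xi> \<one>\<^bsub>G\<^esub> = (\<lambda>d\<in>carrier D. d) \<and>
    (\<forall>h\<in>carrier G. \<forall>g\<in>carrier G. \<xi> (h \<otimes>\<^bsub>G\<^esub> g) = compose (carrier D) (\<xi> g) (\<xi> h))"
  by (simp add: cocycle_cat_def twist_def)

text \<open>The two passages to the opposite cancel, so morphisms are again homomorphisms from
  \<open>fst X\<close> to \<open>fst Y\<close>.\<close>

lemma ZC_simps: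
  "Hom ZC X Y = {f \<in> mod_hom E (fst X) (fst Y). \<forall>g\<in>carrier G.
     compose (carrier (fst X)) (snd Y g) f = compose (carrier (fst X)) f (snd X g)}"
  "Ident ZC X = (\<lambda>d\<in>carrier (fst X). d)"
  "Comp ZC X Y Z k f = compose (carrier (fst X)) k f"
  by (auto simp: cocycle_cat_def twist_def split_beta)

abbreviation "J \<equiv> cocycle_to_gmodule G"

lemma J_simps:
  "FObj J X = (fst X, \<lambda>d\<in>carrier (fst X). \<lambda>g\<in>carrier G. snd X g d)" "FHom J X Y f = f"
  by (simp_all add: cocycle_to_gmodule_def split_beta)

lemma J_obj:
  assumes "X \<in> Obj ZC"
  shows "FObj J X \<in> Obj GM"
proof -
  obtain D \<xi> where X: "X = (D, \<xi>)" by (cases X)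
  have D: "strict_module E D" and \<xi>: "\<And>g. g \<in> carrier G \<Longrightarrow> \<xi> g \<in> mod_hom E D (twist_module E act g D)"
    and one: "\<xi> \<one>\<^bsub>G\<^esub> = (\<lambda>d\<in>carrier D. d)"
    and mult: "\<And>h g. \<lbrakk>h \<in> carrier G; g \<in> carrier G\<rbrakk> \<Longrightarrow> \<xi> (h \<otimes>\<^bsub>G\<^esub> g) = compose (carrier D) (\<xi> g) (\<xi> h)"
    using assms unfolding X ZC_obj_iff by auto
  interpret D: module E D using D by (rule strict_moduleD)
  have \<xi>D: "\<xi> g d \<in> carrier D" "d' \<in> carrier D \<Longrightarrow> \<xi> g (d \<oplus>\<^bsub>D\<^esub> d') = \<xi> g d \<oplus>\<^bsub>D\<^esub> \<xi> g d'"
    "e \<in> carrier E \<Longrightarrow> \<xi> g (e \<odot>\<^bsub>D\<^esub> d) = act e g \<odot>\<^bsub>D\<^esub> \<xi> g d"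
    if g: "g \<in> carrier G" and d: "d \<in> carrier D" for g d d' e
    using mod_homD(2-4) [OF \<xi> [OF g]] d by simp_all
  show ?thesis
    unfolding X J_simps fst_conv snd_conv
    by (rule gmodule_objI [OF D]) (simp_all add: \<xi>D one mult compose_eq)
qed

text \<open>Composites are restricted to the carrier, so their equality is equivariance at each
  element. The hom-sets are literally equal because \<open>J\<close> does not change
  morphisms.\<close>

lemma ZC_Hom: "Hom ZC X Y = Hom GM (FObj J X) (FObj J Y)"
proof -
  have "(compose (carrier (fst X)) (snd Y g) f = compose (carrier (fst X)) f (snd X g)) \<longleftrightarrow>
      (\<forall>d\<in>carrier (fst X). f (snd X g d) = snd Y g (f d))" for f g
    by (auto simp: compose_def restrict_def fun_eq_iff)
  then have "f \<in> Hom ZC X Y \<longleftrightarrow> f \<in> mod_hom E (fst X) (fst Y) \<and>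
      (\<forall>d\<in>carrier (fst X). \<forall>g\<in>carrier G. f (snd X g d) = snd Y g (f d))" for f
    unfolding ZC_simps by blast
  moreover have "f \<in> Hom GM (FObj J X) (FObj J Y) \<longleftrightarrow> f \<in> mod_hom E (fst X) (fst Y) \<and>
      (\<forall>d\<in>carrier (fst X). \<forall>g\<in>carrier G. f (snd X g d) = snd Y g (f d))" for f
    using mod_homD(2) [of f E "fst X" "fst Y"] by (auto simp: gmodule_cat_simps J_simps)
  ultimately show ?thesis by blast
qed

text \<open>The inverse interchanges the arguments \<open>g\<close> and \<open>d\<close>. Both
  composites are identities because actions and cocycles are extensional in each argument.\<close>

lemma J_bij: "bij_betw (FObj J) (Obj (ZC :: (('e, 'a) module \<times> _, 'a \<Rightarrow> 'a) category)) (Obj GM)"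
proof (rule bij_betw_byWitness [where f' = "\<lambda>(D, \<rho>). (D, \<lambda>g\<in>carrier G. \<lambda>d\<in>carrier D. \<rho> d g)"])
  show "\<forall>X\<in>Obj ZC. (\<lambda>(D, \<rho>). (D, \<lambda>g\<in>carrier G. \<lambda>d\<in>carrier D. \<rho> d g)) (FObj J X) = (X :: ('e, 'a) module \<times> _)"
  proof
    fix X :: "('e, 'a) module \<times> ('g \<Rightarrow> 'a \<Rightarrow> 'a)" assume ZC: "X \<in> Obj ZC"
    obtain D \<xi> where X: "X = (D, \<xi>)" by (cases X)
    have \<xi>: "\<xi> \<in> (\<Pi>\<^sub>E g\<in>carrier G. mod_hom E D (twist_module E act g D))"
      using ZC unfolding X ZC_obj_iff by blast
    have "(\<lambda>g\<in>carrier G. \<lambda>d\<in>carrier D. \<xi> g d) = \<xi>"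
    proof (rule extensionalityI [where A = "carrier G"])
      fix g assume g: "g \<in> carrier G"
      then have "\<xi> g \<in> extensional (carrier D)" using \<xi> mod_homD(1) by fastforce
      then show "(\<lambda>g\<in>carrier G. \<lambda>d\<in>carrier D. \<xi> g d) g = \<xi> g"
        using g by (simp add: extensional_restrict)
    qed (use \<xi> in \<open>auto simp: PiE_def\<close>)
    then show "(\<lambda>(D, \<rho>). (D, \<lambda>g\<in>carrier G. \<lambda>d\<in>carrier D. \<rho> d g)) (FObj J X) = X"
      by (simp add: X J_simps cong: restrict_cong)
  qed
  show "\<forall>Y\<in>Obj GM. FObj J ((\<lambda>(D, \<rho>). (D, \<lambda>g\<in>carrier G. \<lambda>d\<in>carrier D. \<rho> d g)) Y) = (Y :: ('e, 'a) module \<times> _)"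
  proof
    fix Y :: "('e, 'a) module \<times> ('a \<Rightarrow> 'g \<Rightarrow> 'a)" assume Y: "Y \<in> Obj GM"
    obtain D \<rho> where Y_eq: "Y = (D, \<rho>)" by (cases Y)
    interpret galois_module B E G p act D \<rho> using gmodule_objD [OF Y] by (simp add: Y_eq)
    have "(\<lambda>d\<in>carrier D. \<lambda>g\<in>carrier G. \<rho> d g) = \<rho>"
    proof (rule extensionalityI [where A = "carrier D"])
      fix d assume d: "d \<in> carrier D"
      then have "\<rho> d \<in> extensional (carrier G)" using \<rho>_ext by (auto simp: PiE_def Pi_iff)
      then show "(\<lambda>d\<in>carrier D. \<lambda>g\<in>carrier G. \<rho> d g) d = \<rho> d"
        using d by (simp add: extensional_restrict)
    qed (use \<rho>_ext in \<open>auto simp: PiE_def\<close>)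
    then show "FObj J ((\<lambda>(D, \<rho>). (D, \<lambda>g\<in>carrier G. \<lambda>d\<in>carrier D. \<rho> d g)) Y) = Y"
      by (simp add: Y_eq J_simps cong: restrict_cong)
  qed
  show "FObj J ` Obj (ZC :: (('e, 'a) module \<times> _, 'a \<Rightarrow> 'a) category) \<subseteq> Obj GM"
    using J_obj by blast
  show "(\<lambda>(D, \<rho>). (D, \<lambda>g\<in>carrier G. \<lambda>d\<in>carrier D. \<rho> d g)) ` Obj GM
      \<subseteq> Obj (ZC :: (('e, 'a) module \<times> _, 'a \<Rightarrow> 'a) category)"
  proof clarify
    fix D and \<rho> :: "'a \<Rightarrow> 'g \<Rightarrow> 'a" assume Y: "(D, \<rho>) \<in> Obj GM"
    interpret galois_module B E G p act D \<rho> using gmodule_objD [OF Y] by simp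
    show "(D, \<lambda>g\<in>carrier G. \<lambda>d\<in>carrier D. \<rho> d g) \<in> Obj ZC"
      unfolding ZC_obj_iff
      by (auto simp: strict \<rho>_mult \<rho>_add \<rho>_smult compose_def fun_eq_iff intro!: mod_homI)
  qed
qed

lemma cat_isomorphism_J:
  "cat_isomorphism (ZC :: (('e, 'a) module \<times> _, 'a \<Rightarrow> 'a) category) GM J"
proof -
  have "is_functor (ZC :: (('e, 'a) module \<times> _, 'a \<Rightarrow> 'a) category) GM J"
  proof (intro is_functor.intro is_functor_axioms.intro category_ZC category_GM)
    fix X Y Z :: "('e, 'a) module \<times> ('g \<Rightarrow> 'a \<Rightarrow> 'a)" and f g
    show "X \<in> Obj ZC \<Longrightarrow> FObj J X \<in> Obj GM" by (rule J_obj)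
    show "\<lbrakk>X \<in> Obj ZC; Y \<in> Obj ZC; f \<in> Hom ZC X Y\<rbrakk> \<Longrightarrow> FHom J X Y f \<in> Hom GM (FObj J X) (FObj J Y)"
      by (simp only: ZC_Hom J_simps(2))
    show "FHom J X X (Ident ZC X) = Ident GM (FObj J X)"
      "FHom J X Z (Comp ZC X Y Z g f) = Comp GM (FObj J X) (FObj J Y) (FObj J Z) (FHom J Y Z g) (FHom J X Y f)"
      by (simp_all only: ZC_simps gmodule_cat_simps J_simps fst_conv)
  qed
  moreover have "FHom J X Y = id" for X Y :: "('e, 'a) module \<times> ('g \<Rightarrow> 'a \<Rightarrow> 'a)"
    by (simp add: J_simps fun_eq_iff)
  ultimately show ?thesis
    unfolding cat_isomorphism_def using J_bij by (simp add: ZC_Hom bij_betw_def del: op_cat_simps)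
qed

end

theorem theorem4p3:
  fixes B :: "'b ring" and E :: "'e ring" and G :: "'g monoid"
    and p :: "'b \<Rightarrow> 'e" and act :: "'e \<Rightarrow> 'g \<Rightarrow> 'e"
  defines "BMod \<equiv> (module_cat B :: (('b, 'u) module, 'u \<Rightarrow> 'u) category)"
    and "EOp \<equiv> op_cat (module_cat E :: (('e, 'u) module, 'u \<Rightarrow> 'u) category)"
    and "GMod \<equiv> (gmodule_cat B E p G act ::
           (('e, 'u) module \<times> ('u \<Rightarrow> 'g \<Rightarrow> 'u), 'u \<Rightarrow> 'u) category)"
    and "Ep \<equiv> restrict_scalars B p (self_module E)"
  assumes "cring B" and "\<one>\<^bsub>B\<^esub> \<noteq> \<zero>\<^bsub>B\<^esub>"
    and "cring E" and "\<one>\<^bsub>E\<^esub> \<noteq> \<zero>\<^bsub>E\<^esub>"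
    and "p \<in> ring_hom B E"
    and "group G"
    and "ring_right_action G E act"
    and "\<forall>b\<in>carrier B. \<forall>g\<in>carrier G. act (p b) g = p b"
    and "infinite (UNIV :: 'u set)" and "carrier E \<lesssim> (UNIV :: 'u set)"
    and "pure_mono TYPE('u) B E p"
    and "bij_betw (galois_map B E p G act)
           (carrier (tensor_group B Ep Ep)) (carrier (map_algebra G E))"
    and "finite (carrier G)"
  shows "G_category G EOp (twist E act)
    \<and> cat_isomorphism (op_cat (cocycle_cat G EOp (twist E act))) GMod (cocycle_to_gmodule G)
    \<and> cat_equivalence BMod GMod (ext_funct B E p G act) (fixed_funct B p G)
    \<and> (\<exists>\<Phi> \<Psi>. cat_equivalence BMod (op_cat (cocycle_cat G EOp (twist E act))) \<Phi> \<Psi>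
         \<and> eq_funct BMod (comp_funct (cocycle_to_gmodule G) \<Phi>) (ext_funct B E p G act)
         \<and> eq_funct (op_cat (cocycle_cat G EOp (twist E act))) \<Psi>
             (comp_funct (fixed_funct B p G) (cocycle_to_gmodule G)))
    \<and> (\<forall>A\<in>Obj BMod.
         gmodule_isomorphic E G (ext_module B E p A, ext_action B E p G act A)
           (FObj (ext_funct B E p G act) A)
         \<and> (\<forall>e\<in>carrier E. \<forall>a\<in>carrier A. \<forall>g\<in>carrier G.
              ext_action B E p G act A (pure_tensor B Ep A e a) g = pure_tensor B Ep A (act e g) a))"
proof -
  interpret galois_descent B E G p act "TYPE('u)"
    by (intro galois_descent.intro galois_data.intro galois_descent_axioms.intro)
      (use assms(5-) in \<open>simp_all add: Ep_def\<close>)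
  interpret J: cat_iso "op_cat (cocycle_cat G EOp (twist E act))" GMod "cocycle_to_gmodule G"
    unfolding EOp_def GMod_def by unfold_locales (rule cat_isomorphism_J)
  have eq: "cat_equivalence BMod GMod (ext_funct B E p G act) (fixed_funct B p G)"
    unfolding BMod_def GMod_def by (rule cat_equivalence_ext_fixed)
  \<comment> \<open>\<open>\<Phi>\<close> is \<open>J.Ji\<close> after the extension functor and
    \<open>\<Psi>\<close> is the functor of invariants after \<open>cocycle_to_gmodule G\<close>, so
    the condition on \<open>\<Psi>\<close> holds by reflexivity.\<close>
  have "\<exists>\<Phi> \<Psi>. cat_equivalence BMod (op_cat (cocycle_cat G EOp (twist E act))) \<Phi> \<Psi>
         \<and> eq_funct BMod (comp_funct (cocycle_to_gmodule G) \<Phi>) (ext_funct B E p G act)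
         \<and> eq_funct (op_cat (cocycle_cat G EOp (twist E act))) \<Psi>
             (comp_funct (fixed_funct B p G) (cocycle_to_gmodule G))"
    using J.cat_equivalence_inv [OF eq] by (auto simp: eq_funct_def)
  moreover have "gmodule_isomorphic E G (ext_module B E p A, ext_action B E p G act A)
           (FObj (ext_funct B E p G act) A)
         \<and> (\<forall>e\<in>carrier E. \<forall>a\<in>carrier A. \<forall>g\<in>carrier G.
              ext_action B E p G act A (pure_tensor B Ep A e a) g = pure_tensor B Ep A (act e g) a)"
    if "A \<in> Obj BMod" for A
  proof -
    interpret A: descent_ext B E G p act "TYPE('u)" A
      using that by (intro descent_extI) (simp add: BMod_def strict_moduleD)
    show ?thesis
      using A.isomorphic_copy A.ext_action_pure by (simp add: Ep_def)
  qed
  ultimately show ?thesis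
    using eq J.iso G_category_twist unfolding EOp_def by blast
qed

end
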